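(* Let $\varphi$ be a unitary fiber functor on a compact quantum group $\mathbb G=(A,\Delta)$ such that $\dim H_{\varphi(x)}=\dim H_x$ for all $x\in\hat{\mathbb G}$. Then there exists a normalized unitary $2$-cocycle $\Omega$ on the dual $(\hat A,\hat\Delta)$, uniquely determined up to coboundary, such that $\varphi$ is isomorphic with the unitary fiber functor $\varphi_\Omega$.
   Context: A compact quantum group $\mathbb G=(A,\Delta)$ is a unital C$^*$-algebra $A$ with a unital coassociative $^*$-homomorphism $\Delta:A\to A\otimes A$ (minimal tensor product) such that $\Delta(A)(A\otimes1)$ and $\Delta(A)(1\otimes A)$ have dense linear span in $A\otimes A$. A finite-dimensional corepresentation on $H$ is a unitary $v\in B(H)\otimes A$ with $(\iota\otimes\Delta)(v)=v_{12}v_{13}$; $v\boxtimes w:=v_{13}w_{23}$; $\mathrm{Mor}(v,w)=\{S:(S\otimes1)v=w(S\otimes1)\}$; irreducible means $\mathrm{Mor}(v,v)=\mathbb C1$. $\hat{\mathbb G}$: classes of irreducible corepresentations, with representatives $U^x\in B(H_x)\otimes A$, $\epsilon$ the trivial one; in $\mathrm{Mor}$ we write $x$ for $U^x$. A unitary fiber functor $\varphi$ on $\mathbb G$ consists of a finite-dimensional Hilbert space $H_{\varphi(x)}$ for each $x\in\hat{\mathbb G}$ ($H_{\varphi(\epsilon)}=\mathbb C$) and linear maps $\varphi:\mathrm{Mor}(x_1\boxtimes\cdots\boxtimes x_r,y_1\boxtimes\cdots\boxtimes y_k)\to B(H_{\varphi(x_1)}\otimes\cdots\otimes H_{\varphi(x_r)},H_{\varphi(y_1)}\otimes\cdots\otimes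 H_{\varphi(y_k)})$ with $\varphi(1)=1$ (for $1\in\mathrm{Mor}(x,x)=\mathrm{Mor}(x,x\boxtimes\epsilon)=\mathrm{Mor}(x,\epsilon\boxtimes x)$), $\varphi(S\otimes T)=\varphi(S)\otimes\varphi(T)$, $\varphi(S^* )=\varphi(S)^*$, $\varphi(ST)=\varphi(S)\varphi(T)$ whenever these make sense. $\varphi$ and $\psi$ are isomorphic if there are unitaries $u_x\in B(H_{\varphi(x)},H_{\psi(x)})$ with $\psi(S)=(u_{y_1}\otimes\cdots\otimes u_{y_k})\varphi(S)(u_{x_1}^*\otimes\cdots\otimes u_{x_r}^* )$ for all $S\in\mathrm{Mor}(x_1\boxtimes\cdots\boxtimes x_r,y_1\boxtimes\cdots\boxtimes y_k)$. The dual discrete quantum group is $\hat A=\bigoplus_{x\in\hat{\mathbb G}}B(H_x)$ ($c_0$-direct sum) with $\hat\Delta:\hat A\to M(\hat A\otimes\hat A)$ determined by $\hat\Delta(a)S=Sa$ for all $a\in\hat A$, $S\in\mathrm{Mor}(x,y\boxtimes z)$. Here $M$ is the multiplier algebra, and $p_x$ is the minimal central projection of $\hat A$ corresponding to $B(H_x)$. A unitary $\Omega\in M(\hat A\otimes\hat A)$ is a unitary $2$-cocycle if $(\hat\Delta\otimes\iota)(\Omega)(\Omega\otimes1)=(\iota\otimes\hat\Delta)(\Omega)(1\otimes\Omega)$; it is normalized if $(p_\epsilon\otimes1)\Omega=p_\epsilon\otimes1$ and $(1\otimes p_\epsilon)\Omega=1\otimes p_\epsilon$. $\Omega_1,\Omega_2$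 differ by a coboundary if $\Omega_2=\hat\Delta(u)\Omega_1(u^*\otimes u^* )$ for some unitary $u\in M(\hat A)$. For a normalized unitary $2$-cocycle $\Omega$ put $\Omega_{(2)}=(\hat\Delta\otimes\iota)(\Omega)(\Omega\otimes1)$. $\varphi_\Omega$ is the unique unitary fiber functor on $\mathbb G$ with $H_{\varphi_\Omega(x)}=H_x$, $\varphi_\Omega(S)=\Omega^*S$ for $S\in\mathrm{Mor}(x,y\boxtimes z)$ and $\varphi_\Omega(T)=\Omega_{(2)}^*T$ for $T\in\mathrm{Mor}(a,x\boxtimes y\boxtimes z)$. *)

theory Defs
  imports
    "HOL-Analysis.Elementary_Topology"
    "Jordan_Normal_Form.Schur_Decomposition"
begin

section \<open>Unital C*-algebras\<close>

class cstar_algebra = real_normed_algebra_1 + complete_space +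
  fixes scaleC :: "complex \<Rightarrow> 'a \<Rightarrow> 'a" (infixr \<open>*\<^sub>C\<close> 75)
    and star :: "'a \<Rightarrow> 'a"
  assumes scaleC_add_right: "c *\<^sub>C (x + y) = c *\<^sub>C x + c *\<^sub>C y"
    and scaleC_add_left: "(c + d) *\<^sub>C x = c *\<^sub>C x + d *\<^sub>C x"
    and scaleC_scaleC: "c *\<^sub>C (d *\<^sub>C x) = (c * d) *\<^sub>C x"
    and scaleC_of_real: "complex_of_real r *\<^sub>C x = r *\<^sub>R x"
    and norm_scaleC: "norm (c *\<^sub>C x) = cmod c * norm x"
    and mult_scaleC_left: "(c *\<^sub>C x) * y = c *\<^sub>C (x * y)"
    and mult_scaleC_right: "x * (c *\<^sub>C y) = c *\<^sub>C (x * y)"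
    and star_add: "star (x + y) = star x + star y"
    and star_scaleC: "star (c *\<^sub>C x) = cnj c *\<^sub>C star x"
    and star_mult: "star (x * y) = star y * star x"
    and star_star: "star (star x) = x"
    and cstar_identity: "norm (star x * x) = (norm x)\<^sup>2"

instantiation complex :: cstar_algebra
begin
definition scaleC_complex :: "complex \<Rightarrow> complex \<Rightarrow> complex" where "scaleC_complex = (*)"
definition star_complex :: "complex \<Rightarrow> complex" where "star_complex = cnj"
instance
  by standard
    (simp_all add: scaleC_complex_def star_complex_def algebra_simps scaleR_conv_of_real
      norm_mult power2_eq_square)
end

definition complex_linear :: "('a::cstar_algebra \<Rightarrow> 'b::cstar_algebra) \<Rightarrow> bool" where
  "complex_linear f \<longleftrightarrow>
     (\<forall>x y. f (x + y) = f x + f y) \<and> (\<forall>c x. f (c *\<^sub>C x) = c *\<^sub>C f x)"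

definition unital_star_hom :: "('a::cstar_algebra \<Rightarrow> 'b::cstar_algebra) \<Rightarrow> bool" where
  "unital_star_hom f \<longleftrightarrow> complex_linear f \<and> f 1 = 1 \<and>
     (\<forall>x y. f (x * y) = f x * f y) \<and> (\<forall>x. f (star x) = star (f x))"

definition state :: "('a::cstar_algebra \<Rightarrow> complex) \<Rightarrow> bool" where
  "state f \<longleftrightarrow> complex_linear f \<and> f 1 = 1 \<and>
     (\<forall>a. Im (f (star a * a)) = 0 \<and> 0 \<le> Re (f (star a * a)))"


section \<open>The minimal tensor product\<close>

text \<open>A list of pairs \<open>[(a\<^sub>1, b\<^sub>1), \<dots>]\<close> stands for the element \<open>\<Sum> a\<^sub>i \<otimes> b\<^sub>i\<close> of the algebraic
  tensor product of two C*-algebras.\<close>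

definition formal_mult ::
    "('a::times \<times> 'b::times) list \<Rightarrow> ('a \<times> 'b) list \<Rightarrow> ('a \<times> 'b) list" where
  "formal_mult s t = map (\<lambda>((a, b), (c, d)). (a * c, b * d)) (List.product s t)"

definition formal_star ::
    "('a::cstar_algebra \<times> 'b::cstar_algebra) list \<Rightarrow> ('a \<times> 'b) list" where
  "formal_star t = map (\<lambda>(a, b). (star a, star b)) t"

definition product_functional ::
    "('a \<Rightarrow> complex) \<Rightarrow> ('b \<Rightarrow> complex) \<Rightarrow> ('a \<times> 'b) list \<Rightarrow> complex" where
  "product_functional f g t = (\<Sum>(a, b)\<leftarrow>t. f a * g b)"

text \<open>The norm of \<open>(\<pi> \<otimes> \<rho>)(t)\<close>, where \<open>\<pi>\<close> and \<open>\<rho>\<close> are the universal representations, i.e. the direct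
  sums of the GNS representations \<open>\<pi>\<^sub>f\<close>, \<open>\<rho>\<^sub>g\<close> over all states. On the dense subspace of vectors
  \<open>\<Sum> c\<^sub>j \<xi>\<^sub>f \<otimes> d\<^sub>j \<xi>\<^sub>g\<close>, given by \<open>s = \<Sum> c\<^sub>j \<otimes> d\<^sub>j\<close>, the norm squared is \<open>(f \<otimes> g)(s\<^sup>* s)\<close>.\<close>

definition minimal_norm :: "('a::cstar_algebra \<times> 'b::cstar_algebra) list \<Rightarrow> real" where
  "minimal_norm t = Sup {sqrt (Re (product_functional f g
        (formal_mult (formal_star (formal_mult t s)) (formal_mult t s)))) | f g s.
      state f \<and> state g \<and> product_functional f g (formal_mult (formal_star s) s) = 1}"

text \<open>\<open>tens\<close> exhibits its target as the minimal C*-tensor product, i.e. as the completion of the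
  algebraic tensor product in the minimal norm; the norm condition includes that the algebraic
  tensor product embeds. The set of elementary tensors is stable under complex scalars, so
  its real span is its complex span.\<close>

definition minimal_tensor_product ::
    "('a::cstar_algebra \<Rightarrow> 'b::cstar_algebra \<Rightarrow> 'c::cstar_algebra) \<Rightarrow> bool" where
  "minimal_tensor_product tens \<longleftrightarrow>
     (\<forall>b. complex_linear (\<lambda>a. tens a b)) \<and> (\<forall>a. complex_linear (tens a)) \<and>
     tens 1 1 = 1 \<and>
     (\<forall>a b c d. tens a b * tens c d = tens (a * c) (b * d)) \<and>
     (\<forall>a b. star (tens a b) = tens (star a) (star b)) \<and>
     (\<forall>t. norm (\<Sum>(a, b)\<leftarrow>t. tens a b) = minimal_norm t) \<and>
     closure (span {tens a b | a b. True}) = UNIV"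

definition tensor_hom ::
    "('a \<Rightarrow> 'b \<Rightarrow> 'c::cstar_algebra) \<Rightarrow> ('d \<Rightarrow> 'e \<Rightarrow> 'f::cstar_algebra) \<Rightarrow>
      ('a \<Rightarrow> 'd) \<Rightarrow> ('b \<Rightarrow> 'e) \<Rightarrow> 'c \<Rightarrow> 'f" where
  "tensor_hom tens tens' f g =
     (THE h. unital_star_hom h \<and> (\<forall>a b. h (tens a b) = tens' (f a) (g b)))"


section \<open>Compact quantum groups\<close>

text \<open>\<open>tens\<close> realises \<open>A \<otimes> A\<close>; \<open>tensL\<close> and \<open>tensR\<close> realise the triple tensor product as
  \<open>(A \<otimes> A) \<otimes> A\<close> and as \<open>A \<otimes> (A \<otimes> A)\<close> on one and the same C*-algebra.
  As before, the real spans in the density conditions are complex subspaces.\<close>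

locale compact_quantum_group =
  fixes tens :: "'a::cstar_algebra \<Rightarrow> 'a \<Rightarrow> 'b::cstar_algebra"
    and tensL :: "'b \<Rightarrow> 'a \<Rightarrow> 'c::cstar_algebra"
    and tensR :: "'a \<Rightarrow> 'b \<Rightarrow> 'c"
    and Delta :: "'a \<Rightarrow> 'b"
  assumes tens: "minimal_tensor_product tens"
    and tensL: "minimal_tensor_product tensL"
    and tensR: "minimal_tensor_product tensR"
    and tens_assoc: "tensL (tens a b) c = tensR a (tens b c)"
    and Delta_hom: "unital_star_hom Delta"
    and coassociative:
      "tensor_hom tens tensL Delta id (Delta a) = tensor_hom tens tensR id Delta (Delta a)"
    and density_left: "closure (span {Delta a * tens b 1 | a b. True}) = UNIV"
    and density_right: "closure (span {Delta a * tens 1 b | a b. True}) = UNIV"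


section \<open>Corepresentations and intertwiners\<close>

text \<open>Finite-dimensional Hilbert spaces are the spaces \<open>\<complex>\<^sup>n\<close>; operators between them are
  complex matrices, and \<open>B(\<complex>\<^sup>n) \<otimes> A\<close> is the algebra of \<open>n \<times> n\<close> matrices over \<open>A\<close>. Via the
  Kronecker product, \<open>\<complex>\<^sup>m \<otimes> \<complex>\<^sup>n = \<complex>\<^sup>m\<^sup>n\<close>, and this is strictly associative with strict unit \<open>\<complex>\<close>.\<close>

definition kronecker :: "'a::times mat \<Rightarrow> 'a mat \<Rightarrow> 'a mat" (infixl \<open>\<otimes>\<^sub>m\<close> 75) where
  "A \<otimes>\<^sub>m B = mat (dim_row A * dim_row B) (dim_col A * dim_col B)
     (\<lambda>(i, j). A $$ (i div dim_row B, j div dim_col B) * B $$ (i mod dim_row B, j mod dim_col B))"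

definition kronecker_list :: "complex mat list \<Rightarrow> complex mat" where
  "kronecker_list As = foldr (\<otimes>\<^sub>m) As (1\<^sub>m 1)"

definition unitary_mat :: "complex mat \<Rightarrow> bool" where
  "unitary_mat S \<longleftrightarrow>
     mat_adjoint S * S = 1\<^sub>m (dim_col S) \<and> S * mat_adjoint S = 1\<^sub>m (dim_row S)"

definition star_mat :: "'a::cstar_algebra mat \<Rightarrow> 'a mat" where
  "star_mat v = mat (dim_col v) (dim_row v) (\<lambda>(i, j). star (v $$ (j, i)))"

definition corepresentation ::
    "('a::cstar_algebra \<Rightarrow> 'a \<Rightarrow> 'b::cstar_algebra) \<Rightarrow> ('a \<Rightarrow> 'b) \<Rightarrow> 'a mat \<Rightarrow> bool" where
  "corepresentation tens Delta v \<longleftrightarrow>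
     square_mat v \<and>
     star_mat v * v = 1\<^sub>m (dim_row v) \<and> v * star_mat v = 1\<^sub>m (dim_row v) \<and>
     map_mat Delta v = map_mat (\<lambda>a. tens a 1) v * map_mat (\<lambda>a. tens 1 a) v"

definition boxtimes :: "'a::cstar_algebra mat \<Rightarrow> 'a mat \<Rightarrow> 'a mat" (infixr \<open>\<boxtimes>\<close> 70) where
  "v \<boxtimes> w = (v \<otimes>\<^sub>m 1\<^sub>m (dim_row w)) * (1\<^sub>m (dim_row v) \<otimes>\<^sub>m w)"

definition amplify :: "complex mat \<Rightarrow> 'a::cstar_algebra mat" where
  "amplify S = map_mat (\<lambda>c. c *\<^sub>C 1) S"

definition Mor :: "'a::cstar_algebra mat \<Rightarrow> 'a mat \<Rightarrow> complex mat set" where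
  "Mor v w = {S \<in> carrier_mat (dim_row w) (dim_row v). amplify S * v = w * amplify S}"

definition irreducible_corepresentation ::
    "('a::cstar_algebra \<Rightarrow> 'a \<Rightarrow> 'b::cstar_algebra) \<Rightarrow> ('a \<Rightarrow> 'b) \<Rightarrow> 'a mat \<Rightarrow> bool" where
  "irreducible_corepresentation tens Delta v \<longleftrightarrow>
     corepresentation tens Delta v \<and> 0 < dim_row v \<and>
     Mor v v = {c \<cdot>\<^sub>m 1\<^sub>m (dim_row v) | c. True}"

definition equivalent_corepresentations :: "'a::cstar_algebra mat \<Rightarrow> 'a mat \<Rightarrow> bool" where
  "equivalent_corepresentations v w \<longleftrightarrow> (\<exists>S \<in> Mor v w. unitary_mat S)"

text \<open>The type \<open>'i\<close> plays the role of the set of classes of irreducible corepresentations,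
  with representatives \<open>U x\<close> and the trivial class \<open>\<epsilon>\<close>.\<close>

locale compact_quantum_group_irreps = compact_quantum_group tens tensL tensR Delta
  for tens :: "'a::cstar_algebra \<Rightarrow> 'a \<Rightarrow> 'b::cstar_algebra"
    and tensL :: "'b \<Rightarrow> 'a \<Rightarrow> 'c::cstar_algebra"
    and tensR :: "'a \<Rightarrow> 'b \<Rightarrow> 'c"
    and Delta :: "'a \<Rightarrow> 'b" +
  fixes U :: "'i \<Rightarrow> 'a mat"
    and \<epsilon> :: 'i
  assumes irreducible_U: "irreducible_corepresentation tens Delta (U x)"
    and representatives: "irreducible_corepresentation tens Delta v \<Longrightarrow>
      \<exists>!x. equivalent_corepresentations v (U x)"
    and trivial: "U \<epsilon> = 1\<^sub>m 1"

definition irr_dim :: "('i \<Rightarrow> 'a mat) \<Rightarrow> 'i \<Rightarrow> nat" where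
  "irr_dim U x = dim_row (U x)"

definition irr_mor ::
    "('i \<Rightarrow> 'a::cstar_algebra mat) \<Rightarrow> 'i list \<Rightarrow> 'i list \<Rightarrow> complex mat set" where
  "irr_mor U xs ys = Mor (foldr (\<boxtimes>) (map U xs) (1\<^sub>m 1)) (foldr (\<boxtimes>) (map U ys) (1\<^sub>m 1))"


section \<open>Unitary fiber functors\<close>

text \<open>\<open>fib_map \<phi> xs ys\<close> is the map on \<open>irr_mor U xs ys\<close>, for non-empty lists \<open>xs\<close> and \<open>ys\<close>. It has the
  value \<open>undefined\<close> outside this domain, so that functors with the same values are equal.\<close>

record 'i fiber_data =
  fib_dim :: "'i \<Rightarrow> nat"
  fib_map :: "'i list \<Rightarrow> 'i list \<Rightarrow> complex mat \<Rightarrow> complex mat"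

definition unitary_fiber_functor ::
    "('i \<Rightarrow> 'a::cstar_algebra mat) \<Rightarrow> 'i \<Rightarrow> 'i fiber_data \<Rightarrow> bool" where
  "unitary_fiber_functor U \<epsilon> \<phi> \<longleftrightarrow>
     (let d = fib_dim \<phi>; F = fib_map \<phi>; Dom = (\<lambda>xs ys S. xs \<noteq> [] \<and> ys \<noteq> [] \<and> S \<in> irr_mor U xs ys) in
       d \<epsilon> = 1 \<and>
       (\<forall>xs ys S. Dom xs ys S \<longrightarrow>
          F xs ys S \<in> carrier_mat (prod_list (map d ys)) (prod_list (map d xs))) \<and>
       (\<forall>xs ys S. \<not> Dom xs ys S \<longrightarrow> F xs ys S = undefined) \<and>
       (\<forall>xs ys S T. Dom xs ys S \<longrightarrow> Dom xs ys T \<longrightarrow>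
          F xs ys (S + T) = F xs ys S + F xs ys T) \<and>
       (\<forall>xs ys S c. Dom xs ys S \<longrightarrow> F xs ys (c \<cdot>\<^sub>m S) = c \<cdot>\<^sub>m F xs ys S) \<and>
       (\<forall>x. F [x] [x] (1\<^sub>m (irr_dim U x)) = 1\<^sub>m (d x)) \<and>
       (\<forall>x. F [x] [x, \<epsilon>] (1\<^sub>m (irr_dim U x)) = 1\<^sub>m (d x)) \<and>
       (\<forall>x. F [x] [\<epsilon>, x] (1\<^sub>m (irr_dim U x)) = 1\<^sub>m (d x)) \<and>
       (\<forall>xs ys S xs' ys' T. Dom xs ys S \<longrightarrow> Dom xs' ys' T \<longrightarrow>
          F (xs @ xs') (ys @ ys') (S \<otimes>\<^sub>m T) = F xs ys S \<otimes>\<^sub>m F xs' ys' T) \<and>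
       (\<forall>xs ys S. Dom xs ys S \<longrightarrow> F ys xs (mat_adjoint S) = mat_adjoint (F xs ys S)) \<and>
       (\<forall>xs ys zs S T. Dom ys zs S \<longrightarrow> Dom xs ys T \<longrightarrow>
          F xs zs (S * T) = F ys zs S * F xs ys T))"

definition isomorphic_fiber_functors ::
    "('i \<Rightarrow> 'a::cstar_algebra mat) \<Rightarrow> 'i fiber_data \<Rightarrow> 'i fiber_data \<Rightarrow> bool" where
  "isomorphic_fiber_functors U \<phi> \<psi> \<longleftrightarrow>
     (\<exists>u. (\<forall>x. u x \<in> carrier_mat (fib_dim \<psi> x) (fib_dim \<phi> x) \<and> unitary_mat (u x)) \<and>
       (\<forall>xs ys. xs \<noteq> [] \<longrightarrow> ys \<noteq> [] \<longrightarrow> (\<forall>S \<in> irr_mor U xs ys.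
          fib_map \<psi> xs ys S = kronecker_list (map u ys) * fib_map \<phi> xs ys S *
            kronecker_list (map (\<lambda>x. mat_adjoint (u x)) xs))))"


section \<open>The dual discrete quantum group\<close>

definition hilbert_norm :: "complex vec \<Rightarrow> real" where
  "hilbert_norm v = sqrt (Re (v \<bullet>c v))"

definition operator_norm :: "complex mat \<Rightarrow> real" where
  "operator_norm S = Sup {hilbert_norm (S *\<^sub>v v) | v. v \<in> carrier_vec (dim_col S) \<and> hilbert_norm v \<le> 1}"

definition families :: "('j \<Rightarrow> nat) \<Rightarrow> ('j \<Rightarrow> complex mat) set" where
  "families d = {a. \<forall>j. a j \<in> carrier_mat (d j) (d j)}"

definition family_mult ::
    "('j \<Rightarrow> complex mat) \<Rightarrow> ('j \<Rightarrow> complex mat) \<Rightarrow> 'j \<Rightarrow> complex mat" (infixl \<open>\<star>\<close> 70) where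
  "a \<star> b = (\<lambda>j. a j * b j)"

definition family_adjoint :: "('j \<Rightarrow> complex mat) \<Rightarrow> 'j \<Rightarrow> complex mat" where
  "family_adjoint a = (\<lambda>j. mat_adjoint (a j))"

definition family_one :: "('j \<Rightarrow> nat) \<Rightarrow> 'j \<Rightarrow> complex mat" where
  "family_one d = (\<lambda>j. 1\<^sub>m (d j))"

text \<open>The \<open>c\<^sub>0\<close>-direct sum of the matrix algebras \<open>B(\<complex>\<^sup>d\<^sup>j)\<close>, and its multiplier algebra as the
  idealizer in the algebra of all families.\<close>

definition c0_sum :: "('j \<Rightarrow> nat) \<Rightarrow> ('j \<Rightarrow> complex mat) set" where
  "c0_sum d = {a \<in> families d. \<forall>e>0. finite {j. operator_norm (a j) \<ge> e}}"

definition multipliers :: "('j \<Rightarrow> nat) \<Rightarrow> ('j \<Rightarrow> complex mat) set" where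
  "multipliers d = {m \<in> families d. \<forall>a \<in> c0_sum d. m \<star> a \<in> c0_sum d \<and> a \<star> m \<in> c0_sum d}"

definition unitary_multiplier :: "('j \<Rightarrow> nat) \<Rightarrow> ('j \<Rightarrow> complex mat) \<Rightarrow> bool" where
  "unitary_multiplier d m \<longleftrightarrow> m \<in> multipliers d \<and>
     family_adjoint m \<star> m = family_one d \<and> m \<star> family_adjoint m = family_one d"

text \<open>The dual algebra is \<open>c0_sum (irr_dim U)\<close>. Its tensor square is the \<open>c\<^sub>0\<close>-direct sum of the
  algebras \<open>B(H\<^sub>y) \<otimes> B(H\<^sub>z) = B(H\<^sub>y \<otimes> H\<^sub>z)\<close> over all pairs \<open>(y, z)\<close>, i.e. \<open>c0_sum (irr_dim2 U)\<close>.\<close>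

definition irr_dim2 :: "('i \<Rightarrow> 'a mat) \<Rightarrow> 'i \<times> 'i \<Rightarrow> nat" where
  "irr_dim2 U = (\<lambda>(y, z). irr_dim U y * irr_dim U z)"

definition family_tensor ::
    "('j \<Rightarrow> complex mat) \<Rightarrow> ('k \<Rightarrow> complex mat) \<Rightarrow> 'j \<times> 'k \<Rightarrow> complex mat" where
  "family_tensor a b = (\<lambda>(j, k). a j \<otimes>\<^sub>m b k)"

definition central_projection :: "('i \<Rightarrow> 'a mat) \<Rightarrow> 'i \<Rightarrow> 'i \<Rightarrow> complex mat" where
  "central_projection U x =
     (\<lambda>y. if y = x then 1\<^sub>m (irr_dim U y) else 0\<^sub>m (irr_dim U y) (irr_dim U y))"

text \<open>The dual comultiplication, on the dual algebra and extended to its multipliers; both are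
  given by \<open>Delta_hat(a) S = S a\<close> for \<open>S \<in> Mor(x, y \<boxtimes> z)\<close>, where in the block at \<open>(y, z)\<close> only the
  component of \<open>a\<close> at \<open>x\<close> is involved.\<close>

definition Delta_hat ::
    "('i \<Rightarrow> 'a::cstar_algebra mat) \<Rightarrow> ('i \<Rightarrow> complex mat) \<Rightarrow> 'i \<times> 'i \<Rightarrow> complex mat" where
  "Delta_hat U a = (\<lambda>(y, z). THE m.
     m \<in> carrier_mat (irr_dim2 U (y, z)) (irr_dim2 U (y, z)) \<and>
     (\<forall>x. \<forall>S \<in> irr_mor U [x] [y, z]. m * S = S * a x))"

text \<open>\<open>Delta_hat \<otimes> \<iota>\<close> and \<open>\<iota> \<otimes> Delta_hat\<close> on multipliers of the tensor square. In the first case,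
  write the component at a fixed \<open>z\<close> in the second leg as \<open>\<Sum> X\<^sub>k\<^sub>l \<otimes> e\<^sub>k\<^sub>l\<close> with matrix units \<open>e\<^sub>k\<^sub>l\<close> of
  \<open>B(H\<^sub>z)\<close>, and apply \<open>Delta_hat\<close> to each \<open>X\<^sub>k\<^sub>l\<close>; similarly in the second case.\<close>

definition slice_snd ::
    "('i \<Rightarrow> 'a mat) \<Rightarrow> ('i \<times> 'i \<Rightarrow> complex mat) \<Rightarrow> 'i \<Rightarrow> nat \<Rightarrow> nat \<Rightarrow> 'i \<Rightarrow> complex mat" where
  "slice_snd U X z k l = (\<lambda>w. mat (irr_dim U w) (irr_dim U w)
     (\<lambda>(i, j). X (w, z) $$ (i * irr_dim U z + k, j * irr_dim U z + l)))"

definition slice_fst ::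
    "('i \<Rightarrow> 'a mat) \<Rightarrow> ('i \<times> 'i \<Rightarrow> complex mat) \<Rightarrow> 'i \<Rightarrow> nat \<Rightarrow> nat \<Rightarrow> 'i \<Rightarrow> complex mat" where
  "slice_fst U X x k l = (\<lambda>w. mat (irr_dim U w) (irr_dim U w)
     (\<lambda>(i, j). X (x, w) $$ (k * irr_dim U w + i, l * irr_dim U w + j)))"

definition Delta_hat_id ::
    "('i \<Rightarrow> 'a::cstar_algebra mat) \<Rightarrow> ('i \<times> 'i \<Rightarrow> complex mat) \<Rightarrow> 'i \<times> 'i \<times> 'i \<Rightarrow> complex mat" where
  "Delta_hat_id U X = (\<lambda>(x, y, z). let n = irr_dim U z; N = irr_dim2 U (x, y) * n in
     mat N N (\<lambda>(i, j).
       Delta_hat U (slice_snd U X z (i mod n) (j mod n)) (x, y) $$ (i div n, j div n)))"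

definition id_Delta_hat ::
    "('i \<Rightarrow> 'a::cstar_algebra mat) \<Rightarrow> ('i \<times> 'i \<Rightarrow> complex mat) \<Rightarrow> 'i \<times> 'i \<times> 'i \<Rightarrow> complex mat" where
  "id_Delta_hat U X = (\<lambda>(x, y, z). let n = irr_dim2 U (y, z); N = irr_dim U x * n in
     mat N N (\<lambda>(i, j).
       Delta_hat U (slice_fst U X x (i div n) (j div n)) (y, z) $$ (i mod n, j mod n)))"

definition tensor_one ::
    "('i \<Rightarrow> 'a mat) \<Rightarrow> ('i \<times> 'i \<Rightarrow> complex mat) \<Rightarrow> 'i \<times> 'i \<times> 'i \<Rightarrow> complex mat" where
  "tensor_one U X = (\<lambda>(x, y, z). X (x, y) \<otimes>\<^sub>m 1\<^sub>m (irr_dim U z))"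

definition one_tensor ::
    "('i \<Rightarrow> 'a mat) \<Rightarrow> ('i \<times> 'i \<Rightarrow> complex mat) \<Rightarrow> 'i \<times> 'i \<times> 'i \<Rightarrow> complex mat" where
  "one_tensor U X = (\<lambda>(x, y, z). 1\<^sub>m (irr_dim U x) \<otimes>\<^sub>m X (y, z))"

definition unitary_2_cocycle ::
    "('i \<Rightarrow> 'a::cstar_algebra mat) \<Rightarrow> ('i \<times> 'i \<Rightarrow> complex mat) \<Rightarrow> bool" where
  "unitary_2_cocycle U \<Omega> \<longleftrightarrow> unitary_multiplier (irr_dim2 U) \<Omega> \<and>
     Delta_hat_id U \<Omega> \<star> tensor_one U \<Omega> = id_Delta_hat U \<Omega> \<star> one_tensor U \<Omega>"

definition normalized ::
    "('i \<Rightarrow> 'a::cstar_algebra mat) \<Rightarrow> 'i \<Rightarrow> ('i \<times> 'i \<Rightarrow> complex mat) \<Rightarrow> bool" where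
  "normalized U \<epsilon> \<Omega> \<longleftrightarrow>
     (let p = central_projection U \<epsilon>; one = family_one (irr_dim U) in
       family_tensor p one \<star> \<Omega> = family_tensor p one \<and>
       family_tensor one p \<star> \<Omega> = family_tensor one p)"

definition differ_by_coboundary ::
    "('i \<Rightarrow> 'a::cstar_algebra mat) \<Rightarrow> ('i \<times> 'i \<Rightarrow> complex mat) \<Rightarrow> ('i \<times> 'i \<Rightarrow> complex mat) \<Rightarrow> bool"
  where
  "differ_by_coboundary U \<Omega>\<^sub>1 \<Omega>\<^sub>2 \<longleftrightarrow> (\<exists>u. unitary_multiplier (irr_dim U) u \<and>
     \<Omega>\<^sub>2 = Delta_hat U u \<star> \<Omega>\<^sub>1 \<star> family_tensor (family_adjoint u) (family_adjoint u))"


section \<open>The fiber functor of a cocycle\<close>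

definition cocycle_2 ::
    "('i \<Rightarrow> 'a::cstar_algebra mat) \<Rightarrow> ('i \<times> 'i \<Rightarrow> complex mat) \<Rightarrow> 'i \<times> 'i \<times> 'i \<Rightarrow> complex mat" where
  "cocycle_2 U \<Omega> = Delta_hat_id U \<Omega> \<star> tensor_one U \<Omega>"

definition cocycle_fiber_functor ::
    "('i \<Rightarrow> 'a::cstar_algebra mat) \<Rightarrow> 'i \<Rightarrow> ('i \<times> 'i \<Rightarrow> complex mat) \<Rightarrow> 'i fiber_data" where
  "cocycle_fiber_functor U \<epsilon> \<Omega> = (THE \<phi>. unitary_fiber_functor U \<epsilon> \<phi> \<and>
     fib_dim \<phi> = irr_dim U \<and>
     (\<forall>x y z. \<forall>S \<in> irr_mor U [x] [y, z].
        fib_map \<phi> [x] [y, z] S = mat_adjoint (\<Omega> (y, z)) * S) \<and>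
     (\<forall>a x y z. \<forall>T \<in> irr_mor U [a] [x, y, z].
        fib_map \<phi> [a] [x, y, z] T = mat_adjoint (cocycle_2 U \<Omega> (x, y, z)) * T))"

end

theory Submission
  imports Defs "Jordan_Normal_Form.Spectral_Radius"
begin

text \<open>Since \<open>\<phi>(x)\<close> and \<open>x\<close> have spaces of equal dimension, both spaces are \<open>\<complex>\<^sup>d\<close> for the same \<open>d\<close>, and the operators
  \<open>\<phi>(S)\<close> and \<open>S\<close> can be compared directly. By complete reducibility the intertwiners \<open>S\<close> from irreducible
  corepresentations \<open>x\<close> to \<open>y \<otimes> z\<close> have ranges that span the space of \<open>y \<otimes> z\<close>, and by Schur's lemma
  \<open>S\<^sup>* T\<close> is a multiple of the identity or zero for any two of them, so that \<open>\<phi>(S)\<^sup>* \<phi>(T) = \<phi>(S\<^sup>* T) = S\<^sup>* T\<close>. Hence there is a unique unitary \<open>\<Omega>\<close> on this space with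
  \<open>\<phi>(S) = \<Omega>\<^sup>* S\<close> for all these \<open>S\<close>. In the same way every word of irreducible corepresentations has a
  structure unitary. The structure unitary of \<open>x \<otimes> y \<otimes> z\<close> can be computed through \<open>(x \<otimes> y) \<otimes> z\<close> and through
  \<open>x \<otimes> (y \<otimes> z)\<close>, and comparing the results gives the cocycle identity (\<open>functor_cocycle_triple\<close>). The
  values on the intertwiners from \<open>x\<close> to \<open>y \<otimes> z\<close> determine a functor with these dimensions (\<open>functor_determined\<close>),
  so \<open>\<phi>\<close> is even equal to \<open>\<phi>\<^sub>\<Omega>\<close>.

  For the uniqueness it has to be known that \<open>\<phi>\<^sub>\<Omega>\<close> exists for every normalized unitary 2-cocycle \<open>\<Omega>\<close>. It is
  constructed as conjugation by iterated cocycles (\<open>twisted_functor\<close>); the cocycle identity, extended to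
  words, makes it monoidal. Unitaries that conjugate one such functor into another then
  exhibit the two cocycles as differing by a coboundary
  (\<open>isomorphic_cocycles_differ_by_coboundary\<close>).

  The two consequences of complete reducibility that are used throughout are stated as properties of the
  intertwiners from irreducible corepresentations to a corepresentation \<open>v\<close>: they separate operators on
  \<open>v\<close> (\<open>intertwiners_separate\<close>), and linear data on them extend to operators on \<open>v\<close>
  (\<open>intertwiners_extend\<close>). Both are proved by splitting \<open>v\<close> along the range of \<open>S - e\<close>, for an eigenvalue \<open>e\<close> of a
  non-scalar self-intertwiner \<open>S\<close>. Because \<open>v\<close> is unitary, this range and its orthogonal complement are both invariant.\<close>

section \<open>Matrices, adjoints and Kronecker products\<close>

text \<open>Entries of products are expanded into explicit sums by \<open>mult_mat_entry\<close>, and not into scalar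
  products of rows and columns, because the sums can be reindexed along Kronecker products.\<close>

declare index_mult_mat(1) [simp del]

lemma mult_mat_assoc:
  fixes A B C :: "'a::semiring_0 mat"
  assumes "dim_col A = dim_row B" "dim_col B = dim_row C"
  shows "A * B * C = A * (B * C)"
  by (rule assoc_mult_mat[of A "dim_row A" "dim_row B" B "dim_row C" C "dim_col C"])
    (use assms in auto)

lemma mult_mat_entry:
  fixes A B :: "'a::semiring_0 mat"
  assumes "i < dim_row A" "j < dim_col B" "dim_col A = dim_row B"
  shows "(A * B) $$ (i, j) = (\<Sum>k<dim_row B. A $$ (i, k) * B $$ (k, j))"
  using assms by (auto simp: index_mult_mat(1) scalar_prod_def lessThan_atLeast0 intro!: sum.cong)

lemma mat_adjoint_dim [simp]: "dim_row (mat_adjoint A) = dim_col A" "dim_col (mat_adjoint A) = dim_row A"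
  by (simp_all add: mat_adjoint_def mat_of_rows_def)

lemma mat_adjoint_entry [simp]:
  "i < dim_col A \<Longrightarrow> j < dim_row A \<Longrightarrow> mat_adjoint A $$ (i, j) = conjugate (A $$ (j, i))"
  by (simp add: mat_adjoint_def mat_of_rows_def)

lemma mat_adjoint_carrier [simp]: "mat_adjoint A \<in> carrier_mat m n \<longleftrightarrow> A \<in> carrier_mat n m"
  by (metis carrier_matD carrier_matI mat_adjoint_dim)

lemma mat_adjoint_adjoint [simp]: "mat_adjoint (mat_adjoint A) = A" for A :: "complex mat"
  by (rule eq_matI) auto

lemma mat_adjoint_one [simp]: "mat_adjoint (1\<^sub>m n :: complex mat) = 1\<^sub>m n"
  by (rule eq_matI) auto

lemma mat_adjoint_smult [simp]: "mat_adjoint (c \<cdot>\<^sub>m A) = cnj c \<cdot>\<^sub>m mat_adjoint A" for A :: "complex mat"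
  by (rule eq_matI) auto

lemma mat_adjoint_add:
  fixes A B :: "complex mat"
  assumes "dim_row A = dim_row B" "dim_col A = dim_col B"
  shows "mat_adjoint (A + B) = mat_adjoint A + mat_adjoint B"
  by (rule eq_matI) (use assms in auto)

lemma mat_adjoint_minus:
  fixes A B :: "complex mat"
  assumes "dim_row A = dim_row B" "dim_col A = dim_col B"
  shows "mat_adjoint (A - B) = mat_adjoint A - mat_adjoint B"
  by (rule eq_matI) (use assms in auto)

lemma mat_adjoint_mult [simp]:
  fixes A B :: "complex mat"
  assumes "dim_col A = dim_row B"
  shows "mat_adjoint (A * B) = mat_adjoint B * mat_adjoint A"
proof (rule eq_matI)
  fix i j assume "i < dim_row (mat_adjoint B * mat_adjoint A)" "j < dim_col (mat_adjoint B * mat_adjoint A)"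
  then show "mat_adjoint (A * B) $$ (i, j) = (mat_adjoint B * mat_adjoint A) $$ (i, j)"
    using assms by (simp add: mult_mat_entry) (simp add: mult.commute)
qed (use assms in auto)

lemma div_mod_bounds:
  fixes i m n :: nat
  assumes "i < m * n"
  shows "i div n < m" "i mod n < n"
  using assms by (cases "n = 0"; simp add: less_mult_imp_div_less)+

lemma pair_index_bound:
  fixes p m k n :: nat
  assumes "p < m" "k < n"
  shows "p * n + k < m * n"
proof -
  have "p * n + k < Suc p * n" using assms by simp
  also have "\<dots> \<le> m * n" using assms by (intro mult_right_mono) auto
  finally show ?thesis .
qed

text \<open>The row index of a Kronecker product is a pair \<open>(a, b)\<close> coded as \<open>a n + b\<close>.\<close>

lemma sum_div_mod:
  fixes f :: "nat \<Rightarrow> nat \<Rightarrow> 'a::comm_monoid_add"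
  shows "(\<Sum>k<m * n. f (k div n) (k mod n)) = (\<Sum>a<m. \<Sum>b<n. f a b)"
proof -
  have "(\<Sum>a<m. \<Sum>b<n. f a b) = (\<Sum>(a, b)\<in>{..<m} \<times> {..<n}. f a b)"
    by (rule sum.cartesian_product)
  also have "\<dots> = (\<Sum>k<m * n. f (k div n) (k mod n))"
    by (rule sum.reindex_bij_witness[where i = "\<lambda>k. (k div n, k mod n)" and j = "\<lambda>(a, b). a * n + b"])
      (auto simp: div_mod_bounds pair_index_bound)
  finally show ?thesis by simp
qed

lemma kronecker_dim [simp]:
  "dim_row (A \<otimes>\<^sub>m B) = dim_row A * dim_row B" "dim_col (A \<otimes>\<^sub>m B) = dim_col A * dim_col B"
  by (simp_all add: kronecker_def)

lemma kronecker_entry [simp]: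
  assumes "i < dim_row A * dim_row B" "j < dim_col A * dim_col B"
  shows "(A \<otimes>\<^sub>m B) $$ (i, j) =
    A $$ (i div dim_row B, j div dim_col B) * B $$ (i mod dim_row B, j mod dim_col B)"
  using assms by (simp add: kronecker_def)

text \<open>Kronecker products are also formed over non-commutative C*-algebras, where
  \<open>(A \<otimes> B)(C \<otimes> D) = A C \<otimes> B D\<close> requires \<open>B\<close> and \<open>C\<close> to commute entrywise.\<close>

definition entries_commute :: "'a::times mat \<Rightarrow> 'a mat \<Rightarrow> bool" where
  "entries_commute B C \<longleftrightarrow> (\<forall>i<dim_row B. \<forall>j<dim_col B. \<forall>k<dim_row C. \<forall>l<dim_col C.
     B $$ (i, j) * C $$ (k, l) = C $$ (k, l) * B $$ (i, j))"

lemma kronecker_mult: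
  fixes A B C D :: "'a::semiring_0 mat"
  assumes "dim_col A = dim_row C" "dim_col B = dim_row D" "entries_commute B C"
  shows "(A \<otimes>\<^sub>m B) * (C \<otimes>\<^sub>m D) = (A * C) \<otimes>\<^sub>m (B * D)"
proof (rule eq_matI)
  fix i j
  assume "i < dim_row ((A * C) \<otimes>\<^sub>m (B * D))" "j < dim_col ((A * C) \<otimes>\<^sub>m (B * D))"
  then have i: "i < dim_row A * dim_row B" and j: "j < dim_col C * dim_col D" by auto
  note i' = div_mod_bounds[OF i] and j' = div_mod_bounds[OF j]
  let ?f = "\<lambda>a b. A $$ (i div dim_row B, a) * C $$ (a, j div dim_col D) *
      (B $$ (i mod dim_row B, b) * D $$ (b, j mod dim_col D))"
  have termwise: "(A \<otimes>\<^sub>m B) $$ (i, k) * (C \<otimes>\<^sub>m D) $$ (k, j) = ?f (k div dim_row D) (k mod dim_row D)"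
    if k: "k < dim_row C * dim_row D" for k
  proof -
    note k' = div_mod_bounds[OF k]
    have comm: "B $$ (i mod dim_row B, k mod dim_row D) * C $$ (k div dim_row D, j div dim_col D) =
        C $$ (k div dim_row D, j div dim_col D) * B $$ (i mod dim_row B, k mod dim_row D)"
      using assms i' j' k' by (auto simp: entries_commute_def)
    have "a * b * (c * d) = a * c * (b * d)" if "b * c = c * b" for a b c d :: 'a
      using that by (metis mult.assoc)
    from this[OF comm] show ?thesis
      using i j k assms by simp
  qed
  have "((A \<otimes>\<^sub>m B) * (C \<otimes>\<^sub>m D)) $$ (i, j) =
      (\<Sum>k<dim_row (C \<otimes>\<^sub>m D). (A \<otimes>\<^sub>m B) $$ (i, k) * (C \<otimes>\<^sub>m D) $$ (k, j))"
    by (rule mult_mat_entry) (use i j assms in auto)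
  also have "\<dots> = (\<Sum>k<dim_row C * dim_row D. ?f (k div dim_row D) (k mod dim_row D))"
    by (rule sum.cong) (use termwise in auto)
  also have "\<dots> = (\<Sum>a<dim_row C. \<Sum>b<dim_row D. ?f a b)" by (rule sum_div_mod)
  also have "\<dots> = ((A * C) \<otimes>\<^sub>m (B * D)) $$ (i, j)"
    using i j i' j' assms
    by (simp add: mult_mat_entry sum_product)
  finally show "((A \<otimes>\<^sub>m B) * (C \<otimes>\<^sub>m D)) $$ (i, j) = ((A * C) \<otimes>\<^sub>m (B * D)) $$ (i, j)" .
qed auto

lemma kronecker_mult_complex:
  fixes A B C D :: "complex mat"
  assumes "dim_col A = dim_row C" "dim_col B = dim_row D"
  shows "(A \<otimes>\<^sub>m B) * (C \<otimes>\<^sub>m D) = (A * C) \<otimes>\<^sub>m (B * D)"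
  by (rule kronecker_mult) (use assms in \<open>auto simp: entries_commute_def mult.commute\<close>)

lemma kronecker_assoc:
  fixes A B C :: "'a::semigroup_mult mat"
  shows "A \<otimes>\<^sub>m B \<otimes>\<^sub>m C = A \<otimes>\<^sub>m (B \<otimes>\<^sub>m C)"
proof (rule eq_matI)
  fix i j
  assume "i < dim_row (A \<otimes>\<^sub>m (B \<otimes>\<^sub>m C))" "j < dim_col (A \<otimes>\<^sub>m (B \<otimes>\<^sub>m C))"
  then have i: "i < dim_row A * (dim_row B * dim_row C)" "i < dim_row A * dim_row B * dim_row C"
    and j: "j < dim_col A * (dim_col B * dim_col C)" "j < dim_col A * dim_col B * dim_col C"
    by (auto simp: mult.assoc)
  have *: "k div (b * c) = k div c div b" "k mod (b * c) div c = k div c mod b"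
    "k mod (b * c) mod c = k mod c" for k b c :: nat
  proof -
    show "k div (b * c) = k div c div b" by (metis div_mult2_eq mult.commute)
    have kk: "k mod (b * c) = c * (k div c mod b) + k mod c" by (metis mod_mult2_eq mult.commute)
    show "k mod (b * c) div c = k div c mod b" unfolding kk by (cases "c = 0") simp_all
    show "k mod (b * c) mod c = k mod c" unfolding kk by simp
  qed
  show "(A \<otimes>\<^sub>m B \<otimes>\<^sub>m C) $$ (i, j) = (A \<otimes>\<^sub>m (B \<otimes>\<^sub>m C)) $$ (i, j)"
    using i j div_mod_bounds[OF i(1)] div_mod_bounds[OF j(1)] div_mod_bounds[OF i(2)] div_mod_bounds[OF j(2)]
    by (simp add: * mult.assoc)
qed (auto simp: mult.assoc)

lemma kronecker_one_one [simp]: "(1\<^sub>m m \<otimes>\<^sub>m 1\<^sub>m n :: 'a::semiring_1 mat) = 1\<^sub>m (m * n)"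
proof (rule eq_matI)
  fix i j assume "i < dim_row (1\<^sub>m (m * n) :: 'a mat)" "j < dim_col (1\<^sub>m (m * n) :: 'a mat)"
  then have i: "i < m * n" and j: "j < m * n" by auto
  have "i = j \<longleftrightarrow> i div n = j div n \<and> i mod n = j mod n"
    by (metis div_mult_mod_eq)
  then show "(1\<^sub>m m \<otimes>\<^sub>m 1\<^sub>m n) $$ (i, j) = (1\<^sub>m (m * n) :: 'a mat) $$ (i, j)"
    using i j div_mod_bounds[OF i] div_mod_bounds[OF j] by auto
qed auto

lemma kronecker_one_right [simp]: "A \<otimes>\<^sub>m 1\<^sub>m (Suc 0) = (A :: 'a::semiring_1 mat)"
  by (rule eq_matI) auto

lemma kronecker_one_left [simp]: "1\<^sub>m (Suc 0) \<otimes>\<^sub>m A = (A :: 'a::semiring_1 mat)"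
proof (rule eq_matI)
  fix i j assume *: "i < dim_row A" "j < dim_col A"
  show "(1\<^sub>m (Suc 0) \<otimes>\<^sub>m A) $$ (i, j) = A $$ (i, j)"
    using * by simp
qed auto

lemma kronecker_adjoint [simp]:
  fixes A B :: "complex mat"
  shows "mat_adjoint (A \<otimes>\<^sub>m B) = mat_adjoint A \<otimes>\<^sub>m mat_adjoint B"
proof (rule eq_matI)
  fix i j assume "i < dim_row (mat_adjoint A \<otimes>\<^sub>m mat_adjoint B)" "j < dim_col (mat_adjoint A \<otimes>\<^sub>m mat_adjoint B)"
  then have i: "i < dim_col A * dim_col B" and j: "j < dim_row A * dim_row B" by auto
  show "mat_adjoint (A \<otimes>\<^sub>m B) $$ (i, j) = (mat_adjoint A \<otimes>\<^sub>m mat_adjoint B) $$ (i, j)"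
    using i j div_mod_bounds[OF i] div_mod_bounds[OF j] by simp
qed auto

lemma kronecker_add_left:
  fixes A B C :: "complex mat"
  assumes "dim_row A = dim_row B" "dim_col A = dim_col B"
  shows "(A + B) \<otimes>\<^sub>m C = A \<otimes>\<^sub>m C + B \<otimes>\<^sub>m C"
proof (rule eq_matI)
  fix i j assume "i < dim_row (A \<otimes>\<^sub>m C + B \<otimes>\<^sub>m C)" "j < dim_col (A \<otimes>\<^sub>m C + B \<otimes>\<^sub>m C)"
  then have i: "i < dim_row B * dim_row C" and j: "j < dim_col B * dim_col C" by auto
  show "((A + B) \<otimes>\<^sub>m C) $$ (i, j) = (A \<otimes>\<^sub>m C + B \<otimes>\<^sub>m C) $$ (i, j)"
    using i j div_mod_bounds[OF i] div_mod_bounds[OF j] assms by (simp add: algebra_simps)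
qed (use assms in auto)

lemma kronecker_add_right:
  fixes A B C :: "complex mat"
  assumes "dim_row A = dim_row B" "dim_col A = dim_col B"
  shows "C \<otimes>\<^sub>m (A + B) = C \<otimes>\<^sub>m A + C \<otimes>\<^sub>m B"
proof (rule eq_matI)
  fix i j assume "i < dim_row (C \<otimes>\<^sub>m A + C \<otimes>\<^sub>m B)" "j < dim_col (C \<otimes>\<^sub>m A + C \<otimes>\<^sub>m B)"
  then have i: "i < dim_row C * dim_row B" and j: "j < dim_col C * dim_col B" by auto
  show "(C \<otimes>\<^sub>m (A + B)) $$ (i, j) = (C \<otimes>\<^sub>m A + C \<otimes>\<^sub>m B) $$ (i, j)"
    using i j div_mod_bounds[OF i] div_mod_bounds[OF j] assms by (simp add: algebra_simps)
qed (use assms in auto)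

lemma kronecker_smult_left: "(c \<cdot>\<^sub>m A) \<otimes>\<^sub>m B = c \<cdot>\<^sub>m (A \<otimes>\<^sub>m B)" for A B :: "complex mat"
proof (rule eq_matI)
  fix i j assume "i < dim_row (c \<cdot>\<^sub>m (A \<otimes>\<^sub>m B))" "j < dim_col (c \<cdot>\<^sub>m (A \<otimes>\<^sub>m B))"
  then have i: "i < dim_row A * dim_row B" and j: "j < dim_col A * dim_col B" by auto
  show "((c \<cdot>\<^sub>m A) \<otimes>\<^sub>m B) $$ (i, j) = (c \<cdot>\<^sub>m (A \<otimes>\<^sub>m B)) $$ (i, j)"
    using i j div_mod_bounds[OF i] div_mod_bounds[OF j] by simp
qed auto

lemma kronecker_smult_right: "A \<otimes>\<^sub>m (c \<cdot>\<^sub>m B) = c \<cdot>\<^sub>m (A \<otimes>\<^sub>m B)" for A B :: "complex mat"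
proof (rule eq_matI)
  fix i j assume "i < dim_row (c \<cdot>\<^sub>m (A \<otimes>\<^sub>m B))" "j < dim_col (c \<cdot>\<^sub>m (A \<otimes>\<^sub>m B))"
  then have i: "i < dim_row A * dim_row B" and j: "j < dim_col A * dim_col B" by auto
  show "(A \<otimes>\<^sub>m (c \<cdot>\<^sub>m B)) $$ (i, j) = (c \<cdot>\<^sub>m (A \<otimes>\<^sub>m B)) $$ (i, j)"
    using i j div_mod_bounds[OF i] div_mod_bounds[OF j] by simp
qed auto

lemma unitary_matD:
  assumes "unitary_mat S"
  shows "mat_adjoint S * S = 1\<^sub>m (dim_col S)" "S * mat_adjoint S = 1\<^sub>m (dim_row S)"
  using assms by (auto simp: unitary_mat_def)

lemma square_isometry_unitary:
  assumes "dim_row S = dim_col S" "mat_adjoint S * S = 1\<^sub>m (dim_col S)"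
  shows "unitary_mat S"
proof -
  have "S * mat_adjoint S = 1\<^sub>m (dim_col S)"
    by (rule mat_mult_left_right_inverse[OF _ _ assms(2)]) (use assms(1) in \<open>auto intro!: carrier_matI\<close>)
  then show ?thesis using assms by (simp add: unitary_mat_def)
qed

lemma unitary_mat_adjoint: "unitary_mat S \<Longrightarrow> unitary_mat (mat_adjoint S)"
  by (simp add: unitary_mat_def)

lemma unitary_mat_one: "unitary_mat (1\<^sub>m n)"
  by (simp add: unitary_mat_def)

lemma unitary_mat_mult:
  assumes "unitary_mat S" "unitary_mat T" "dim_col S = dim_row T"
  shows "unitary_mat (S * T)"
proof -
  have "mat_adjoint (S * T) * (S * T) = mat_adjoint T * ((mat_adjoint S * S) * T)"
    using assms(3) by (simp add: mult_mat_assoc)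
  moreover have "S * T * mat_adjoint (S * T) = S * ((T * mat_adjoint T) * mat_adjoint S)"
    using assms(3) by (simp add: mult_mat_assoc)
  ultimately show ?thesis
    using assms by (simp add: unitary_mat_def)
qed

lemma unitary_mat_kronecker: "unitary_mat S \<Longrightarrow> unitary_mat T \<Longrightarrow> unitary_mat (S \<otimes>\<^sub>m T)"
  by (simp add: unitary_mat_def kronecker_mult_complex)

lemma unitary_cancel_left:
  assumes "unitary_mat S" "dim_row A = dim_col S"
  shows "mat_adjoint S * (S * A) = A"
  using assms by (simp add: unitary_mat_def flip: mult_mat_assoc)

lemma unitary_cancel_left':
  assumes "unitary_mat S" "dim_row A = dim_row S"
  shows "S * (mat_adjoint S * A) = A"
  using assms by (simp add: unitary_mat_def flip: mult_mat_assoc)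


section \<open>Isometries onto ranges\<close>

lemma mat_mult_add_right:
  fixes A B C :: "'a::semiring_0 mat"
  assumes "dim_col A = dim_row B" "dim_row B = dim_row C" "dim_col B = dim_col C"
  shows "A * (B + C) = A * B + A * C"
  by (rule mult_add_distrib_mat[of A "dim_row A" "dim_row B" B "dim_col B" C])
    (use assms in \<open>auto intro!: carrier_matI\<close>)

lemma mat_mult_add_left:
  fixes A B C :: "'a::semiring_0 mat"
  assumes "dim_col B = dim_row A" "dim_row B = dim_row C" "dim_col B = dim_col C"
  shows "(B + C) * A = B * A + C * A"
  by (rule add_mult_distrib_mat[of B "dim_row B" "dim_row A" C A "dim_col A"])
    (use assms in \<open>auto intro!: carrier_matI\<close>)

lemma mat_mult_minus_right:
  fixes A B C :: "complex mat"
  assumes "dim_col A = dim_row B" "dim_row B = dim_row C" "dim_col B = dim_col C"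
  shows "A * (B - C) = A * B - A * C"
  by (rule mult_minus_distrib_mat[of A "dim_row A" "dim_row B" B "dim_col B" C])
    (use assms in \<open>auto intro!: carrier_matI\<close>)

lemma mat_mult_minus_left:
  fixes A B C :: "complex mat"
  assumes "dim_col B = dim_row A" "dim_row B = dim_row C" "dim_col B = dim_col C"
  shows "(B - C) * A = B * A - C * A"
  by (rule minus_mult_distrib_mat[of B "dim_row B" "dim_row A" C A "dim_col A"])
    (use assms in \<open>auto intro!: carrier_matI\<close>)

lemma mat_mult_smult_right: "dim_col A = dim_row B \<Longrightarrow> A * (c \<cdot>\<^sub>m B) = c \<cdot>\<^sub>m (A * B)"
  for A B :: "complex mat"
  by (rule mult_smult_distrib) (auto intro!: carrier_matI)

lemma mat_mult_smult_left: "dim_col A = dim_row B \<Longrightarrow> (c \<cdot>\<^sub>m A) * B = c \<cdot>\<^sub>m (A * B)"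
  for A B :: "complex mat"
  by (rule mult_smult_assoc_mat) (auto intro!: carrier_matI)

lemma mat_smult_smult: "c \<cdot>\<^sub>m (d \<cdot>\<^sub>m A) = (c * d) \<cdot>\<^sub>m A" for A :: "complex mat"
  by (rule eq_matI) auto

lemma one_smult_mat [simp]: "1 \<cdot>\<^sub>m A = (A :: complex mat)"
  by (rule eq_matI) auto

lemma add_zero_mat_dim [simp]:
  fixes A :: "complex mat"
  assumes "dim_row A = m" "dim_col A = n"
  shows "A + 0\<^sub>m m n = A" "0\<^sub>m m n + A = A"
  by (rule eq_matI; use assms in simp)+

definition unit_column :: "nat \<Rightarrow> nat \<Rightarrow> complex mat" where
  "unit_column m j = mat m 1 (\<lambda>(i, _). if i = j then 1 else 0)"

lemma unit_column_dim [simp]: "dim_row (unit_column m j) = m" "dim_col (unit_column m j) = 1"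
  by (simp_all add: unit_column_def)

lemma mult_unit_column_entry:
  assumes "i < dim_row A" "j < dim_col A" "dim_col A = m"
  shows "(A * unit_column m j) $$ (i, 0) = A $$ (i, j)"
proof -
  have "(A * unit_column m j) $$ (i, 0) = (\<Sum>k<m. A $$ (i, k) * unit_column m j $$ (k, 0))"
    using assms by (subst mult_mat_entry) auto
  also have "\<dots> = (\<Sum>k<m. if k = j then A $$ (i, k) else 0)"
    by (rule sum.cong) (auto simp: unit_column_def)
  finally show ?thesis using assms by simp
qed

lemma mat_eq_by_columns:
  fixes A B :: "complex mat"
  assumes "A \<in> carrier_mat n m" "B \<in> carrier_mat n m"
    and "\<And>j. j < m \<Longrightarrow> A * unit_column m j = B * unit_column m j"
  shows "A = B"
proof (rule eq_matI)
  fix i j assume *: "i < dim_row B" "j < dim_col B"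
  then have "(A * unit_column m j) $$ (i, 0) = A $$ (i, j)" "(B * unit_column m j) $$ (i, 0) = B $$ (i, j)"
    using assms(1,2) by (simp_all add: mult_unit_column_entry)
  moreover have "A * unit_column m j = B * unit_column m j"
    using assms * by auto
  ultimately show "A $$ (i, j) = B $$ (i, j)" by metis
qed (use assms in auto)

text \<open>The canonical projections of \<open>\<complex>\<^sup>k \<oplus> \<complex>\<close> onto its two summands.\<close>

definition drop_last :: "nat \<Rightarrow> complex mat" where
  "drop_last k = mat k (Suc k) (\<lambda>(i, j). if i = j then 1 else 0)"

definition take_last :: "nat \<Rightarrow> complex mat" where
  "take_last k = mat 1 (Suc k) (\<lambda>(i, j). if j = k then 1 else 0)"

lemma drop_take_dim [simp]:
  "dim_row (drop_last k) = k" "dim_col (drop_last k) = Suc k"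
  "dim_row (take_last k) = 1" "dim_col (take_last k) = Suc k"
  by (simp_all add: drop_last_def take_last_def)

lemma drop_take_relations:
  "drop_last k * mat_adjoint (drop_last k) = 1\<^sub>m k"
  "take_last k * mat_adjoint (take_last k) = 1\<^sub>m 1"
  "drop_last k * mat_adjoint (take_last k) = 0\<^sub>m k 1"
  "take_last k * mat_adjoint (drop_last k) = 0\<^sub>m 1 k"
  "mat_adjoint (drop_last k) * drop_last k + mat_adjoint (take_last k) * take_last k = 1\<^sub>m (Suc k)"
proof -
  have *: "(if P then 1 else 0) * (if Q then 1 else 0) = (if P then if Q then 1 else 0 else (0 :: complex))"
    for P Q by simp
  have **: "cnj (if P then 1 else 0) = (if P then 1 else 0)" for P by simp
  show "drop_last k * mat_adjoint (drop_last k) = 1\<^sub>m k"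
    by (rule eq_matI) (auto simp: mult_mat_entry drop_last_def * ** sum.delta')
  show "take_last k * mat_adjoint (take_last k) = 1\<^sub>m 1"
    by (rule eq_matI) (auto simp: mult_mat_entry take_last_def * ** simp del: sum.lessThan_Suc)
  show "drop_last k * mat_adjoint (take_last k) = 0\<^sub>m k 1"
    by (rule eq_matI) (auto simp: mult_mat_entry drop_last_def take_last_def * ** simp del: sum.lessThan_Suc)
  show "take_last k * mat_adjoint (drop_last k) = 0\<^sub>m 1 k"
    by (rule eq_matI) (auto simp: mult_mat_entry drop_last_def take_last_def * ** simp del: sum.lessThan_Suc)
  show "mat_adjoint (drop_last k) * drop_last k + mat_adjoint (take_last k) * take_last k = 1\<^sub>m (Suc k)"
    by (rule eq_matI) (auto simp: mult_mat_entry drop_last_def take_last_def * **)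
qed

lemma trace_mult_commute:
  fixes A B :: "complex mat"
  assumes "A \<in> carrier_mat m n" "B \<in> carrier_mat n m"
  shows "(\<Sum>i<m. (A * B) $$ (i, i)) = (\<Sum>j<n. (B * A) $$ (j, j))"
proof -
  have "(\<Sum>i<m. (A * B) $$ (i, i)) = (\<Sum>i<m. \<Sum>j<n. A $$ (i, j) * B $$ (j, i))"
    using assms by (intro sum.cong refl) (auto simp: mult_mat_entry)
  also have "\<dots> = (\<Sum>j<n. \<Sum>i<m. B $$ (j, i) * A $$ (i, j))"
    by (subst sum.swap) (simp add: mult.commute)
  also have "\<dots> = (\<Sum>j<n. (B * A) $$ (j, j))"
    using assms by (intro sum.cong refl) (auto simp: mult_mat_entry)
  finally show ?thesis .
qed

lemma adjoint_zero [simp]: "mat_adjoint (0\<^sub>m m n :: complex mat) = 0\<^sub>m n m"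
  by (rule eq_matI) auto

text \<open>Gram--Schmidt: going through the columns of \<open>T\<close>, a column that is not yet fixed by the
  projection \<open>W W\<^sup>*\<close> contributes its normalised component orthogonal to \<open>W\<close> as a new column.\<close>

lemma isometry_onto_range:
  fixes T :: "complex mat"
  assumes T: "T \<in> carrier_mat n m"
  obtains k W X where "W \<in> carrier_mat n k" "X \<in> carrier_mat m k" "W = T * X"
    "mat_adjoint W * W = 1\<^sub>m k" "W * (mat_adjoint W * T) = T"
proof -
  have dimT [simp]: "dim_row T = n" "dim_col T = m" using T by auto
  have "\<exists>k W X. W \<in> carrier_mat n k \<and> X \<in> carrier_mat m k \<and> W = T * X \<and>
     mat_adjoint W * W = 1\<^sub>m k \<and>
     (\<forall>i<j. W * (mat_adjoint W * (T * unit_column m i)) = T * unit_column m i)" for j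
  proof (induction j)
    case 0
    have "0\<^sub>m n 0 = T * 0\<^sub>m m 0" by simp
    moreover have "mat_adjoint (0\<^sub>m n 0) * 0\<^sub>m n 0 = (1\<^sub>m 0 :: complex mat)"
      by (rule eq_matI) auto
    ultimately show ?case by (intro exI[of _ 0] exI[of _ "0\<^sub>m n 0"] exI[of _ "0\<^sub>m m 0"]) auto
  next
    case (Suc j)
    then obtain k W X where W: "W \<in> carrier_mat n k" and X: "X \<in> carrier_mat m k"
      and WX: "W = T * X" and iso: "mat_adjoint W * W = 1\<^sub>m k"
      and fixed: "\<And>i. i < j \<Longrightarrow> W * (mat_adjoint W * (T * unit_column m i)) = T * unit_column m i"
      by metis
    have [simp]: "dim_row W = n" "dim_col W = k" "dim_row X = m" "dim_col X = k" using W X by auto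
    define t where "t = T * unit_column m j"
    define r where "r = t - W * (mat_adjoint W * t)"
    have [simp]: "dim_row t = n" "dim_col t = 1" by (simp_all add: t_def)
    have [simp]: "dim_row r = n" "dim_col r = 1" by (simp_all add: r_def)
    show ?case
    proof (cases "r = 0\<^sub>m n 1")
      case True
      have "W * (mat_adjoint W * t) = t"
      proof (rule eq_matI)
        fix a b assume ab: "a < dim_row t" "b < dim_col t"
        have "(t - W * (mat_adjoint W * t)) $$ (a, b) = 0\<^sub>m n 1 $$ (a, b)"
          using True by (simp add: r_def)
        then show "(W * (mat_adjoint W * t)) $$ (a, b) = t $$ (a, b)" using ab by simp
      qed auto
      then have "\<forall>i<Suc j. W * (mat_adjoint W * (T * unit_column m i)) = T * unit_column m i"
        using fixed by (auto simp: less_Suc_eq t_def)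
      then show ?thesis using W X WX iso by blast
    next
      case False
      define q where "q = (\<Sum>i<n. (cmod (r $$ (i, 0)))\<^sup>2)"
      have rr: "mat_adjoint r * r = complex_of_real q \<cdot>\<^sub>m 1\<^sub>m 1"
        by (rule eq_matI) (auto simp: mult_mat_entry q_def complex_norm_square mult.commute simp del: of_real_power)
      from False obtain i where i: "i < n" "r $$ (i, 0) \<noteq> 0"
        by (metis (no_types, lifting) \<open>dim_col r = 1\<close> \<open>dim_row r = n\<close> eq_matI index_zero_mat less_one)
      have q: "0 < q"
        unfolding q_def by (rule sum_pos2[of _ i]) (use i in auto)
      define w where "w = complex_of_real (1 / sqrt q) \<cdot>\<^sub>m r"
      have [simp]: "dim_row w = n" "dim_col w = 1" by (simp_all add: w_def)
      have "complex_of_real (1 / sqrt q) * complex_of_real (1 / sqrt q) * complex_of_real q = 1"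
        using q by (simp flip: of_real_mult)
      then have ww: "mat_adjoint w * w = 1\<^sub>m 1"
        by (simp add: w_def mat_mult_smult_left mat_mult_smult_right rr mat_smult_smult mult.assoc)
      have Wr: "mat_adjoint W * r = 0\<^sub>m k 1"
      proof -
        have "mat_adjoint W * r = mat_adjoint W * t - (mat_adjoint W * W) * (mat_adjoint W * t)"
          by (simp add: r_def mat_mult_minus_right mult_mat_assoc)
        also have "\<dots> = 0\<^sub>m k 1" by (subst iso) (rule eq_matI, auto)
        finally show ?thesis .
      qed
      then have Ww: "mat_adjoint W * w = 0\<^sub>m k 1"
        by (simp add: w_def mat_mult_smult_right)
      then have wW: "mat_adjoint w * W = 0\<^sub>m 1 k"
        by (metis (no_types, lifting) adjoint_zero \<open>dim_col W = k\<close> \<open>dim_row W = n\<close> \<open>dim_row w = n\<close> mat_adjoint_adjoint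
            mat_adjoint_dim(2) mat_adjoint_mult)
      \<comment> \<open>\<open>W'\<close> is \<open>W\<close> with the column \<open>w\<close> appended, and \<open>x\<close> is the preimage of \<open>w\<close> under \<open>T\<close>.\<close>
      define W' where "W' = W * drop_last k + w * take_last k"
      define x where "x = complex_of_real (1 / sqrt q) \<cdot>\<^sub>m (unit_column m j - X * (mat_adjoint W * t))"
      define X' where "X' = X * drop_last k + x * take_last k"
      have [simp]: "dim_row W' = n" "dim_col W' = Suc k" "dim_row x = m" "dim_col x = 1"
        "dim_row X' = m" "dim_col X' = Suc k"
        by (simp_all add: W'_def X'_def x_def)
      have "w = T * x"
        by (simp add: w_def x_def r_def t_def mat_mult_smult_right mat_mult_minus_right WX mult_mat_assoc)
      then have W'X': "W' = T * X'"
        by (simp add: W'_def X'_def mat_mult_add_right WX mult_mat_assoc)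
      have W'_adj: "mat_adjoint W' = mat_adjoint (drop_last k) * mat_adjoint W + mat_adjoint (take_last k) * mat_adjoint w"
        by (simp add: W'_def mat_adjoint_add)
      have JW: "mat_adjoint W * W' = drop_last k" "mat_adjoint w * W' = take_last k"
        by (simp_all add: W'_def mat_mult_add_right iso ww wW Ww flip: mult_mat_assoc)
      have iso': "mat_adjoint W' * W' = 1\<^sub>m (Suc k)"
        by (simp add: W'_adj mat_mult_add_left mult_mat_assoc JW drop_take_relations)
      have JW': "W' * mat_adjoint (drop_last k) = W" "W' * mat_adjoint (take_last k) = w"
        by (simp_all add: W'_def mat_mult_add_left mult_mat_assoc drop_take_relations)
      have proj: "W' * (mat_adjoint W' * u) = W * (mat_adjoint W * u) + w * (mat_adjoint w * u)"
        if [simp]: "dim_row u = n" for u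
      proof -
        have "W' * (mat_adjoint W' * u) = W' * mat_adjoint (drop_last k) * (mat_adjoint W * u)
            + W' * mat_adjoint (take_last k) * (mat_adjoint w * u)"
          by (simp add: W'_adj mat_mult_add_left mat_mult_add_right mult_mat_assoc)
        then show ?thesis by (simp add: JW')
      qed
      have "W' * (mat_adjoint W' * (T * unit_column m i)) = T * unit_column m i" if "i < j" for i
      proof -
        let ?u = "T * unit_column m i"
        have "mat_adjoint w * ?u = mat_adjoint w * (W * (mat_adjoint W * ?u))"
          using fixed[OF that] by simp
        also have "\<dots> = 0\<^sub>m 1 1" by (simp add: wW flip: mult_mat_assoc)
        finally show ?thesis using fixed[OF that] by (simp add: proj)
      qed
      moreover have "W' * (mat_adjoint W' * t) = t"
      proof -
        have t: "t = W * (mat_adjoint W * t) + r"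
          by (rule eq_matI) (auto simp: r_def)
        have "mat_adjoint w * t = mat_adjoint w * W * (mat_adjoint W * t) + mat_adjoint w * r"
          by (subst t) (simp add: mat_mult_add_right mult_mat_assoc)
        then have "w * (mat_adjoint w * t) = w * (mat_adjoint w * r)"
          by (simp add: wW)
        also have "\<dots> = r"
        proof -
          have c: "complex_of_real (sqrt q) * complex_of_real (sqrt q) = complex_of_real q"
            using q by (simp flip: of_real_mult)
          show ?thesis
            by (simp add: w_def mat_mult_smult_left mat_mult_smult_right rr mat_smult_smult c less_imp_neq[OF q, symmetric])
        qed
        finally show ?thesis using t by (simp add: proj)
      qed
      ultimately have "\<forall>i<Suc j. W' * (mat_adjoint W' * (T * unit_column m i)) = T * unit_column m i"
        by (auto simp: less_Suc_eq t_def)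
      then show ?thesis using W'X' iso' by (intro exI[of _ "Suc k"] exI[of _ W'] exI[of _ X']) auto
    qed
  qed
  from this[of m] obtain k W X where W: "W \<in> carrier_mat n k" and X: "X \<in> carrier_mat m k"
    and WX: "W = T * X" and iso: "mat_adjoint W * W = 1\<^sub>m k"
    and fixed: "\<And>i. i < m \<Longrightarrow> W * (mat_adjoint W * (T * unit_column m i)) = T * unit_column m i"
    by metis
  have "W * (mat_adjoint W * T) = T"
  proof (rule mat_eq_by_columns)
    show "W * (mat_adjoint W * T) \<in> carrier_mat n m" using W by (auto intro!: carrier_matI)
    show "W * (mat_adjoint W * T) * unit_column m j = T * unit_column m j" if "j < m" for j
      using fixed[OF that] W by (simp add: mult_mat_assoc)
  qed (fact T)
  then show ?thesis using that W X WX iso by blast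
qed

text \<open>The ranges of \<open>W\<^sub>1\<close> and \<open>W\<^sub>2\<close> are the range of \<open>T\<close> and its orthogonal complement; taking traces,
  their dimensions add up to \<open>n\<close>.\<close>

lemma orthogonal_splitting:
  fixes T :: "complex mat"
  assumes T: "T \<in> carrier_mat n n" and T0: "T \<noteq> 0\<^sub>m n n"
    and noninv: "\<And>Y. Y \<in> carrier_mat n n \<Longrightarrow> T * Y \<noteq> 1\<^sub>m n"
  obtains k\<^sub>1 W\<^sub>1 X\<^sub>1 k\<^sub>2 W\<^sub>2 where "k\<^sub>1 < n" "k\<^sub>2 < n"
    "W\<^sub>1 \<in> carrier_mat n k\<^sub>1" "W\<^sub>2 \<in> carrier_mat n k\<^sub>2" "X\<^sub>1 \<in> carrier_mat n k\<^sub>1"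
    "W\<^sub>1 = T * X\<^sub>1" "W\<^sub>1 * (mat_adjoint W\<^sub>1 * T) = T"
    "mat_adjoint W\<^sub>1 * W\<^sub>1 = 1\<^sub>m k\<^sub>1" "mat_adjoint W\<^sub>2 * W\<^sub>2 = 1\<^sub>m k\<^sub>2"
    "W\<^sub>1 * mat_adjoint W\<^sub>1 + W\<^sub>2 * mat_adjoint W\<^sub>2 = 1\<^sub>m n"
proof -
  obtain k\<^sub>1 W\<^sub>1 X\<^sub>1 where 1: "W\<^sub>1 \<in> carrier_mat n k\<^sub>1" "X\<^sub>1 \<in> carrier_mat n k\<^sub>1" "W\<^sub>1 = T * X\<^sub>1"
    "mat_adjoint W\<^sub>1 * W\<^sub>1 = 1\<^sub>m k\<^sub>1" "W\<^sub>1 * (mat_adjoint W\<^sub>1 * T) = T"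
    using isometry_onto_range[OF T] by metis
  \<comment> \<open>\<open>Q\<close> is a projection, so the isometry onto its range satisfies \<open>Q = W\<^sub>2 W\<^sub>2\<^sup>*\<close>.\<close>
  define Q where "Q = 1\<^sub>m n - W\<^sub>1 * mat_adjoint W\<^sub>1"
  have Q: "Q \<in> carrier_mat n n" using 1(1) unfolding Q_def by (intro carrier_matI; simp)
  obtain k\<^sub>2 W\<^sub>2 X\<^sub>2 where 2: "W\<^sub>2 \<in> carrier_mat n k\<^sub>2" "X\<^sub>2 \<in> carrier_mat n k\<^sub>2" "W\<^sub>2 = Q * X\<^sub>2"
    "mat_adjoint W\<^sub>2 * W\<^sub>2 = 1\<^sub>m k\<^sub>2" "W\<^sub>2 * (mat_adjoint W\<^sub>2 * Q) = Q"
    using isometry_onto_range[OF Q] by metis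
  have [simp]: "dim_row T = n" "dim_col T = n" "dim_row W\<^sub>1 = n" "dim_col W\<^sub>1 = k\<^sub>1" "dim_row X\<^sub>1 = n"
    "dim_col X\<^sub>1 = k\<^sub>1" "dim_row W\<^sub>2 = n" "dim_col W\<^sub>2 = k\<^sub>2" "dim_row X\<^sub>2 = n" "dim_col X\<^sub>2 = k\<^sub>2"
    "dim_row Q = n" "dim_col Q = n"
    using 1(1,2) 2(1,2) Q T by auto
  have QQ: "Q * Q = Q"
  proof -
    have "W\<^sub>1 * (mat_adjoint W\<^sub>1 * (W\<^sub>1 * mat_adjoint W\<^sub>1)) = W\<^sub>1 * ((mat_adjoint W\<^sub>1 * W\<^sub>1) * mat_adjoint W\<^sub>1)"
      by (simp add: mult_mat_assoc)
    also have "\<dots> = W\<^sub>1 * mat_adjoint W\<^sub>1" by (simp add: 1(4))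
    finally have "W\<^sub>1 * (mat_adjoint W\<^sub>1 * (W\<^sub>1 * mat_adjoint W\<^sub>1)) = W\<^sub>1 * mat_adjoint W\<^sub>1" .
    then show ?thesis
      by (simp add: Q_def mat_mult_minus_right mat_mult_minus_left mult_mat_assoc) (rule eq_matI, auto)
  qed
  have Qadj: "mat_adjoint Q = Q"
    by (simp add: Q_def mat_adjoint_minus)
  have "Q = mat_adjoint (W\<^sub>2 * (mat_adjoint W\<^sub>2 * Q))" by (simp add: 2(5) Qadj)
  also have "\<dots> = Q * W\<^sub>2 * mat_adjoint W\<^sub>2" by (simp add: Qadj mult_mat_assoc)
  also have "Q * W\<^sub>2 = W\<^sub>2" by (simp add: 2(3) QQ flip: mult_mat_assoc)
  finally have QW: "Q = W\<^sub>2 * mat_adjoint W\<^sub>2" .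
  have sum: "W\<^sub>1 * mat_adjoint W\<^sub>1 + W\<^sub>2 * mat_adjoint W\<^sub>2 = 1\<^sub>m n"
    unfolding QW[symmetric] by (rule eq_matI) (auto simp: Q_def)
  have "of_nat (k\<^sub>1 + k\<^sub>2) = (\<Sum>i<k\<^sub>1. (mat_adjoint W\<^sub>1 * W\<^sub>1) $$ (i, i)) + (\<Sum>i<k\<^sub>2. (mat_adjoint W\<^sub>2 * W\<^sub>2) $$ (i, i))"
    unfolding 1(4) 2(4) by simp
  also have "\<dots> = (\<Sum>i<n. (W\<^sub>1 * mat_adjoint W\<^sub>1) $$ (i, i)) + (\<Sum>i<n. (W\<^sub>2 * mat_adjoint W\<^sub>2) $$ (i, i))"
    using 1(1) 2(1) by (simp add: trace_mult_commute[of "mat_adjoint W\<^sub>1" k\<^sub>1 n] trace_mult_commute[of "mat_adjoint W\<^sub>2" k\<^sub>2 n])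
  also have "\<dots> = (\<Sum>i<n. (W\<^sub>1 * mat_adjoint W\<^sub>1 + W\<^sub>2 * mat_adjoint W\<^sub>2) $$ (i, i))"
    by (simp add: sum.distrib)
  also have "\<dots> = (of_nat n :: complex)" unfolding sum by simp
  finally have k: "k\<^sub>1 + k\<^sub>2 = n" by (simp only: of_nat_eq_iff)
  have "k\<^sub>1 \<noteq> 0"
  proof
    assume "k\<^sub>1 = 0"
    then have "W\<^sub>1 * (mat_adjoint W\<^sub>1 * T) = 0\<^sub>m n n"
      by (intro eq_matI) (auto simp: mult_mat_entry)
    then show False using 1(5) T0 by simp
  qed
  moreover have "k\<^sub>2 \<noteq> 0"
  proof
    assume "k\<^sub>2 = 0"
    then have "W\<^sub>2 * mat_adjoint W\<^sub>2 = 0\<^sub>m n n"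
      by (intro eq_matI) (auto simp: mult_mat_entry)
    then have "W\<^sub>1 * mat_adjoint W\<^sub>1 = 1\<^sub>m n" using sum by simp
    then have "T * (X\<^sub>1 * mat_adjoint W\<^sub>1) = 1\<^sub>m n"
      using 1(3) by (metis \<open>dim_col T = n\<close> \<open>dim_col W\<^sub>1 = k\<^sub>1\<close> \<open>dim_col X\<^sub>1 = k\<^sub>1\<close> \<open>dim_row X\<^sub>1 = n\<close> mat_adjoint_dim(1) mult_mat_assoc)
    moreover have "X\<^sub>1 * mat_adjoint W\<^sub>1 \<in> carrier_mat n n" by (auto intro!: carrier_matI)
    ultimately show False using noninv by blast
  qed
  ultimately have "k\<^sub>1 < n" "k\<^sub>2 < n" using k by auto
  then show ?thesis using that[of k\<^sub>1 k\<^sub>2 W\<^sub>1 W\<^sub>2 X\<^sub>1] 1 2 sum by blast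
qed

text \<open>The witness \<open>c\<close> is the negative of an eigenvalue of \<open>S\<close>.\<close>

lemma nonscalar_singular_shift:
  fixes S :: "complex mat"
  assumes S: "S \<in> carrier_mat n n" and n: "0 < n" and nonscalar: "\<And>c. S \<noteq> c \<cdot>\<^sub>m 1\<^sub>m n"
  obtains c where "S + c \<cdot>\<^sub>m 1\<^sub>m n \<noteq> 0\<^sub>m n n"
    "\<And>Y. Y \<in> carrier_mat n n \<Longrightarrow> (S + c \<cdot>\<^sub>m 1\<^sub>m n) * Y \<noteq> 1\<^sub>m n"
proof -
  have [simp]: "dim_row S = n" "dim_col S = n" using S by auto
  obtain e where "eigenvalue S e"
    using spectrum_non_empty[OF S] n by (auto simp: spectrum_def)
  then have det: "det (char_matrix S e) = 0" using eigenvalue_det[OF S] by simp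
  have char: "char_matrix S e = S + (- e) \<cdot>\<^sub>m 1\<^sub>m n"
    by (rule eq_matI) (auto simp: char_matrix_def)
  have "S + (- e) \<cdot>\<^sub>m 1\<^sub>m n \<noteq> 0\<^sub>m n n"
  proof
    assume 0: "S + (- e) \<cdot>\<^sub>m 1\<^sub>m n = 0\<^sub>m n n"
    have "S = e \<cdot>\<^sub>m 1\<^sub>m n"
    proof (rule eq_matI)
      fix i j assume ij: "i < dim_row (e \<cdot>\<^sub>m 1\<^sub>m n)" "j < dim_col (e \<cdot>\<^sub>m 1\<^sub>m n)"
      have "(S + (- e) \<cdot>\<^sub>m 1\<^sub>m n) $$ (i, j) = 0\<^sub>m n n $$ (i, j)" by (simp only: 0)
      then show "S $$ (i, j) = (e \<cdot>\<^sub>m 1\<^sub>m n) $$ (i, j)" using ij by (auto split: if_splits)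
    qed auto
    then show False using nonscalar by blast
  qed
  moreover have "(S + (- e) \<cdot>\<^sub>m 1\<^sub>m n) * Y \<noteq> 1\<^sub>m n" if Y: "Y \<in> carrier_mat n n" for Y
  proof
    assume inv: "(S + (- e) \<cdot>\<^sub>m 1\<^sub>m n) * Y = 1\<^sub>m n"
    have "det ((S + (- e) \<cdot>\<^sub>m 1\<^sub>m n) * Y) = det (S + (- e) \<cdot>\<^sub>m 1\<^sub>m n) * det Y"
      by (rule det_mult) (use Y S in auto)
    then show False using det by (simp add: char inv)
  qed
  ultimately show ?thesis using that by blast
qed


section \<open>Matrices over a C*-algebra\<close>

lemma scaleC_zero_left [simp]: "0 *\<^sub>C x = (0 :: 'a::cstar_algebra)"
  using scaleC_of_real[of 0 x] by simp

lemma scaleC_one_left [simp]: "1 *\<^sub>C x = (x :: 'a::cstar_algebra)"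
  using scaleC_of_real[of 1 x] by simp

lemma star_zero [simp]: "star 0 = (0 :: 'a::cstar_algebra)"
  using star_add[of 0 "0 :: 'a"] by simp

lemma star_one [simp]: "star 1 = (1 :: 'a::cstar_algebra)"
  by (metis mult.right_neutral mult_1 star_mult star_star)

lemma star_sum: "star (\<Sum>i\<in>I. f i) = (\<Sum>i\<in>I. star (f i :: 'a::cstar_algebra))"
  by (induction I rule: infinite_finite_induct) (auto simp: star_add)

lemma scaleC_sum_left: "(\<Sum>i\<in>I. f i) *\<^sub>C x = (\<Sum>i\<in>I. f i *\<^sub>C (x :: 'a::cstar_algebra))"
  by (induction I rule: infinite_finite_induct) (auto simp: scaleC_add_left)

lemma star_mat_dim [simp]: "dim_row (star_mat v) = dim_col v" "dim_col (star_mat v) = dim_row v"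
  by (simp_all add: star_mat_def)

lemma star_mat_entry [simp]:
  "i < dim_col v \<Longrightarrow> j < dim_row v \<Longrightarrow> star_mat v $$ (i, j) = star (v $$ (j, i))"
  by (simp add: star_mat_def)

lemma star_mat_mult [simp]:
  fixes v w :: "'a::cstar_algebra mat"
  assumes "dim_col v = dim_row w"
  shows "star_mat (v * w) = star_mat w * star_mat v"
  by (rule eq_matI) (use assms in \<open>auto simp: mult_mat_entry star_sum star_mult\<close>)

lemma star_mat_star [simp]: "star_mat (star_mat v) = v"
  by (rule eq_matI) (auto simp: star_star)

lemma star_mat_one [simp]: "star_mat (1\<^sub>m n :: 'a::cstar_algebra mat) = 1\<^sub>m n"
  by (rule eq_matI) auto

lemma star_mat_kronecker_one_right:
  "star_mat (v \<otimes>\<^sub>m 1\<^sub>m n) = star_mat v \<otimes>\<^sub>m (1\<^sub>m n :: 'a::cstar_algebra mat)"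
proof (rule eq_matI)
  fix i j assume "i < dim_row (star_mat v \<otimes>\<^sub>m (1\<^sub>m n :: 'a mat))" "j < dim_col (star_mat v \<otimes>\<^sub>m (1\<^sub>m n :: 'a mat))"
  then have i: "i < dim_col v * n" and j: "j < dim_row v * n" by auto
  show "star_mat (v \<otimes>\<^sub>m 1\<^sub>m n) $$ (i, j) = (star_mat v \<otimes>\<^sub>m 1\<^sub>m n) $$ (i, j)"
    using i j div_mod_bounds[OF i] div_mod_bounds[OF j] by auto
qed auto

lemma star_mat_kronecker_one_left:
  "star_mat (1\<^sub>m n \<otimes>\<^sub>m v) = (1\<^sub>m n :: 'a::cstar_algebra mat) \<otimes>\<^sub>m star_mat v"
proof (rule eq_matI)
  fix i j assume "i < dim_row ((1\<^sub>m n :: 'a mat) \<otimes>\<^sub>m star_mat v)" "j < dim_col ((1\<^sub>m n :: 'a mat) \<otimes>\<^sub>m star_mat v)"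
  then have i: "i < n * dim_col v" and j: "j < n * dim_row v" by auto
  show "star_mat (1\<^sub>m n \<otimes>\<^sub>m v) $$ (i, j) = (1\<^sub>m n \<otimes>\<^sub>m star_mat v) $$ (i, j)"
    using i j div_mod_bounds[OF i] div_mod_bounds[OF j] by auto
qed auto

lemma amplify_dim [simp]: "dim_row (amplify S) = dim_row S" "dim_col (amplify S) = dim_col S"
  by (simp_all add: amplify_def)

lemma amplify_entry [simp]:
  "i < dim_row S \<Longrightarrow> j < dim_col S \<Longrightarrow> amplify S $$ (i, j) = S $$ (i, j) *\<^sub>C 1"
  by (simp add: amplify_def)

lemma amplify_mult:
  assumes "dim_col S = dim_row T"
  shows "amplify (S * T) = amplify S * (amplify T :: 'a::cstar_algebra mat)"
  by (rule eq_matI)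
    (use assms in \<open>auto simp: mult_mat_entry scaleC_sum_left mult_scaleC_left mult_scaleC_right scaleC_scaleC mult.commute\<close>)

lemma amplify_one [simp]: "amplify (1\<^sub>m n) = (1\<^sub>m n :: 'a::cstar_algebra mat)"
  by (rule eq_matI) auto

lemma amplify_add:
  assumes "dim_row S = dim_row T" "dim_col S = dim_col T"
  shows "amplify (S + T) = amplify S + (amplify T :: 'a::cstar_algebra mat)"
  by (rule eq_matI) (use assms in \<open>auto simp: scaleC_add_left\<close>)

lemma star_mat_amplify [simp]: "star_mat (amplify S) = (amplify (mat_adjoint S) :: 'a::cstar_algebra mat)"
  by (rule eq_matI) (auto simp: star_scaleC)

lemma amplify_kronecker:
  "amplify (S \<otimes>\<^sub>m T) = amplify S \<otimes>\<^sub>m (amplify T :: 'a::cstar_algebra mat)"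
proof (rule eq_matI)
  fix i j assume "i < dim_row (amplify S \<otimes>\<^sub>m (amplify T :: 'a mat))" "j < dim_col (amplify S \<otimes>\<^sub>m (amplify T :: 'a mat))"
  then have i: "i < dim_row S * dim_row T" and j: "j < dim_col S * dim_col T" by auto
  show "amplify (S \<otimes>\<^sub>m T) $$ (i, j) = (amplify S \<otimes>\<^sub>m (amplify T :: 'a mat)) $$ (i, j)"
    using i j div_mod_bounds[OF i] div_mod_bounds[OF j]
    by (simp add: mult_scaleC_left mult_scaleC_right scaleC_scaleC mult.commute)
qed auto


lemma entries_commute_amplify:
  "entries_commute (amplify S) v" "entries_commute v (amplify S)" for v :: "'a::cstar_algebra mat"
  by (auto simp: entries_commute_def mult_scaleC_left mult_scaleC_right)

lemma entries_commute_one: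
  "entries_commute (1\<^sub>m n) v" "entries_commute v (1\<^sub>m n)" for v :: "'a::cstar_algebra mat"
  by (auto simp: entries_commute_def)

lemma unital_star_homD:
  assumes "unital_star_hom h"
  shows "h (x + y) = h x + h y" "h (x * y) = h x * h y" "h 1 = 1" "h 0 = 0" "h (c *\<^sub>C x) = c *\<^sub>C h x"
proof -
  show add: "h (x + y) = h x + h y" for x y
    using assms by (auto simp: unital_star_hom_def complex_linear_def)
  show "h 0 = 0" using add[of 0 0] by simp
qed (use assms in \<open>auto simp: unital_star_hom_def complex_linear_def\<close>)

lemma unital_star_hom_sum: "unital_star_hom h \<Longrightarrow> h (\<Sum>i\<in>I. f i) = (\<Sum>i\<in>I. h (f i))"
  by (induction I rule: infinite_finite_induct) (auto simp: unital_star_homD)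

lemma map_mat_hom_mult:
  assumes "unital_star_hom h" "dim_col v = dim_row w"
  shows "map_mat h (v * w) = map_mat h v * map_mat h w"
  by (rule eq_matI)
    (use assms in \<open>auto simp: mult_mat_entry unital_star_hom_sum unital_star_homD\<close>)

lemma map_mat_hom_one: "unital_star_hom h \<Longrightarrow> map_mat h (1\<^sub>m n) = 1\<^sub>m n"
  by (rule eq_matI) (auto simp: unital_star_homD)

lemma map_mat_hom_amplify: "unital_star_hom h \<Longrightarrow> map_mat h (amplify S) = amplify S"
  by (rule eq_matI) (auto simp: unital_star_homD)

lemma map_mat_hom_kronecker:
  assumes "unital_star_hom h"
  shows "map_mat h (v \<otimes>\<^sub>m w) = map_mat h v \<otimes>\<^sub>m map_mat h w"
proof (rule eq_matI)
  fix i j assume "i < dim_row (map_mat h v \<otimes>\<^sub>m map_mat h w)" "j < dim_col (map_mat h v \<otimes>\<^sub>m map_mat h w)"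
  then have i: "i < dim_row v * dim_row w" and j: "j < dim_col v * dim_col w" by auto
  show "map_mat h (v \<otimes>\<^sub>m w) $$ (i, j) = (map_mat h v \<otimes>\<^sub>m map_mat h w) $$ (i, j)"
    using i j div_mod_bounds[OF i] div_mod_bounds[OF j] unital_star_homD[OF assms] by simp
qed auto

lemma boxtimes_eq_kronecker:
  fixes v w :: "'a::cstar_algebra mat"
  assumes "square_mat v" "square_mat w"
  shows "v \<boxtimes> w = v \<otimes>\<^sub>m w"
  using assms by (simp add: boxtimes_def kronecker_mult entries_commute_one)


section \<open>Intertwiners\<close>

lemma MorD:
  assumes "S \<in> Mor v w"
  shows "dim_row S = dim_row w" "dim_col S = dim_row v" "amplify S * v = w * amplify S"
  using assms by (auto simp: Mor_def)

lemma MorI: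
  assumes "dim_row S = dim_row w" "dim_col S = dim_row v" "amplify S * v = w * amplify S"
  shows "S \<in> Mor v w"
  using assms by (auto simp: Mor_def)

lemma Mor_one: "square_mat v \<Longrightarrow> 1\<^sub>m (dim_row v) \<in> Mor v v" for v :: "'a::cstar_algebra mat"
  by (rule MorI) auto

lemma Mor_zero: "square_mat v \<Longrightarrow> square_mat w \<Longrightarrow> 0\<^sub>m (dim_row w) (dim_row v) \<in> Mor v w"
  for v :: "'a::cstar_algebra mat"
  by (rule MorI) (auto intro!: eq_matI simp: mult_mat_entry)

lemma Mor_add:
  fixes v w :: "'a::cstar_algebra mat"
  assumes "square_mat v" "square_mat w" "S \<in> Mor v w" "T \<in> Mor v w"
  shows "S + T \<in> Mor v w"
  using assms MorD[OF assms(3)] MorD[OF assms(4)]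
  by (intro MorI) (simp_all add: amplify_add mat_mult_add_left mat_mult_add_right)

lemma Mor_smult:
  fixes v w :: "'a::cstar_algebra mat"
  assumes "square_mat v" "square_mat w" "S \<in> Mor v w"
  shows "c \<cdot>\<^sub>m S \<in> Mor v w"
proof (rule MorI)
  note S = MorD[OF assms(3)]
  show "amplify (c \<cdot>\<^sub>m S) * v = w * amplify (c \<cdot>\<^sub>m S)"
  proof (rule eq_matI)
    fix i j assume ij: "i < dim_row (w * amplify (c \<cdot>\<^sub>m S))" "j < dim_col (w * amplify (c \<cdot>\<^sub>m S))"
    have scale: "c *\<^sub>C (\<Sum>k\<in>I. f k) = (\<Sum>k\<in>I. c *\<^sub>C f k)" for f :: "nat \<Rightarrow> 'a" and I
      using scaleC_add_right[of c 0 "0 :: 'a"]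
      by (induction I rule: infinite_finite_induct) (auto simp: scaleC_add_right)
    have "(amplify (c \<cdot>\<^sub>m S) * v) $$ (i, j) = c *\<^sub>C (amplify S * v) $$ (i, j)"
      using ij S(1,2) assms(1,2) by (simp add: mult_mat_entry scale mult_scaleC_left scaleC_scaleC)
    also have "\<dots> = c *\<^sub>C (w * amplify S) $$ (i, j)" by (simp add: S(3))
    also have "\<dots> = (w * amplify (c \<cdot>\<^sub>m S)) $$ (i, j)"
      using ij S(1,2) assms(1,2) by (simp add: mult_mat_entry scale mult_scaleC_right scaleC_scaleC)
    finally show "(amplify (c \<cdot>\<^sub>m S) * v) $$ (i, j) = (w * amplify (c \<cdot>\<^sub>m S)) $$ (i, j)" .
  qed (use S assms in auto)
qed (use MorD[OF assms(3)] in auto)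

lemma Mor_mult:
  fixes v w z :: "'a::cstar_algebra mat"
  assumes "square_mat v" "square_mat w" "square_mat z" "S \<in> Mor w z" "T \<in> Mor v w"
  shows "S * T \<in> Mor v z"
proof (rule MorI)
  note S = MorD[OF assms(4)] and T = MorD[OF assms(5)]
  note [simp] = S(1,2) T(1,2)
  have "amplify (S * T) * v = amplify S * (amplify T * v)"
    using assms(1-3) by (simp add: amplify_mult mult_mat_assoc)
  also have "\<dots> = amplify S * w * amplify T"
    using assms(1-3) by (simp add: T(3) mult_mat_assoc)
  also have "\<dots> = z * amplify S * amplify T" by (simp only: S(3))
  also have "\<dots> = z * amplify (S * T)"
    using assms(1-3) by (simp add: amplify_mult mult_mat_assoc)
  finally show "amplify (S * T) * v = z * amplify (S * T)" .
qed (use MorD[OF assms(4)] MorD[OF assms(5)] in auto)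

lemma Mor_kronecker:
  fixes v w v' w' :: "'a::cstar_algebra mat"
  assumes "square_mat v" "square_mat w" "square_mat v'" "square_mat w'" "S \<in> Mor v w" "T \<in> Mor v' w'"
  shows "S \<otimes>\<^sub>m T \<in> Mor (v \<otimes>\<^sub>m v') (w \<otimes>\<^sub>m w')"
  using assms(1-4) MorD[OF assms(5)] MorD[OF assms(6)]
  by (intro MorI) (simp_all add: amplify_kronecker kronecker_mult entries_commute_amplify)

text \<open>Unitarity of \<open>v\<close> and \<open>w\<close> turns \<open>S v = w S\<close> into \<open>w\<^sup>* S = S v\<^sup>*\<close>, whose adjoint is the claim.\<close>

lemma Mor_adjoint:
  fixes v w :: "'a::cstar_algebra mat"
  assumes "square_mat v" "square_mat w" "star_mat w * w = 1\<^sub>m (dim_row w)"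
    "v * star_mat v = 1\<^sub>m (dim_row v)" "S \<in> Mor v w"
  shows "mat_adjoint S \<in> Mor w v"
proof (rule MorI)
  note S = MorD[OF assms(5)]
  have "star_mat w * amplify S = star_mat w * (amplify S * v) * star_mat v"
    using assms(1,2,4) S(1,2) by (simp add: mult_mat_assoc)
  also have "\<dots> = (star_mat w * w) * amplify S * star_mat v"
    using assms(1,2) S(1,2) by (simp add: mult_mat_assoc S(3))
  also have "\<dots> = amplify S * star_mat v"
    using assms(3) S(1) by simp
  finally have "star_mat (star_mat w * amplify S) = star_mat (amplify S * star_mat v)" by simp
  then show "amplify (mat_adjoint S) * w = v * amplify (mat_adjoint S)"
    using assms(1,2) S(1,2) by simp
qed (use MorD[OF assms(5)] in auto)


section \<open>Decomposition of corepresentations\<close>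

context compact_quantum_group
begin

abbreviation corep :: "'a mat \<Rightarrow> bool" where
  "corep \<equiv> corepresentation tens Delta"

lemma corepD:
  assumes "corep v"
  shows "square_mat v" "dim_col v = dim_row v"
    "star_mat v * v = 1\<^sub>m (dim_row v)" "v * star_mat v = 1\<^sub>m (dim_row v)"
    "map_mat Delta v = map_mat (\<lambda>a. tens a 1) v * map_mat (\<lambda>a. tens 1 a) v"
  using assms by (auto simp: corepresentation_def)

lemma tens_props:
  "tens (a + b) c = tens a c + tens b c" "tens a (b + c) = tens a b + tens a c"
  "tens (k *\<^sub>C a) b = k *\<^sub>C tens a b" "tens a (k *\<^sub>C b) = k *\<^sub>C tens a b"
  "tens 1 1 = 1" "tens a b * tens c d = tens (a * c) (b * d)" "star (tens a b) = tens (star a) (star b)"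
  using tens by (simp_all add: minimal_tensor_product_def complex_linear_def)

lemma tens_legs_hom: "unital_star_hom (\<lambda>a. tens a 1)" "unital_star_hom (\<lambda>a. tens 1 a)"
  by (simp_all add: unital_star_hom_def complex_linear_def tens_props)

lemma corep_trivial: "corep (1\<^sub>m 1)"
  by (simp add: corepresentation_def map_mat_hom_one[OF Delta_hom] map_mat_hom_one[OF tens_legs_hom(1)]
      map_mat_hom_one[OF tens_legs_hom(2)])

text \<open>In the coproduct of \<open>v \<otimes> w\<close>, the entries of \<open>v\<close> in the second leg are moved past those of
  \<open>w\<close> in the first leg, with which they commute.\<close>

lemma corep_kronecker:
  assumes v: "corep v" and w: "corep w"
  shows "corep (v \<otimes>\<^sub>m w)"
proof -
  note [simp] = corepD(2)[OF v] corepD(2)[OF w]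
  have vw: "v \<otimes>\<^sub>m w = (v \<otimes>\<^sub>m 1\<^sub>m (dim_row w)) * (1\<^sub>m (dim_row v) \<otimes>\<^sub>m w)"
    by (simp add: kronecker_mult entries_commute_one)
  have star: "star_mat (v \<otimes>\<^sub>m w) = (1\<^sub>m (dim_row v) \<otimes>\<^sub>m star_mat w) * (star_mat v \<otimes>\<^sub>m 1\<^sub>m (dim_row w))"
    unfolding vw by (simp add: star_mat_kronecker_one_left star_mat_kronecker_one_right)
  have "star_mat (v \<otimes>\<^sub>m w) * (v \<otimes>\<^sub>m w) = (1\<^sub>m (dim_row v) \<otimes>\<^sub>m star_mat w) *
      ((star_mat v \<otimes>\<^sub>m 1\<^sub>m (dim_row w)) * (v \<otimes>\<^sub>m 1\<^sub>m (dim_row w))) * (1\<^sub>m (dim_row v) \<otimes>\<^sub>m w)"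
    unfolding star by (subst vw) (simp add: mult_mat_assoc)
  also have "\<dots> = 1\<^sub>m (dim_row v * dim_row w)"
    by (simp add: kronecker_mult entries_commute_one corepD(3)[OF v] corepD(3)[OF w])
  finally have 1: "star_mat (v \<otimes>\<^sub>m w) * (v \<otimes>\<^sub>m w) = 1\<^sub>m (dim_row v * dim_row w)" .
  have "(v \<otimes>\<^sub>m w) * star_mat (v \<otimes>\<^sub>m w) = (v \<otimes>\<^sub>m 1\<^sub>m (dim_row w)) *
      ((1\<^sub>m (dim_row v) \<otimes>\<^sub>m w) * (1\<^sub>m (dim_row v) \<otimes>\<^sub>m star_mat w)) * (star_mat v \<otimes>\<^sub>m 1\<^sub>m (dim_row w))"
    unfolding star by (subst vw) (simp add: mult_mat_assoc)
  also have "\<dots> = 1\<^sub>m (dim_row v * dim_row w)"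
    by (simp add: kronecker_mult entries_commute_one corepD(4)[OF v] corepD(4)[OF w])
  finally have 2: "(v \<otimes>\<^sub>m w) * star_mat (v \<otimes>\<^sub>m w) = 1\<^sub>m (dim_row v * dim_row w)" .
  have comm: "entries_commute (map_mat (\<lambda>a. tens a 1) w) (map_mat (\<lambda>a. tens 1 a) v)"
    by (auto simp: entries_commute_def tens_props)
  have "map_mat Delta (v \<otimes>\<^sub>m w) =
      map_mat (\<lambda>a. tens a 1) (v \<otimes>\<^sub>m w) * map_mat (\<lambda>a. tens 1 a) (v \<otimes>\<^sub>m w)"
    unfolding map_mat_hom_kronecker[OF Delta_hom] map_mat_hom_kronecker[OF tens_legs_hom(1)]
      map_mat_hom_kronecker[OF tens_legs_hom(2)] corepD(5)[OF v] corepD(5)[OF w]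
    by (rule kronecker_mult[OF _ _ comm, symmetric]) simp_all
  then show ?thesis using 1 2 by (simp add: corepresentation_def)
qed

lemma corep_Mor_adjoint: "corep v \<Longrightarrow> corep w \<Longrightarrow> S \<in> Mor v w \<Longrightarrow> mat_adjoint S \<in> Mor w v"
  by (rule Mor_adjoint) (auto dest: corepD)

text \<open>The compression \<open>W\<^sup>* v W\<close> of \<open>v\<close> to the range of \<open>W\<close>. It is multiplicative, hence again a unitary
  corepresentation, because the projection \<open>W W\<^sup>*\<close> commutes with \<open>v\<close>.\<close>

lemma subcorepresentation:
  assumes v: "corep v" and W: "W \<in> carrier_mat (dim_row v) k" and iso: "mat_adjoint W * W = 1\<^sub>m k"
    and P: "W * mat_adjoint W \<in> Mor v v"
  obtains v' where "corep v'" "dim_row v' = k" "W \<in> Mor v' v"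
proof -
  define a where "a = (amplify W :: 'a mat)"
  define b where "b = (amplify (mat_adjoint W) :: 'a mat)"
  define v' where "v' = b * v * a"
  have [simp]: "dim_row a = dim_row v" "dim_col a = k" "dim_row b = k" "dim_col b = dim_row v"
    "dim_col v = dim_row v" "dim_row v' = k" "dim_col v' = k" "dim_row W = dim_row v" "dim_col W = k"
    using W corepD(2)[OF v] by (auto simp: a_def b_def v'_def)
  have ba: "b * a = 1\<^sub>m k" by (simp add: a_def b_def iso flip: amplify_mult)
  have ab: "a * b * v = v * (a * b)"
    using MorD(3)[OF P] by (simp add: a_def b_def amplify_mult)
  have star: "star_mat v' = b * star_mat v * a"
    by (simp add: v'_def a_def b_def mult_mat_assoc)
  have va: "v * a = a * v'"
  proof -
    have "a * v' = (a * b * v) * a" by (simp add: v'_def mult_mat_assoc)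
    also have "\<dots> = v * a * (b * a)" by (simp only: ab) (simp add: mult_mat_assoc)
    finally show ?thesis by (simp add: ba)
  qed
  have bv: "b * v = v' * b"
  proof -
    have "v' * b = b * (v * (a * b))" by (simp add: v'_def mult_mat_assoc)
    also have "\<dots> = (b * a) * b * v" by (simp only: ab[symmetric]) (simp add: mult_mat_assoc)
    finally show ?thesis by (simp add: ba)
  qed
  have "star_mat v' * v' = b * star_mat v * (a * v')"
    by (simp add: star mult_mat_assoc)
  also have "\<dots> = b * (star_mat v * v) * a" by (simp add: va[symmetric] mult_mat_assoc)
  also have "\<dots> = 1\<^sub>m k" by (simp add: corepD(3)[OF v] ba)
  finally have 1: "star_mat v' * v' = 1\<^sub>m k" .
  have "v' * star_mat v' = (v' * b) * star_mat v * a"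
    by (simp add: star mult_mat_assoc)
  also have "\<dots> = b * (v * star_mat v) * a" by (simp add: bv[symmetric] mult_mat_assoc)
  also have "\<dots> = 1\<^sub>m k" by (simp add: corepD(4)[OF v] ba)
  finally have 2: "v' * star_mat v' = 1\<^sub>m k" .
  define A where "A = (amplify W :: 'b mat)"
  define B where "B = (amplify (mat_adjoint W) :: 'b mat)"
  have [simp]: "dim_row A = dim_row v" "dim_col A = k" "dim_row B = k" "dim_col B = dim_row v"
    by (auto simp: A_def B_def)
  have img: "map_mat h v' = B * map_mat h v * A" if "unital_star_hom h" for h :: "'a \<Rightarrow> 'b"
    by (simp add: v'_def a_def b_def A_def B_def map_mat_hom_mult[OF that] map_mat_hom_amplify[OF that])
  have img': "map_mat h v * A = A * map_mat h v'" if "unital_star_hom h" for h :: "'a \<Rightarrow> 'b"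
    using arg_cong[OF va, of "map_mat h"]
    by (simp add: a_def A_def map_mat_hom_mult[OF that] map_mat_hom_amplify[OF that])
  have BA: "B * A = 1\<^sub>m k" by (simp add: A_def B_def iso flip: amplify_mult)
  have "map_mat Delta v' = B * map_mat (\<lambda>a. tens a 1) v * (map_mat (\<lambda>a. tens 1 a) v * A)"
    by (simp add: img[OF Delta_hom] corepD(5)[OF v] mult_mat_assoc)
  also have "\<dots> = B * map_mat (\<lambda>a. tens a 1) v * A * map_mat (\<lambda>a. tens 1 a) v'"
    by (subst img'[OF tens_legs_hom(2)]) (simp add: mult_mat_assoc)
  finally have "map_mat Delta v' = map_mat (\<lambda>a. tens a 1) v' * map_mat (\<lambda>a. tens 1 a) v'"
    by (simp add: img[OF tens_legs_hom(1)])
  then have "corep v'" using 1 2 by (simp add: corepresentation_def)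
  moreover have "W \<in> Mor v' v"
    by (rule MorI) (use va in \<open>auto simp: a_def\<close>)
  ultimately show ?thesis using that by simp
qed

text \<open>A non-scalar intertwiner \<open>S\<close> has an eigenvalue \<open>e\<close>. The range of \<open>T = S - e\<close> is a proper
  non-zero subspace; it is invariant under \<open>v\<close> and under \<open>v\<^sup>*\<close>, because \<open>T\<close> commutes with both.\<close>

lemma corep_splitting:
  assumes v: "corep v" and n: "0 < dim_row v" and red: "\<not> irreducible_corepresentation tens Delta v"
  obtains v\<^sub>1 v\<^sub>2 W\<^sub>1 W\<^sub>2 where "corep v\<^sub>1" "corep v\<^sub>2" "dim_row v\<^sub>1 < dim_row v" "dim_row v\<^sub>2 < dim_row v"
    "W\<^sub>1 \<in> Mor v\<^sub>1 v" "W\<^sub>2 \<in> Mor v\<^sub>2 v"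
    "W\<^sub>1 * mat_adjoint W\<^sub>1 + W\<^sub>2 * mat_adjoint W\<^sub>2 = 1\<^sub>m (dim_row v)"
proof -
  let ?n = "dim_row v"
  note sq = corepD(1)[OF v]
  have scalar: "c \<cdot>\<^sub>m 1\<^sub>m ?n \<in> Mor v v" for c
    by (rule Mor_smult[OF sq sq Mor_one[OF sq]])
  then obtain S where S: "S \<in> Mor v v" and nonscalar: "\<And>c. S \<noteq> c \<cdot>\<^sub>m 1\<^sub>m ?n"
    using red v n by (auto simp: irreducible_corepresentation_def)
  have S_carrier: "S \<in> carrier_mat ?n ?n" using MorD[OF S] by auto
  obtain c where c: "S + c \<cdot>\<^sub>m 1\<^sub>m ?n \<noteq> 0\<^sub>m ?n ?n"
    "\<And>Y. Y \<in> carrier_mat ?n ?n \<Longrightarrow> (S + c \<cdot>\<^sub>m 1\<^sub>m ?n) * Y \<noteq> 1\<^sub>m ?n"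
    using nonscalar_singular_shift[OF S_carrier n nonscalar] by metis
  define T where "T = S + c \<cdot>\<^sub>m 1\<^sub>m ?n"
  have T: "T \<in> Mor v v" unfolding T_def by (rule Mor_add[OF sq sq S scalar])
  have T_carrier: "T \<in> carrier_mat ?n ?n" using MorD[OF T] by auto
  obtain k\<^sub>1 W\<^sub>1 X k\<^sub>2 W\<^sub>2 where k: "k\<^sub>1 < ?n" "k\<^sub>2 < ?n"
    and W: "W\<^sub>1 \<in> carrier_mat ?n k\<^sub>1" "W\<^sub>2 \<in> carrier_mat ?n k\<^sub>2" "X \<in> carrier_mat ?n k\<^sub>1"
    and TX: "W\<^sub>1 = T * X" and fix_T: "W\<^sub>1 * (mat_adjoint W\<^sub>1 * T) = T"
    and iso: "mat_adjoint W\<^sub>1 * W\<^sub>1 = 1\<^sub>m k\<^sub>1" "mat_adjoint W\<^sub>2 * W\<^sub>2 = 1\<^sub>m k\<^sub>2"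
    and sum: "W\<^sub>1 * mat_adjoint W\<^sub>1 + W\<^sub>2 * mat_adjoint W\<^sub>2 = 1\<^sub>m ?n"
    using orthogonal_splitting[OF T_carrier] c unfolding T_def by metis
  have [simp]: "dim_row W\<^sub>1 = ?n" "dim_col W\<^sub>1 = k\<^sub>1" "dim_row W\<^sub>2 = ?n" "dim_col W\<^sub>2 = k\<^sub>2"
    "dim_row X = ?n" "dim_col X = k\<^sub>1" "dim_row T = ?n" "dim_col T = ?n" "dim_col v = ?n"
    using W T_carrier sq by auto
  define P where "P = W\<^sub>1 * mat_adjoint W\<^sub>1"
  have [simp]: "dim_row P = ?n" "dim_col P = ?n" by (simp_all add: P_def)
  have P_adj: "mat_adjoint P = P" by (simp add: P_def)
  have PT: "P * T = T" using fix_T by (simp add: P_def mult_mat_assoc)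
  \<comment> \<open>\<open>u P = u T X W\<^sub>1\<^sup>* = T u X W\<^sub>1\<^sup>*\<close>, and \<open>P T = T\<close>.\<close>
  have invariant: "amplify P * (u * amplify P) = u * amplify P"
    if u: "amplify T * u = u * amplify T" "dim_row u = ?n" "dim_col u = ?n" for u :: "'a mat"
  proof -
    have "u * amplify P = u * amplify T * amplify (X * mat_adjoint W\<^sub>1)"
      using u(2,3) by (simp add: P_def TX amplify_mult mult_mat_assoc)
    then have *: "u * amplify P = amplify T * (u * amplify (X * mat_adjoint W\<^sub>1))"
      using u(2,3) by (simp add: u(1)[symmetric] mult_mat_assoc)
    have "amplify P * (u * amplify P) = amplify (P * T) * (u * amplify (X * mat_adjoint W\<^sub>1))"
      unfolding * using u(2,3) by (simp add: amplify_mult mult_mat_assoc)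
    then show ?thesis by (simp add: PT *)
  qed
  have "amplify P * (v * amplify P) = v * amplify P"
    by (rule invariant) (use MorD[OF T] in auto)
  moreover have "amplify P * v = amplify P * (v * amplify P)"
  proof -
    have "amplify T * star_mat v = star_mat v * amplify T"
    proof -
      have "star_mat (amplify (mat_adjoint T) * v) = star_mat (v * amplify (mat_adjoint T))"
        using MorD(3)[OF corep_Mor_adjoint[OF v v T]] by simp
      then show ?thesis by simp
    qed
    then have "amplify P * (star_mat v * amplify P) = star_mat v * amplify P"
      by (rule invariant) auto
    then have "star_mat (amplify P * (star_mat v * amplify P)) = star_mat (star_mat v * amplify P)" by simp
    then show ?thesis by (simp add: P_adj mult_mat_assoc)
  qed
  ultimately have P_Mor: "P \<in> Mor v v" by (intro MorI) simp_all
  have "1\<^sub>m ?n + (- 1) \<cdot>\<^sub>m P \<in> Mor v v"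
    by (rule Mor_add[OF sq sq Mor_one[OF sq] Mor_smult[OF sq sq P_Mor]])
  also have "1\<^sub>m ?n + (- 1) \<cdot>\<^sub>m P = W\<^sub>2 * mat_adjoint W\<^sub>2"
    unfolding sum[symmetric] by (rule eq_matI) (auto simp: P_def)
  finally have Q_Mor: "W\<^sub>2 * mat_adjoint W\<^sub>2 \<in> Mor v v" .
  obtain v\<^sub>1 where "corep v\<^sub>1" "dim_row v\<^sub>1 = k\<^sub>1" "W\<^sub>1 \<in> Mor v\<^sub>1 v"
    using subcorepresentation[OF v W(1) iso(1)] P_Mor unfolding P_def by metis
  moreover obtain v\<^sub>2 where "corep v\<^sub>2" "dim_row v\<^sub>2 = k\<^sub>2" "W\<^sub>2 \<in> Mor v\<^sub>2 v"
    using subcorepresentation[OF v W(2) iso(2) Q_Mor] by metis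
  ultimately show ?thesis using that k sum by blast
qed

end


section \<open>Ampliations\<close>

text \<open>The operator \<open>1 \<otimes> S \<otimes> 1\<close>. Spectator factors are allowed on both sides, because \<open>S\<close> acts in the first
  leg for the map \<open>Delta_hat \<otimes> \<iota>\<close> (where \<open>k = 1\<close>), in the last leg for \<open>\<iota> \<otimes> Delta_hat\<close> (where \<open>n = 1\<close>),
  and in the middle leg when the cocycle identity is extended to words.\<close>

definition ampliation :: "nat \<Rightarrow> nat \<Rightarrow> complex mat \<Rightarrow> complex mat" where
  "ampliation k n S = 1\<^sub>m k \<otimes>\<^sub>m (S \<otimes>\<^sub>m 1\<^sub>m n)"

lemma ampliation_dim [simp]:
  "dim_row (ampliation k n S) = k * (dim_row S * n)" "dim_col (ampliation k n S) = k * (dim_col S * n)"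
  by (simp_all add: ampliation_def)

lemma ampliation_one [simp]: "ampliation k n (1\<^sub>m m) = 1\<^sub>m (k * (m * n))"
  by (simp add: ampliation_def)

lemma ampliation_trivial:
  "ampliation (Suc 0) n S = S \<otimes>\<^sub>m 1\<^sub>m n" "ampliation k (Suc 0) S = 1\<^sub>m k \<otimes>\<^sub>m S"
  by (simp_all add: ampliation_def)

lemma ampliation_mult:
  "dim_col S = dim_row T \<Longrightarrow> ampliation k n (S * T) = ampliation k n S * ampliation k n T"
  by (simp add: ampliation_def kronecker_mult_complex)

lemma ampliation_add:
  "dim_row S = dim_row T \<Longrightarrow> dim_col S = dim_col T \<Longrightarrow>
    ampliation k n (S + T) = ampliation k n S + ampliation k n T"
  by (simp add: ampliation_def kronecker_add_left kronecker_add_right)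

lemma ampliation_smult: "ampliation k n (c \<cdot>\<^sub>m S) = c \<cdot>\<^sub>m ampliation k n S"
  by (simp add: ampliation_def kronecker_smult_left kronecker_smult_right)

lemma ampliation_zero: "ampliation k n (0\<^sub>m a b) = 0\<^sub>m (k * (a * n)) (k * (b * n))"
proof -
  have "0\<^sub>m a b = 0 \<cdot>\<^sub>m (0\<^sub>m a b :: complex mat)" by (rule eq_matI) auto
  then have "ampliation k n (0\<^sub>m a b) = 0 \<cdot>\<^sub>m ampliation k n (0\<^sub>m a b)"
    by (metis ampliation_smult)
  also have "\<dots> = 0\<^sub>m (k * (a * n)) (k * (b * n))" by (rule eq_matI) auto
  finally show ?thesis .
qed

lemma ampliation_adjoint: "mat_adjoint (ampliation k n S) = ampliation k n (mat_adjoint S)"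
  by (simp add: ampliation_def)

lemma mult_adjoint_eq_zero:
  fixes S :: "complex mat"
  assumes "mat_adjoint S * S = 0\<^sub>m (dim_col S) (dim_col S)"
  shows "S = 0\<^sub>m (dim_row S) (dim_col S)"
proof (rule eq_matI)
  fix i j assume "i < dim_row (0\<^sub>m (dim_row S) (dim_col S))" "j < dim_col (0\<^sub>m (dim_row S) (dim_col S))"
  then have i: "i < dim_row S" and j: "j < dim_col S" by auto
  have "complex_of_real (\<Sum>k<dim_row S. (cmod (S $$ (k, j)))\<^sup>2) = (mat_adjoint S * S) $$ (j, j)"
    using j by (simp add: mult_mat_entry complex_norm_square mult.commute del: of_real_power)
  also have "\<dots> = 0" using assms j by simp
  finally have "(\<Sum>k<dim_row S. (cmod (S $$ (k, j)))\<^sup>2) = 0" by (simp only: of_real_eq_0_iff)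
  then show "S $$ (i, j) = 0\<^sub>m (dim_row S) (dim_col S) $$ (i, j)"
    using i j by (simp add: sum_nonneg_eq_0_iff)
qed auto

lemma smult_mat_cancel:
  assumes "c \<cdot>\<^sub>m S = d \<cdot>\<^sub>m S" "S \<noteq> 0\<^sub>m (dim_row S) (dim_col S)"
  shows "c = (d :: complex)"
proof -
  obtain i j where ij: "i < dim_row S" "j < dim_col S" "S $$ (i, j) \<noteq> 0"
    using assms(2) by (metis eq_matI index_zero_mat)
  have "(c \<cdot>\<^sub>m S) $$ (i, j) = (d \<cdot>\<^sub>m S) $$ (i, j)" by (simp only: assms(1))
  then show ?thesis using ij by simp
qed

section \<open>Intertwiners from irreducible corepresentations\<close>

context compact_quantum_group_irreps
begin

lemma irreducible_dim [simp]: "dim_row (U x) = irr_dim U x" "dim_col (U x) = irr_dim U x"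
  and corep_irreducible [simp]: "corep (U x)"
  and irr_dim_pos [simp]: "0 < irr_dim U x"
  and Mor_irreducible: "S \<in> Mor (U x) (U x) \<longleftrightarrow> (\<exists>c. S = c \<cdot>\<^sub>m 1\<^sub>m (irr_dim U x))"
proof -
  show *: "corep (U x)" "dim_row (U x) = irr_dim U x"
    using irreducible_U[of x] by (auto simp: irreducible_corepresentation_def irr_dim_def)
  show "dim_col (U x) = irr_dim U x" using corepD(2)[OF *(1)] *(2) by simp
  show "0 < irr_dim U x" "S \<in> Mor (U x) (U x) \<longleftrightarrow> (\<exists>c. S = c \<cdot>\<^sub>m 1\<^sub>m (irr_dim U x))"
    using irreducible_U[of x] *(2) by (auto simp: irreducible_corepresentation_def)
qed

lemma Mor_irreducible_dim:
  assumes "S \<in> Mor (U x) v"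
  shows "dim_row S = dim_row v" "dim_col S = irr_dim U x"
  using MorD[OF assms] by auto

text \<open>The intertwiners \<open>S\<^sup>* S\<close> and \<open>S S\<^sup>*\<close> are scalars \<open>c\<close> and \<open>d\<close>. If \<open>S \<noteq> 0\<close>, then \<open>c = d > 0\<close>, and \<open>S\<close> divided by
  the square root of \<open>c\<close> is a unitary equivalence, although different representatives are inequivalent.\<close>

lemma schur:
  assumes S: "S \<in> Mor (U x) (U y)" and "x \<noteq> y"
  shows "S = 0\<^sub>m (irr_dim U y) (irr_dim U x)"
proof (rule ccontr)
  assume nz: "S \<noteq> 0\<^sub>m (irr_dim U y) (irr_dim U x)"
  note [simp] = Mor_irreducible_dim[OF S]
  have S': "mat_adjoint S \<in> Mor (U y) (U x)"
    by (rule corep_Mor_adjoint[OF _ _ S]) simp_all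
  have "mat_adjoint S * S \<in> Mor (U x) (U x)" "S * mat_adjoint S \<in> Mor (U y) (U y)"
    by (rule Mor_mult[OF _ _ _ S' S] Mor_mult[OF _ _ _ S S']; simp)+
  then obtain c d where c: "mat_adjoint S * S = c \<cdot>\<^sub>m 1\<^sub>m (irr_dim U x)"
    and d: "S * mat_adjoint S = d \<cdot>\<^sub>m 1\<^sub>m (irr_dim U y)"
    by (auto simp: Mor_irreducible)
  have "c \<cdot>\<^sub>m S = S * (mat_adjoint S * S)" by (simp add: c mat_mult_smult_right)
  also have "\<dots> = S * mat_adjoint S * S" by (simp add: mult_mat_assoc)
  also have "\<dots> = d \<cdot>\<^sub>m S" by (simp add: d mat_mult_smult_left)
  finally have dc: "d = c" using smult_mat_cancel[of c S d] nz by simp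
  \<comment> \<open>The diagonal entry of \<open>S\<^sup>* S\<close> at \<open>0\<close> shows that \<open>c\<close> is real and non-negative.\<close>
  define r where "r = (\<Sum>k<irr_dim U y. (cmod (S $$ (k, 0)))\<^sup>2)"
  have "complex_of_real r = (mat_adjoint S * S) $$ (0, 0)"
    by (simp add: r_def mult_mat_entry complex_norm_square mult.commute del: of_real_power)
  then have cr: "c = complex_of_real r" by (simp add: c)
  have "c \<noteq> 0"
  proof
    assume "c = 0"
    then have "mat_adjoint S * S = 0\<^sub>m (irr_dim U x) (irr_dim U x)" by (simp add: c) (rule eq_matI, auto)
    then show False using mult_adjoint_eq_zero[of S] nz by simp
  qed
  moreover have "0 \<le> r" unfolding r_def by (rule sum_nonneg) simp
  ultimately have r: "0 < r" using cr by auto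
  define V where "V = complex_of_real (1 / sqrt r) \<cdot>\<^sub>m S"
  have scale: "complex_of_real (sqrt r) * complex_of_real (sqrt r) = complex_of_real r"
    using r by (simp flip: of_real_mult)
  have "unitary_mat V"
    using r by (simp add: unitary_mat_def V_def mat_mult_smult_left mat_mult_smult_right mat_smult_smult
        c d dc cr scale)
  moreover have "V \<in> Mor (U x) (U y)"
    unfolding V_def by (rule Mor_smult[OF _ _ S]) simp_all
  ultimately have "equivalent_corepresentations (U x) (U y)"
    by (auto simp: equivalent_corepresentations_def)
  moreover have "equivalent_corepresentations (U x) (U x)"
    unfolding equivalent_corepresentations_def
    using Mor_one[of "U x"] unitary_mat_one by (intro bexI[of _ "1\<^sub>m (irr_dim U x)"]) auto
  ultimately show False using representatives[OF irreducible_U[of x]] \<open>x \<noteq> y\<close> by blast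
qed

lemma irreducible_unitary:
  assumes "irreducible_corepresentation tens Delta v"
  obtains x V where "V \<in> Mor (U x) v" "unitary_mat V"
proof -
  obtain x V where V: "V \<in> Mor v (U x)" "unitary_mat V"
    using representatives[OF assms] by (auto simp: equivalent_corepresentations_def)
  have "corep v" using assms by (simp add: irreducible_corepresentation_def)
  then have "mat_adjoint V \<in> Mor (U x) v" using corep_Mor_adjoint[OF _ _ V(1)] by simp
  then show ?thesis using that V(2) unitary_mat_adjoint by blast
qed

text \<open>The case distinction for inductions on the dimension of a corepresentation.\<close>

lemma corep_cases:
  assumes "corep v"
  obtains "dim_row v = 0"
  | x V where "V \<in> Mor (U x) v" "unitary_mat V"
  | v\<^sub>1 v\<^sub>2 W\<^sub>1 W\<^sub>2 where "corep v\<^sub>1" "corep v\<^sub>2" "dim_row v\<^sub>1 < dim_row v" "dim_row v\<^sub>2 < dim_row v"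
    "W\<^sub>1 \<in> Mor v\<^sub>1 v" "W\<^sub>2 \<in> Mor v\<^sub>2 v"
    "W\<^sub>1 * mat_adjoint W\<^sub>1 + W\<^sub>2 * mat_adjoint W\<^sub>2 = 1\<^sub>m (dim_row v)"
  using corep_splitting[OF assms] irreducible_unitary by (metis gr0I)

text \<open>Complete reducibility, in a form that involves no choice of a decomposition: the ranges of the
  intertwiners from irreducible corepresentations span the space of \<open>v\<close>.\<close>

lemma intertwiners_separate:
  assumes "corep v" "dim_row A = dim_row B"
    and "dim_col A = k * (dim_row v * n)" "dim_col B = k * (dim_row v * n)"
    and "\<And>x S. S \<in> Mor (U x) v \<Longrightarrow> A * ampliation k n S = B * ampliation k n S"
  shows "A = B"
  using assms
proof (induction "dim_row v" arbitrary: v A B rule: less_induct)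
  case less
  note [simp] = less.prems(2-4)
  from less.prems(1) show ?case
  proof (cases rule: corep_cases)
    case 1
    then show ?thesis by (intro eq_matI) auto
  next
    case (2 x V)
    note [simp] = Mor_irreducible_dim[OF 2(1)]
    have *: "C = C * ampliation k n V * ampliation k n (mat_adjoint V)"
      if "dim_col C = k * (dim_row v * n)" for C
      using that unitary_matD(2)[OF 2(2)] by (simp add: mult_mat_assoc flip: ampliation_mult)
    show ?thesis using *[of A] *[of B] less.prems(5)[OF 2(1)] by simp
  next
    case (3 v\<^sub>1 v\<^sub>2 W\<^sub>1 W\<^sub>2)
    note [simp] = MorD(1,2)[OF 3(5)] MorD(1,2)[OF 3(6)]
    have eq: "A * ampliation k n W = B * ampliation k n W"
      if v': "corep v'" "dim_row v' < dim_row v" and W: "W \<in> Mor v' v" for v' W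
    proof (rule less.hyps[OF v'(2,1)])
      note [simp] = MorD(1,2)[OF W]
      show "A * ampliation k n W * ampliation k n S = B * ampliation k n W * ampliation k n S"
        if S: "S \<in> Mor (U x) v'" for x S
      proof -
        note [simp] = MorD(1,2)[OF S]
        have "W * S \<in> Mor (U x) v"
          by (rule Mor_mult[OF _ _ _ W S]) (use v' less.prems(1) in \<open>auto dest: corepD\<close>)
        from less.prems(5)[OF this] show ?thesis
          by (simp add: ampliation_mult mult_mat_assoc)
      qed
    qed (use MorD[OF W] in simp_all)
    have *: "C = C * ampliation k n W\<^sub>1 * ampliation k n (mat_adjoint W\<^sub>1)
        + C * ampliation k n W\<^sub>2 * ampliation k n (mat_adjoint W\<^sub>2)"
      if "dim_col C = k * (dim_row v * n)" for C
    proof -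
      have "C = C * ampliation k n (1\<^sub>m (dim_row v))" using that by simp
      also have "\<dots> = C * ampliation k n (W\<^sub>1 * mat_adjoint W\<^sub>1 + W\<^sub>2 * mat_adjoint W\<^sub>2)"
        by (simp only: 3(7))
      finally show ?thesis
        using that by (simp add: ampliation_add ampliation_mult mat_mult_add_right mult_mat_assoc)
    qed
    show ?thesis using *[of A] *[of B] eq[OF 3(1,3,5)] eq[OF 3(2,4,6)] by simp
  qed
qed

text \<open>Any family \<open>R\<close> that depends linearly on the intertwiners is given by one operator \<open>M\<close>. If a unitary
  \<open>V\<close> identifies \<open>v\<close> with an irreducible corepresentation, then \<open>M = R(V) (1 \<otimes> V\<^sup>* \<otimes> 1)\<close>, since all
  other intertwiners are multiples of \<open>V\<close> or zero; for a direct sum, the operators of the two summands are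
  added. This replaces the formula \<open>\<Sum> R(S\<^sub>i) (1 \<otimes> S\<^sub>i\<^sup>* \<otimes> 1)\<close> for a chosen decomposition into irreducibles.\<close>

lemma intertwiners_extend:
  assumes "corep v"
    and "\<And>x S. S \<in> Mor (U x) v \<Longrightarrow> R x S \<in> carrier_mat m (k * (irr_dim U x * n))"
    and "\<And>x S T. S \<in> Mor (U x) v \<Longrightarrow> T \<in> Mor (U x) v \<Longrightarrow> R x (S + T) = R x S + R x T"
    and "\<And>x S c. S \<in> Mor (U x) v \<Longrightarrow> R x (c \<cdot>\<^sub>m S) = c \<cdot>\<^sub>m R x S"
  shows "\<exists>M \<in> carrier_mat m (k * (dim_row v * n)).
    \<forall>x. \<forall>S \<in> Mor (U x) v. M * ampliation k n S = R x S"
  using assms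
proof (induction "dim_row v" arbitrary: v R rule: less_induct)
  case less
  note R = less.prems(2-4)
  note R_dim = carrier_matD[OF R(1)]
  note sq = corepD(1)[OF less.prems(1)]
  have R_zero: "R x (0\<^sub>m (dim_row v) (irr_dim U x)) = 0\<^sub>m m (k * (irr_dim U x * n))" for x
  proof -
    have 0: "0\<^sub>m (dim_row v) (irr_dim U x) \<in> Mor (U x) v"
      using Mor_zero[of "U x" v] sq by simp
    have "R x (0\<^sub>m (dim_row v) (irr_dim U x)) = R x (0 \<cdot>\<^sub>m 0\<^sub>m (dim_row v) (irr_dim U x))" by simp
    also have "\<dots> = 0 \<cdot>\<^sub>m R x (0\<^sub>m (dim_row v) (irr_dim U x))" by (rule R(3)[OF 0])
    also have "\<dots> = 0\<^sub>m m (k * (irr_dim U x * n))"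
      by (rule eq_matI) (use R_dim[OF 0] in auto)
    finally show ?thesis .
  qed
  from less.prems(1) show ?case
  proof (cases rule: corep_cases)
    case 1
    have "0\<^sub>m m 0 * ampliation k n S = R x S" if S: "S \<in> Mor (U x) v" for x S
    proof -
      have "S = 0\<^sub>m (dim_row v) (irr_dim U x)"
        by (rule eq_matI) (use Mor_irreducible_dim[OF S] 1 in auto)
      then show ?thesis using R_zero[of x] 1 by simp
    qed
    then show ?thesis using 1 by (intro bexI[of _ "0\<^sub>m m 0"]) auto
  next
    case (2 x V)
    note V_dim [simp] = Mor_irreducible_dim[OF 2(1)]
    note [simp] = R_dim[OF 2(1)]
    note VV = unitary_matD[OF 2(2)]
    let ?M = "R x V * ampliation k n (mat_adjoint V)"
    have "?M * ampliation k n S = R y S" if S: "S \<in> Mor (U y) v" for y S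
    proof -
      note S_dim [simp] = Mor_irreducible_dim[OF S]
      have "mat_adjoint V * S \<in> Mor (U y) (U x)"
        by (rule Mor_mult[OF _ _ _ corep_Mor_adjoint[OF _ less.prems(1) 2(1)] S]) (use sq in simp_all)
      have S_eq: "S = V * (mat_adjoint V * S)"
        using VV by (simp flip: mult_mat_assoc)
      show ?thesis
      proof (cases "y = x")
        case True
        then obtain c where "mat_adjoint V * S = c \<cdot>\<^sub>m 1\<^sub>m (irr_dim U x)"
          using \<open>mat_adjoint V * S \<in> Mor (U y) (U x)\<close> by (auto simp: Mor_irreducible)
        then have S_c: "S = c \<cdot>\<^sub>m V" using S_eq by (simp add: mat_mult_smult_right)
        have "?M * ampliation k n S = c \<cdot>\<^sub>m (R x V * ampliation k n (mat_adjoint V * V))"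
          by (simp add: S_c ampliation_smult ampliation_mult mat_mult_smult_right mult_mat_assoc)
        then show ?thesis using True VV R(3)[OF 2(1)] by (simp add: S_c)
      next
        case False
        then have "S = V * 0\<^sub>m (irr_dim U x) (irr_dim U y)"
          using \<open>mat_adjoint V * S \<in> Mor (U y) (U x)\<close> schur S_eq by metis
        then have "S = 0\<^sub>m (dim_row v) (irr_dim U y)" by simp
        then show ?thesis using R_zero[of y] by (simp add: ampliation_zero)
      qed
    qed
    moreover have "?M \<in> carrier_mat m (k * (dim_row v * n))" by (intro carrier_matI; simp)
    ultimately show ?thesis by blast
  next
    case (3 v\<^sub>1 v\<^sub>2 W\<^sub>1 W\<^sub>2)
    note [simp] = MorD(1,2)[OF 3(5)] MorD(1,2)[OF 3(6)]
    have ex: "\<exists>M \<in> carrier_mat m (k * (dim_row v' * n)).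
        \<forall>x. \<forall>S \<in> Mor (U x) v'. M * ampliation k n S = R x (W * S)"
      if v': "corep v'" "dim_row v' < dim_row v" and W: "W \<in> Mor v' v" for v' W
    proof (rule less.hyps[OF v'(2,1)])
      note [simp] = MorD(1,2)[OF W]
      fix x S T c assume S: "S \<in> Mor (U x) v'"
      have comp: "W * S' \<in> Mor (U x) v" if "S' \<in> Mor (U x) v'" for S'
        by (rule Mor_mult[OF _ _ _ W that]) (use v' less.prems(1) in \<open>auto dest: corepD\<close>)
      show "R x (W * S) \<in> carrier_mat m (k * (irr_dim U x * n))" by (rule R(1)[OF comp[OF S]])
      show "R x (W * (c \<cdot>\<^sub>m S)) = c \<cdot>\<^sub>m R x (W * S)"
        using R(3)[OF comp[OF S]] MorD(1,2)[OF S] by (simp add: mat_mult_smult_right)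
      assume T: "T \<in> Mor (U x) v'"
      show "R x (W * (S + T)) = R x (W * S) + R x (W * T)"
        using R(2)[OF comp[OF S] comp[OF T]] MorD(1,2)[OF S] MorD(1,2)[OF T]
        by (simp add: mat_mult_add_right)
    qed
    obtain M\<^sub>1 where M1: "M\<^sub>1 \<in> carrier_mat m (k * (dim_row v\<^sub>1 * n))"
      "\<And>x S. S \<in> Mor (U x) v\<^sub>1 \<Longrightarrow> M\<^sub>1 * ampliation k n S = R x (W\<^sub>1 * S)"
      using ex[OF 3(1,3,5)] by blast
    obtain M\<^sub>2 where M2: "M\<^sub>2 \<in> carrier_mat m (k * (dim_row v\<^sub>2 * n))"
      "\<And>x S. S \<in> Mor (U x) v\<^sub>2 \<Longrightarrow> M\<^sub>2 * ampliation k n S = R x (W\<^sub>2 * S)"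
      using ex[OF 3(2,4,6)] by blast
    note [simp] = carrier_matD[OF M1(1)] carrier_matD[OF M2(1)]
    let ?M = "M\<^sub>1 * ampliation k n (mat_adjoint W\<^sub>1) + M\<^sub>2 * ampliation k n (mat_adjoint W\<^sub>2)"
    have "?M * ampliation k n S = R x S" if S: "S \<in> Mor (U x) v" for x S
    proof -
      note [simp] = Mor_irreducible_dim[OF S]
      have comp: "mat_adjoint W * S \<in> Mor (U x) v'" "W * (mat_adjoint W * S) \<in> Mor (U x) v"
        if "corep v'" "W \<in> Mor v' v" for v' W
      proof -
        show 1: "mat_adjoint W * S \<in> Mor (U x) v'"
          by (rule Mor_mult[OF _ _ _ corep_Mor_adjoint[OF that(1) less.prems(1) that(2)] S])
            (use that less.prems(1) in \<open>auto dest: corepD\<close>)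
        show "W * (mat_adjoint W * S) \<in> Mor (U x) v"
          by (rule Mor_mult[OF _ _ _ that(2) 1]) (use that less.prems(1) in \<open>auto dest: corepD\<close>)
      qed
      have "?M * ampliation k n S =
          M\<^sub>1 * ampliation k n (mat_adjoint W\<^sub>1 * S) + M\<^sub>2 * ampliation k n (mat_adjoint W\<^sub>2 * S)"
        by (simp add: ampliation_mult mat_mult_add_left mult_mat_assoc)
      also have "\<dots> = R x (W\<^sub>1 * (mat_adjoint W\<^sub>1 * S)) + R x (W\<^sub>2 * (mat_adjoint W\<^sub>2 * S))"
        using M1(2)[OF comp(1)[OF 3(1,5)]] M2(2)[OF comp(1)[OF 3(2,6)]] by simp
      also have "\<dots> = R x (W\<^sub>1 * (mat_adjoint W\<^sub>1 * S) + W\<^sub>2 * (mat_adjoint W\<^sub>2 * S))"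
        by (rule R(2)[OF comp(2)[OF 3(1,5)] comp(2)[OF 3(2,6)], symmetric])
      also have "W\<^sub>1 * (mat_adjoint W\<^sub>1 * S) + W\<^sub>2 * (mat_adjoint W\<^sub>2 * S) =
          (W\<^sub>1 * mat_adjoint W\<^sub>1 + W\<^sub>2 * mat_adjoint W\<^sub>2) * S"
        by (simp add: mat_mult_add_left mult_mat_assoc)
      also have "\<dots> = S" by (simp add: 3(7))
      finally show ?thesis .
    qed
    moreover have "?M \<in> carrier_mat m (k * (dim_row v * n))" by (intro carrier_matI; simp)
    ultimately show ?thesis by blast
  qed
qed

end


section \<open>Natural extension of families\<close>

context compact_quantum_group_irreps
begin

definition ampliated_family :: "nat \<Rightarrow> nat \<Rightarrow> ('i \<Rightarrow> complex mat) \<Rightarrow> bool" where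
  "ampliated_family k n Y \<longleftrightarrow>
     (\<forall>x. Y x \<in> carrier_mat (k * (irr_dim U x * n)) (k * (irr_dim U x * n)))"

lemma ampliated_familyD [simp]:
  assumes "ampliated_family k n Y"
  shows "dim_row (Y x) = k * (irr_dim U x * n)" "dim_col (Y x) = k * (irr_dim U x * n)"
  using assms by (auto simp: ampliated_family_def)

text \<open>The operator \<open>\<Sum> S\<^sub>i Y\<^sub>x\<^sub>i S\<^sub>i\<^sup>*\<close> for a decomposition of \<open>v\<close> by isometric intertwiners \<open>S\<^sub>i\<close> from \<open>x\<^sub>i\<close>,
  each \<open>S\<^sub>i\<close> being ampliated. With a family \<open>a\<close> of the dual algebra in place of \<open>Y\<close> and \<open>y \<otimes> z\<close> in place
  of \<open>v\<close>, this is the component of \<open>Delta_hat(a)\<close> at \<open>(y, z)\<close>.\<close>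

definition natural_extension ::
    "nat \<Rightarrow> nat \<Rightarrow> ('i \<Rightarrow> complex mat) \<Rightarrow> 'a mat \<Rightarrow> complex mat" where
  "natural_extension k n Y v = (SOME M.
     M \<in> carrier_mat (k * (dim_row v * n)) (k * (dim_row v * n)) \<and>
     (\<forall>x. \<forall>S \<in> Mor (U x) v. M * ampliation k n S = ampliation k n S * Y x))"

lemma natural_extension:
  assumes v: "corep v" and Y: "ampliated_family k n Y"
  shows "natural_extension k n Y v \<in> carrier_mat (k * (dim_row v * n)) (k * (dim_row v * n))"
    "S \<in> Mor (U x) v \<Longrightarrow>
      natural_extension k n Y v * ampliation k n S = ampliation k n S * Y x"
proof -
  note [simp] = ampliated_familyD[OF Y]
  have "\<exists>M \<in> carrier_mat (k * (dim_row v * n)) (k * (dim_row v * n)).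
      \<forall>x. \<forall>S \<in> Mor (U x) v. M * ampliation k n S = ampliation k n S * Y x"
  proof (rule intertwiners_extend[OF v])
    fix x S T c assume S: "S \<in> Mor (U x) v"
    note [simp] = Mor_irreducible_dim[OF S]
    show "ampliation k n S * Y x \<in> carrier_mat (k * (dim_row v * n)) (k * (irr_dim U x * n))"
      by (intro carrier_matI; simp)
    show "ampliation k n (c \<cdot>\<^sub>m S) * Y x = c \<cdot>\<^sub>m (ampliation k n S * Y x)"
      by (simp add: ampliation_smult mat_mult_smult_left)
    assume T: "T \<in> Mor (U x) v"
    note [simp] = Mor_irreducible_dim[OF T]
    show "ampliation k n (S + T) * Y x = ampliation k n S * Y x + ampliation k n T * Y x"
      by (simp add: ampliation_add mat_mult_add_left)
  qed
  then have *: "natural_extension k n Y v \<in> carrier_mat (k * (dim_row v * n)) (k * (dim_row v * n)) \<and>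
     (\<forall>x. \<forall>S \<in> Mor (U x) v. natural_extension k n Y v * ampliation k n S = ampliation k n S * Y x)"
    unfolding natural_extension_def Bex_def by (rule someI_ex)
  show "natural_extension k n Y v \<in> carrier_mat (k * (dim_row v * n)) (k * (dim_row v * n))"
    "S \<in> Mor (U x) v \<Longrightarrow>
      natural_extension k n Y v * ampliation k n S = ampliation k n S * Y x"
    using * by auto
qed

lemma natural_extension_dim [simp]:
  assumes "corep v" "ampliated_family k n Y"
  shows "dim_row (natural_extension k n Y v) = k * (dim_row v * n)"
    "dim_col (natural_extension k n Y v) = k * (dim_row v * n)"
  using natural_extension(1)[OF assms] by auto

lemma natural_extension_unique:
  assumes "corep v" "ampliated_family k n Y"
    and "dim_row M = k * (dim_row v * n)" "dim_col M = k * (dim_row v * n)"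
    and "\<And>x S. S \<in> Mor (U x) v \<Longrightarrow> M * ampliation k n S = ampliation k n S * Y x"
  shows "M = natural_extension k n Y v"
  by (rule intertwiners_separate[OF assms(1)]) (use assms natural_extension(2)[OF assms(1,2)] in auto)

lemma natural_extension_irreducible:
  assumes "ampliated_family k n Y"
  shows "natural_extension k n Y (U x) = Y x"
proof -
  have "1\<^sub>m (irr_dim U x) \<in> Mor (U x) (U x)" using Mor_one[of "U x"] by simp
  from natural_extension(2)[OF corep_irreducible assms this] show ?thesis
    using assms by simp
qed

text \<open>Naturality with respect to all intertwiners follows from naturality with respect to those
  from irreducible corepresentations, since the latter separate.\<close>

lemma natural_extension_natural:
  assumes v: "corep v" and w: "corep w" and Y: "ampliated_family k n Y" and S: "S \<in> Mor v w"
  shows "natural_extension k n Y w * ampliation k n S = ampliation k n S * natural_extension k n Y v"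
proof (rule intertwiners_separate[OF v])
  note [simp] = MorD(1,2)[OF S] natural_extension_dim[OF v Y] natural_extension_dim[OF w Y] ampliated_familyD[OF Y]
  fix x T assume T: "T \<in> Mor (U x) v"
  note [simp] = Mor_irreducible_dim[OF T]
  have ST: "S * T \<in> Mor (U x) w"
    by (rule Mor_mult[OF _ _ _ S T]) (use v w in \<open>auto dest: corepD\<close>)
  show "natural_extension k n Y w * ampliation k n S * ampliation k n T =
      ampliation k n S * natural_extension k n Y v * ampliation k n T"
    using natural_extension(2)[OF w Y ST] natural_extension(2)[OF v Y T]
    by (simp add: ampliation_mult mult_mat_assoc)
qed (use MorD(1,2)[OF S] v w Y in simp_all)

text \<open>By Schur's lemma a family commutes with all intertwiners between irreducible
  corepresentations, so the adjoint of an extension has the property that characterises the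
  extension of the adjoint family.\<close>

lemma natural_extension_adjoint:
  assumes v: "corep v" and Y: "ampliated_family k n Y" and S: "S \<in> Mor (U x) v"
  shows "mat_adjoint (natural_extension k n Y v) * ampliation k n S =
    ampliation k n S * mat_adjoint (Y x)"
proof -
  note [simp] = Mor_irreducible_dim[OF S] natural_extension_dim[OF v Y] ampliated_familyD[OF Y]
  have "ampliation k n (mat_adjoint S) * natural_extension k n Y v =
      Y x * ampliation k n (mat_adjoint S)"
  proof (rule intertwiners_separate[OF v])
    fix y T assume T: "T \<in> Mor (U y) v"
    note [simp] = Mor_irreducible_dim[OF T]
    have ST: "mat_adjoint S * T \<in> Mor (U y) (U x)"
      by (rule Mor_mult[OF _ _ _ corep_Mor_adjoint[OF _ v S] T]) (use v in \<open>auto dest: corepD\<close>)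
    have "ampliation k n (mat_adjoint S * T) * Y y = Y x * ampliation k n (mat_adjoint S * T)"
    proof (cases "y = x")
      case True
      then obtain c where "mat_adjoint S * T = c \<cdot>\<^sub>m 1\<^sub>m (irr_dim U x)"
        using ST by (auto simp: Mor_irreducible)
      then show ?thesis using True by (simp add: ampliation_smult mat_mult_smult_left mat_mult_smult_right)
    next
      case False
      then have "mat_adjoint S * T = 0\<^sub>m (irr_dim U x) (irr_dim U y)" using schur[OF ST] by simp
      then show ?thesis by (simp add: ampliation_zero)
    qed
    then show "ampliation k n (mat_adjoint S) * natural_extension k n Y v * ampliation k n T =
        Y x * ampliation k n (mat_adjoint S) * ampliation k n T"
      by (simp add: ampliation_mult mult_mat_assoc natural_extension(2)[OF v Y T])
  qed simp_all
  then have "mat_adjoint (ampliation k n (mat_adjoint S) * natural_extension k n Y v) =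
      mat_adjoint (Y x * ampliation k n (mat_adjoint S))" by simp
  then show ?thesis by (simp add: ampliation_adjoint)
qed

lemma natural_extension_unitary:
  assumes v: "corep v" and Y: "ampliated_family k n Y" and unitary: "\<And>x. unitary_mat (Y x)"
  shows "unitary_mat (natural_extension k n Y v)"
proof (rule square_isometry_unitary)
  note [simp] = natural_extension_dim[OF v Y] ampliated_familyD[OF Y]
  show "mat_adjoint (natural_extension k n Y v) * natural_extension k n Y v =
      1\<^sub>m (dim_col (natural_extension k n Y v))"
  proof (rule intertwiners_separate[OF v])
    fix x S assume S: "S \<in> Mor (U x) v"
    note [simp] = Mor_irreducible_dim[OF S]
    have "mat_adjoint (natural_extension k n Y v) * natural_extension k n Y v * ampliation k n S =
        mat_adjoint (natural_extension k n Y v) * ampliation k n S * Y x"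
      by (simp add: mult_mat_assoc natural_extension(2)[OF v Y S])
    also have "\<dots> = ampliation k n S * (mat_adjoint (Y x) * Y x)"
      by (simp add: mult_mat_assoc natural_extension_adjoint[OF v Y S])
    finally show "mat_adjoint (natural_extension k n Y v) * natural_extension k n Y v * ampliation k n S =
        1\<^sub>m (dim_col (natural_extension k n Y v)) * ampliation k n S"
      using unitary[of x] by (simp add: unitary_mat_def)
  qed simp_all
qed (use v Y in simp)


section \<open>Words of irreducible corepresentations\<close>

definition word :: "'i list \<Rightarrow> 'a mat" where
  "word xs = foldr (\<boxtimes>) (map U xs) (1\<^sub>m 1)"

lemma word_Nil [simp]: "word [] = 1\<^sub>m 1"
  by (simp add: word_def)

lemma corep_word [simp]: "corep (word xs)"
  and word_Cons: "word (x # xs) = U x \<otimes>\<^sub>m word xs"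
proof -
  have *: "corep (word xs)" for xs
  proof (induction xs)
    case Nil
    then show ?case using corep_trivial by simp
  next
    case (Cons x xs)
    have "word (x # xs) = U x \<boxtimes> word xs" by (simp add: word_def)
    also have "\<dots> = U x \<otimes>\<^sub>m word xs"
      by (rule boxtimes_eq_kronecker) (use corepD(2)[OF Cons] in auto)
    finally show ?case using corep_kronecker[OF corep_irreducible Cons] by simp
  qed
  show "corep (word xs)" by (rule *)
  have "word (x # xs) = U x \<boxtimes> word xs" by (simp add: word_def)
  then show "word (x # xs) = U x \<otimes>\<^sub>m word xs"
    by (simp add: boxtimes_eq_kronecker corepD(2)[OF *])
qed

lemma word_append: "word (xs @ ys) = word xs \<otimes>\<^sub>m word ys"
  by (induction xs) (auto simp: word_Cons kronecker_assoc)

lemma word_singleton: "word [x] = U x"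
  by (simp add: word_Cons)

lemma word_dim [simp]: "dim_row (word xs) = prod_list (map (irr_dim U) xs)"
  "dim_col (word xs) = prod_list (map (irr_dim U) xs)"
  by (induction xs) (auto simp: word_Cons)

lemma irr_mor_word: "irr_mor U xs ys = Mor (word xs) (word ys)"
  by (simp add: irr_mor_def word_def)

lemma irr_mor_dim:
  assumes "S \<in> irr_mor U xs ys"
  shows "dim_row S = prod_list (map (irr_dim U) ys)" "dim_col S = prod_list (map (irr_dim U) xs)"
  using assms MorD(1,2)[of S "word xs" "word ys"] by (auto simp: irr_mor_word)

lemma irr_mor_one: "1\<^sub>m (prod_list (map (irr_dim U) xs)) \<in> irr_mor U xs xs"
  using Mor_one[of "word xs"] by (simp add: irr_mor_word)

lemma irr_mor_mult: "S \<in> irr_mor U ys zs \<Longrightarrow> T \<in> irr_mor U xs ys \<Longrightarrow> S * T \<in> irr_mor U xs zs"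
  unfolding irr_mor_word by (rule Mor_mult) simp_all

lemma irr_mor_adjoint: "S \<in> irr_mor U xs ys \<Longrightarrow> mat_adjoint S \<in> irr_mor U ys xs"
  unfolding irr_mor_word by (rule corep_Mor_adjoint) simp_all

lemma irr_mor_kronecker:
  "S \<in> irr_mor U xs ys \<Longrightarrow> T \<in> irr_mor U xs' ys' \<Longrightarrow> S \<otimes>\<^sub>m T \<in> irr_mor U (xs @ xs') (ys @ ys')"
  unfolding irr_mor_word word_append by (rule Mor_kronecker) simp_all

lemma irr_mor_singleton: "irr_mor U [x] ys = Mor (U x) (word ys)"
  by (simp add: irr_mor_word word_singleton)

lemma irr_mor_trivial_right: "irr_mor U xs (ys @ [\<epsilon>]) = irr_mor U xs ys"
  and irr_mor_trivial_left: "irr_mor U xs (\<epsilon> # ys) = irr_mor U xs ys"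
  by (simp_all add: irr_mor_word word_append word_Cons trivial)

lemma irr_dim_trivial: "irr_dim U \<epsilon> = 1"
  by (simp add: irr_dim_def trivial)


end

section \<open>The dual comultiplication\<close>

lemma mult_kronecker_one_entry:
  fixes A T :: "complex mat"
  assumes "dim_col A = dim_row T * n" "i < dim_row A" "q < dim_col T" "l < n"
  shows "(A * (T \<otimes>\<^sub>m 1\<^sub>m n)) $$ (i, q * n + l) = (\<Sum>r<dim_row T. A $$ (i, r * n + l) * T $$ (r, q))"
proof -
  have "(A * (T \<otimes>\<^sub>m 1\<^sub>m n)) $$ (i, q * n + l) =
      (\<Sum>k<dim_row T * n. A $$ (i, k div n * n + k mod n) * (T $$ (k div n, q) * 1\<^sub>m n $$ (k mod n, l)))"
    using assms by (subst mult_mat_entry) (auto simp: pair_index_bound intro!: sum.cong)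
  also have "\<dots> = (\<Sum>r<dim_row T. \<Sum>s<n. A $$ (i, r * n + s) * (T $$ (r, q) * 1\<^sub>m n $$ (s, l)))"
    by (rule sum_div_mod)
  also have "\<dots> = (\<Sum>r<dim_row T. \<Sum>s<n. if s = l then A $$ (i, r * n + s) * T $$ (r, q) else 0)"
    using assms by (intro sum.cong refl) auto
  finally show ?thesis using assms by simp
qed

lemma kronecker_one_mult_entry:
  fixes A T :: "complex mat"
  assumes "dim_row A = dim_col T * n" "j < dim_col A" "p < dim_row T" "k < n"
  shows "((T \<otimes>\<^sub>m 1\<^sub>m n) * A) $$ (p * n + k, j) = (\<Sum>r<dim_col T. T $$ (p, r) * A $$ (r * n + k, j))"
proof -
  have "((T \<otimes>\<^sub>m 1\<^sub>m n) * A) $$ (p * n + k, j) =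
      (\<Sum>m<dim_col T * n. T $$ (p, m div n) * 1\<^sub>m n $$ (k, m mod n) * A $$ (m div n * n + m mod n, j))"
    using assms by (subst mult_mat_entry) (auto simp: pair_index_bound intro!: sum.cong)
  also have "\<dots> = (\<Sum>r<dim_col T. \<Sum>s<n. T $$ (p, r) * 1\<^sub>m n $$ (k, s) * A $$ (r * n + s, j))"
    by (rule sum_div_mod)
  also have "\<dots> = (\<Sum>r<dim_col T. \<Sum>s<n. if s = k then T $$ (p, r) * A $$ (r * n + s, j) else 0)"
    using assms by (intro sum.cong refl) auto
  finally show ?thesis using assms by simp
qed

lemma mult_one_kronecker_entry:
  fixes A T :: "complex mat"
  assumes "dim_col A = n * dim_row T" "i < dim_row A" "q < dim_col T" "l < n"
  shows "(A * (1\<^sub>m n \<otimes>\<^sub>m T)) $$ (i, l * dim_col T + q) =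
    (\<Sum>r<dim_row T. A $$ (i, l * dim_row T + r) * T $$ (r, q))"
proof -
  let ?m = "dim_row T"
  have "(A * (1\<^sub>m n \<otimes>\<^sub>m T)) $$ (i, l * dim_col T + q) =
      (\<Sum>k<n * ?m. A $$ (i, k div ?m * ?m + k mod ?m) * (1\<^sub>m n $$ (k div ?m, l) * T $$ (k mod ?m, q)))"
    using assms by (subst mult_mat_entry) (auto simp: pair_index_bound intro!: sum.cong)
  also have "\<dots> = (\<Sum>s<n. \<Sum>r<?m. A $$ (i, s * ?m + r) * (1\<^sub>m n $$ (s, l) * T $$ (r, q)))"
    by (rule sum_div_mod)
  also have "\<dots> = (\<Sum>s<n. if s = l then \<Sum>r<?m. A $$ (i, s * ?m + r) * T $$ (r, q) else 0)"
    using assms by (intro sum.cong refl) auto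
  finally show ?thesis using assms by simp
qed

lemma one_kronecker_mult_entry:
  fixes A T :: "complex mat"
  assumes "dim_row A = n * dim_col T" "j < dim_col A" "p < dim_row T" "k < n"
  shows "((1\<^sub>m n \<otimes>\<^sub>m T) * A) $$ (k * dim_row T + p, j) =
    (\<Sum>r<dim_col T. T $$ (p, r) * A $$ (k * dim_col T + r, j))"
proof -
  let ?m = "dim_col T"
  have "((1\<^sub>m n \<otimes>\<^sub>m T) * A) $$ (k * dim_row T + p, j) =
      (\<Sum>i<n * ?m. 1\<^sub>m n $$ (k, i div ?m) * T $$ (p, i mod ?m) * A $$ (i div ?m * ?m + i mod ?m, j))"
    using assms by (subst mult_mat_entry) (auto simp: pair_index_bound intro!: sum.cong)
  also have "\<dots> = (\<Sum>s<n. \<Sum>r<?m. 1\<^sub>m n $$ (k, s) * T $$ (p, r) * A $$ (s * ?m + r, j))"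
    by (rule sum_div_mod)
  also have "\<dots> = (\<Sum>s<n. if s = k then \<Sum>r<?m. T $$ (p, r) * A $$ (s * ?m + r, j) else 0)"
    using assms by (intro sum.cong refl) auto
  finally show ?thesis using assms by simp
qed

context compact_quantum_group_irreps
begin

lemma Delta_hat_eq:
  assumes "a \<in> families (irr_dim U)"
  shows "Delta_hat U a (y, z) = natural_extension 1 1 a (U y \<otimes>\<^sub>m U z)"
proof -
  have a: "ampliated_family 1 1 a"
    using assms by (simp add: ampliated_family_def families_def)
  have c: "corep (U y \<otimes>\<^sub>m U z)" by (rule corep_kronecker) simp_all
  have mor: "irr_mor U [x] [y, z] = Mor (U x) (U y \<otimes>\<^sub>m U z)" for x
    by (simp add: irr_mor_singleton word_Cons)
  show ?thesis
    unfolding Delta_hat_def prod.case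
  proof (rule the_equality)
    show "natural_extension 1 1 a (U y \<otimes>\<^sub>m U z) \<in> carrier_mat (irr_dim2 U (y, z)) (irr_dim2 U (y, z)) \<and>
      (\<forall>x. \<forall>S \<in> irr_mor U [x] [y, z]. natural_extension 1 1 a (U y \<otimes>\<^sub>m U z) * S = S * a x)"
      using natural_extension[OF c a] by (auto simp: irr_dim2_def mor ampliation_trivial)
    fix m assume "m \<in> carrier_mat (irr_dim2 U (y, z)) (irr_dim2 U (y, z)) \<and>
      (\<forall>x. \<forall>S \<in> irr_mor U [x] [y, z]. m * S = S * a x)"
    then show "m = natural_extension 1 1 a (U y \<otimes>\<^sub>m U z)"
      by (intro natural_extension_unique[OF c a]) (auto simp: irr_dim2_def mor ampliation_trivial)
  qed
qed

lemma Delta_hat: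
  assumes "a \<in> families (irr_dim U)"
  shows "Delta_hat U a (y, z) \<in> carrier_mat (irr_dim2 U (y, z)) (irr_dim2 U (y, z))"
    "S \<in> Mor (U x) (U y \<otimes>\<^sub>m U z) \<Longrightarrow> Delta_hat U a (y, z) * S = S * a x"
proof -
  have a: "ampliated_family 1 1 a"
    using assms by (simp add: ampliated_family_def families_def)
  have c: "corep (U y \<otimes>\<^sub>m U z)" by (rule corep_kronecker) simp_all
  show "Delta_hat U a (y, z) \<in> carrier_mat (irr_dim2 U (y, z)) (irr_dim2 U (y, z))"
    "S \<in> Mor (U x) (U y \<otimes>\<^sub>m U z) \<Longrightarrow> Delta_hat U a (y, z) * S = S * a x"
    using natural_extension[OF c a] by (simp_all add: Delta_hat_eq[OF assms] irr_dim2_def ampliation_trivial)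
qed

text \<open>Entrywise, the slices of \<open>D (T \<otimes> 1)\<close> and of \<open>(T \<otimes> 1) X\<close> are the products of \<open>T\<close> with the slices of
  \<open>D\<close> and of \<open>X\<close>. So the property of \<open>Delta_hat\<close> on all slices of \<open>X\<close> is the property that characterises
  the extension in the first leg.\<close>

lemma Delta_hat_id_eq:
  assumes X: "X \<in> families (irr_dim2 U)"
  shows "Delta_hat_id U X (x, y, z) =
    natural_extension 1 (irr_dim U z) (\<lambda>w. X (w, z)) (U x \<otimes>\<^sub>m U y)"
proof (rule natural_extension_unique)
  let ?n = "irr_dim U z" and ?v = "U x \<otimes>\<^sub>m U y"
  show c: "corep ?v" by (rule corep_kronecker) simp_all
  have X_dim [simp]: "dim_row (X (w, z)) = irr_dim U w * ?n" "dim_col (X (w, z)) = irr_dim U w * ?n" for w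
    using X by (auto simp: families_def irr_dim2_def)
  show "ampliated_family 1 ?n (\<lambda>w. X (w, z))"
    by (auto simp: ampliated_family_def intro!: carrier_matI)
  show dims: "dim_row (Delta_hat_id U X (x, y, z)) = 1 * (dim_row ?v * ?n)"
    "dim_col (Delta_hat_id U X (x, y, z)) = 1 * (dim_row ?v * ?n)"
    by (simp_all add: Delta_hat_id_def irr_dim2_def Let_def)
  fix w T assume T: "T \<in> Mor (U w) ?v"
  note [simp] = Mor_irreducible_dim[OF T]
  have slice: "slice_snd U X z k l \<in> families (irr_dim U)" for k l
    by (auto simp: slice_snd_def families_def)
  show "Delta_hat_id U X (x, y, z) * ampliation 1 ?n T = ampliation 1 ?n T * X (w, z)"
  proof (rule eq_matI)
    fix i j assume "i < dim_row (ampliation 1 ?n T * X (w, z))" "j < dim_col (ampliation 1 ?n T * X (w, z))"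
    then have i: "i < dim_row ?v * ?n" and j: "j < irr_dim U w * ?n" by auto
    define p k q l where "p = i div ?n" "k = i mod ?n" "q = j div ?n" "l = j mod ?n"
    have ij: "i = p * ?n + k" "j = q * ?n + l" by (simp_all only: p_k_q_l_def div_mult_mod_eq)
    have b: "p < dim_row ?v" "k < ?n" "q < irr_dim U w" "l < ?n"
      using div_mod_bounds[OF i] div_mod_bounds[OF j] by (auto simp: p_k_q_l_def)
    have "(Delta_hat_id U X (x, y, z) * ampliation 1 ?n T) $$ (i, j) =
        (\<Sum>r<dim_row ?v. Delta_hat_id U X (x, y, z) $$ (i, r * ?n + l) * T $$ (r, q))"
      unfolding ij(2) using dims i b
      by (simp add: ampliation_trivial mult_kronecker_one_entry del: kronecker_dim)
    also have "\<dots> = (\<Sum>r<dim_row ?v. Delta_hat U (slice_snd U X z k l) (x, y) $$ (p, r) * T $$ (r, q))"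
    proof (intro sum.cong refl)
      fix r assume "r \<in> {..<dim_row ?v}"
      then have r: "r * ?n + l < dim_row ?v * ?n" using b by (intro pair_index_bound) auto
      then show "Delta_hat_id U X (x, y, z) $$ (i, r * ?n + l) * T $$ (r, q) =
          Delta_hat U (slice_snd U X z k l) (x, y) $$ (p, r) * T $$ (r, q)"
        using i b by (simp add: Delta_hat_id_def irr_dim2_def Let_def p_k_q_l_def)
    qed
    also have "\<dots> = (Delta_hat U (slice_snd U X z k l) (x, y) * T) $$ (p, q)"
      using b Delta_hat(1)[OF slice[of k l], where y = x and z = y] by (subst mult_mat_entry) (auto simp: irr_dim2_def)
    also have "\<dots> = (T * slice_snd U X z k l w) $$ (p, q)"
      using Delta_hat(2)[OF slice T] by simp
    also have "\<dots> = (\<Sum>r<irr_dim U w. T $$ (p, r) * X (w, z) $$ (r * ?n + k, j))"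
      using b by (subst mult_mat_entry) (auto simp: slice_snd_def ij(2))
    also have "\<dots> = (ampliation 1 ?n T * X (w, z)) $$ (i, j)"
      unfolding ij(1) using j b by (simp add: ampliation_trivial kronecker_one_mult_entry)
    finally show "(Delta_hat_id U X (x, y, z) * ampliation 1 ?n T) $$ (i, j) =
        (ampliation 1 ?n T * X (w, z)) $$ (i, j)" .
  qed (use dims in simp_all)
qed

lemma id_Delta_hat_eq:
  assumes X: "X \<in> families (irr_dim2 U)"
  shows "id_Delta_hat U X (x, y, z) =
    natural_extension (irr_dim U x) 1 (\<lambda>w. X (x, w)) (U y \<otimes>\<^sub>m U z)"
proof (rule natural_extension_unique)
  let ?m = "irr_dim U x" and ?v = "U y \<otimes>\<^sub>m U z"
  show c: "corep ?v" by (rule corep_kronecker) simp_all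
  have X_dim [simp]: "dim_row (X (x, w)) = ?m * irr_dim U w" "dim_col (X (x, w)) = ?m * irr_dim U w" for w
    using X by (auto simp: families_def irr_dim2_def)
  show "ampliated_family ?m 1 (\<lambda>w. X (x, w))"
    by (auto simp: ampliated_family_def intro!: carrier_matI)
  show dims: "dim_row (id_Delta_hat U X (x, y, z)) = ?m * (dim_row ?v * 1)"
    "dim_col (id_Delta_hat U X (x, y, z)) = ?m * (dim_row ?v * 1)"
    by (simp_all add: id_Delta_hat_def irr_dim2_def Let_def)
  fix w T assume T: "T \<in> Mor (U w) ?v"
  note T_dim = Mor_irreducible_dim[OF T]
  have slice: "slice_fst U X x k l \<in> families (irr_dim U)" for k l
    by (auto simp: slice_fst_def families_def)
  show "id_Delta_hat U X (x, y, z) * ampliation ?m 1 T = ampliation ?m 1 T * X (x, w)"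
  proof (rule eq_matI)
    fix i j assume "i < dim_row (ampliation ?m 1 T * X (x, w))" "j < dim_col (ampliation ?m 1 T * X (x, w))"
    then have i: "i < ?m * dim_row T" and j: "j < ?m * dim_col T" by (auto simp: T_dim)
    define k p l q where "k = i div dim_row T" "p = i mod dim_row T" "l = j div dim_col T" "q = j mod dim_col T"
    have ij: "i = k * dim_row T + p" "j = l * dim_col T + q" by (simp_all only: k_p_l_q_def div_mult_mod_eq)
    have b: "p < dim_row T" "k < ?m" "q < dim_col T" "l < ?m"
      using div_mod_bounds[OF i] div_mod_bounds[OF j] by (auto simp: k_p_l_q_def)
    have "(id_Delta_hat U X (x, y, z) * ampliation ?m 1 T) $$ (i, j) =
        (\<Sum>r<dim_row T. id_Delta_hat U X (x, y, z) $$ (i, l * dim_row T + r) * T $$ (r, q))"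
      unfolding ij(2) using dims i b
      by (simp add: ampliation_trivial mult_one_kronecker_entry T_dim(1)[symmetric] del: kronecker_dim)
    also have "\<dots> = (\<Sum>r<dim_row T. Delta_hat U (slice_fst U X x k l) (y, z) $$ (p, r) * T $$ (r, q))"
    proof (intro sum.cong refl)
      fix r assume "r \<in> {..<dim_row T}"
      then have r: "l * dim_row T + r < ?m * dim_row T" "r < dim_row T" using b by (auto intro: pair_index_bound)
      then show "id_Delta_hat U X (x, y, z) $$ (i, l * dim_row T + r) * T $$ (r, q) =
          Delta_hat U (slice_fst U X x k l) (y, z) $$ (p, r) * T $$ (r, q)"
        using i b by (simp add: id_Delta_hat_def irr_dim2_def Let_def k_p_l_q_def T_dim)
    qed
    also have "\<dots> = (Delta_hat U (slice_fst U X x k l) (y, z) * T) $$ (p, q)"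
      using b Delta_hat(1)[OF slice[of k l], where y = y and z = z] by (subst mult_mat_entry) (auto simp: irr_dim2_def T_dim)
    also have "\<dots> = (T * slice_fst U X x k l w) $$ (p, q)"
      using Delta_hat(2)[OF slice T] by simp
    also have "\<dots> = (\<Sum>r<dim_col T. T $$ (p, r) * X (x, w) $$ (k * dim_col T + r, j))"
      using b by (subst mult_mat_entry) (auto simp: slice_fst_def ij(2) T_dim)
    also have "\<dots> = (ampliation ?m 1 T * X (x, w)) $$ (i, j)"
      unfolding ij(1) using j b
      by (simp only: ampliation_trivial One_nat_def) (subst one_kronecker_mult_entry, simp_all add: T_dim)
    finally show "(id_Delta_hat U X (x, y, z) * ampliation ?m 1 T) $$ (i, j) =
        (ampliation ?m 1 T * X (x, w)) $$ (i, j)" .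
  qed (use dims in \<open>simp_all add: T_dim\<close>)
qed

end


section \<open>The structure of a dimension-preserving fiber functor\<close>

context compact_quantum_group_irreps
begin

definition dimension_preserving :: "'i fiber_data \<Rightarrow> bool" where
  "dimension_preserving \<phi> \<longleftrightarrow> unitary_fiber_functor U \<epsilon> \<phi> \<and> fib_dim \<phi> = irr_dim U"

abbreviation word_dim :: "'i list \<Rightarrow> nat" where
  "word_dim xs \<equiv> prod_list (map (irr_dim U) xs)"

lemma functor_clauses:
  assumes "dimension_preserving \<phi>"
  shows "\<forall>xs ys S. xs \<noteq> [] \<and> ys \<noteq> [] \<and> S \<in> irr_mor U xs ys \<longrightarrow>
      fib_map \<phi> xs ys S \<in> carrier_mat (word_dim ys) (word_dim xs)"
    "\<forall>xs ys S. \<not> (xs \<noteq> [] \<and> ys \<noteq> [] \<and> S \<in> irr_mor U xs ys) \<longrightarrow> fib_map \<phi> xs ys S = undefined"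
    "\<forall>xs ys S T. xs \<noteq> [] \<and> ys \<noteq> [] \<and> S \<in> irr_mor U xs ys \<longrightarrow>
      xs \<noteq> [] \<and> ys \<noteq> [] \<and> T \<in> irr_mor U xs ys \<longrightarrow>
      fib_map \<phi> xs ys (S + T) = fib_map \<phi> xs ys S + fib_map \<phi> xs ys T"
    "\<forall>xs ys S c. xs \<noteq> [] \<and> ys \<noteq> [] \<and> S \<in> irr_mor U xs ys \<longrightarrow>
      fib_map \<phi> xs ys (c \<cdot>\<^sub>m S) = c \<cdot>\<^sub>m fib_map \<phi> xs ys S"
    "\<forall>x. fib_map \<phi> [x] [x] (1\<^sub>m (irr_dim U x)) = 1\<^sub>m (irr_dim U x)"
    "\<forall>x. fib_map \<phi> [x] [x, \<epsilon>] (1\<^sub>m (irr_dim U x)) = 1\<^sub>m (irr_dim U x)"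
    "\<forall>x. fib_map \<phi> [x] [\<epsilon>, x] (1\<^sub>m (irr_dim U x)) = 1\<^sub>m (irr_dim U x)"
    "\<forall>xs ys S xs' ys' T. xs \<noteq> [] \<and> ys \<noteq> [] \<and> S \<in> irr_mor U xs ys \<longrightarrow>
      xs' \<noteq> [] \<and> ys' \<noteq> [] \<and> T \<in> irr_mor U xs' ys' \<longrightarrow>
      fib_map \<phi> (xs @ xs') (ys @ ys') (S \<otimes>\<^sub>m T) = fib_map \<phi> xs ys S \<otimes>\<^sub>m fib_map \<phi> xs' ys' T"
    "\<forall>xs ys S. xs \<noteq> [] \<and> ys \<noteq> [] \<and> S \<in> irr_mor U xs ys \<longrightarrow>
      fib_map \<phi> ys xs (mat_adjoint S) = mat_adjoint (fib_map \<phi> xs ys S)"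
    "\<forall>xs ys zs S T. ys \<noteq> [] \<and> zs \<noteq> [] \<and> S \<in> irr_mor U ys zs \<longrightarrow>
      xs \<noteq> [] \<and> ys \<noteq> [] \<and> T \<in> irr_mor U xs ys \<longrightarrow>
      fib_map \<phi> xs zs (S * T) = fib_map \<phi> ys zs S * fib_map \<phi> xs ys T"
  by ((insert assms[unfolded dimension_preserving_def unitary_fiber_functor_def Let_def, THEN conjunct1,
        unfolded assms[unfolded dimension_preserving_def, THEN conjunct2]]; elim conjE; assumption)+)

lemma functor_dim [simp]:
  assumes "dimension_preserving \<phi>" "xs \<noteq> []" "ys \<noteq> []" "S \<in> irr_mor U xs ys"
  shows "dim_row (fib_map \<phi> xs ys S) = word_dim ys" "dim_col (fib_map \<phi> xs ys S) = word_dim xs"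
  using functor_clauses(1)[OF assms(1)] assms(2-) by blast+

lemma functor_undefined:
  assumes "dimension_preserving \<phi>" "\<not> (xs \<noteq> [] \<and> ys \<noteq> [] \<and> S \<in> irr_mor U xs ys)"
  shows "fib_map \<phi> xs ys S = undefined"
  using functor_clauses(2)[OF assms(1)] assms(2) by blast

lemma functor_linear:
  assumes "dimension_preserving \<phi>" "xs \<noteq> []" "ys \<noteq> []" "S \<in> irr_mor U xs ys"
  shows "T \<in> irr_mor U xs ys \<Longrightarrow> fib_map \<phi> xs ys (S + T) = fib_map \<phi> xs ys S + fib_map \<phi> xs ys T"
    "fib_map \<phi> xs ys (c \<cdot>\<^sub>m S) = c \<cdot>\<^sub>m fib_map \<phi> xs ys S"
  using functor_clauses(3,4)[OF assms(1)] assms(2-) by blast+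

lemma functor_unital:
  assumes "dimension_preserving \<phi>"
  shows "fib_map \<phi> [x] [x] (1\<^sub>m (irr_dim U x)) = 1\<^sub>m (irr_dim U x)"
    "fib_map \<phi> [x] [x, \<epsilon>] (1\<^sub>m (irr_dim U x)) = 1\<^sub>m (irr_dim U x)"
    "fib_map \<phi> [x] [\<epsilon>, x] (1\<^sub>m (irr_dim U x)) = 1\<^sub>m (irr_dim U x)"
  using functor_clauses(5-7)[OF assms] by blast+

lemma functor_kronecker:
  assumes "dimension_preserving \<phi>" "xs \<noteq> []" "ys \<noteq> []" "S \<in> irr_mor U xs ys"
    and "xs' \<noteq> []" "ys' \<noteq> []" "T \<in> irr_mor U xs' ys'"
  shows "fib_map \<phi> (xs @ xs') (ys @ ys') (S \<otimes>\<^sub>m T) = fib_map \<phi> xs ys S \<otimes>\<^sub>m fib_map \<phi> xs' ys' T"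
  using functor_clauses(8)[OF assms(1)] assms(2-) by blast

lemma functor_adjoint:
  assumes "dimension_preserving \<phi>" "xs \<noteq> []" "ys \<noteq> []" "S \<in> irr_mor U xs ys"
  shows "fib_map \<phi> ys xs (mat_adjoint S) = mat_adjoint (fib_map \<phi> xs ys S)"
  using functor_clauses(9)[OF assms(1)] assms(2-) by blast

lemma functor_mult:
  assumes "dimension_preserving \<phi>" "xs \<noteq> []" "ys \<noteq> []" "zs \<noteq> []"
    and "S \<in> irr_mor U ys zs" "T \<in> irr_mor U xs ys"
  shows "fib_map \<phi> xs zs (S * T) = fib_map \<phi> ys zs S * fib_map \<phi> xs ys T"
  using functor_clauses(10)[OF assms(1)] assms(2-) by blast

lemma functor_one:
  assumes \<phi>: "dimension_preserving \<phi>" and "xs \<noteq> []"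
  shows "fib_map \<phi> xs xs (1\<^sub>m (word_dim xs)) = 1\<^sub>m (word_dim xs)"
  using assms(2)
proof (induction xs rule: list_nonempty_induct)
  case (single x)
  then show ?case using functor_unital(1)[OF \<phi>] by simp
next
  case (cons x xs)
  have "fib_map \<phi> ([x] @ xs) ([x] @ xs) (1\<^sub>m (irr_dim U x) \<otimes>\<^sub>m 1\<^sub>m (word_dim xs)) =
      fib_map \<phi> [x] [x] (1\<^sub>m (irr_dim U x)) \<otimes>\<^sub>m fib_map \<phi> xs xs (1\<^sub>m (word_dim xs))"
    using irr_mor_one[of "[x]"] irr_mor_one[of xs] cons(1) by (intro functor_kronecker[OF \<phi>]) simp_all
  then show ?case by (simp add: functor_unital(1)[OF \<phi>] cons(2))
qed

text \<open>By Schur's lemma such an \<open>S\<close> is a multiple of the identity or zero.\<close>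

lemma functor_irreducible:
  assumes \<phi>: "dimension_preserving \<phi>" and S: "S \<in> irr_mor U [x] [y]"
  shows "fib_map \<phi> [x] [y] S = S"
proof -
  have "\<exists>c. x = y \<and> S = c \<cdot>\<^sub>m 1\<^sub>m (irr_dim U x) \<or> S = 0 \<cdot>\<^sub>m S"
  proof (cases "x = y")
    case True
    then show ?thesis using S by (auto simp: irr_mor_singleton word_singleton Mor_irreducible)
  next
    case False
    then have "S = 0\<^sub>m (irr_dim U y) (irr_dim U x)"
      using S schur by (simp add: irr_mor_singleton word_singleton)
    then show ?thesis by auto
  qed
  then consider c where "x = y" "S = c \<cdot>\<^sub>m 1\<^sub>m (irr_dim U x)" | "S = 0 \<cdot>\<^sub>m S" by auto
  then show ?thesis
  proof cases
    case 1
    then show ?thesis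
      using functor_linear(2)[OF \<phi>, of "[x]" "[x]" "1\<^sub>m (irr_dim U x)"] irr_mor_one[of "[x]"]
      by (simp add: functor_unital(1)[OF \<phi>])
  next
    case 2
    have "fib_map \<phi> [x] [y] S = 0 \<cdot>\<^sub>m fib_map \<phi> [x] [y] S"
      by (subst 2) (use functor_linear(2)[OF \<phi> _ _ S] in simp)
    also have "\<dots> = 0 \<cdot>\<^sub>m S"
      by (rule eq_matI) (use functor_dim[OF \<phi> _ _ S] irr_mor_dim[OF S] in auto)
    finally show ?thesis using 2 by simp
  qed
qed

text \<open>The unitaries \<open>J\<^bsub>ys\<^esub>\<close> with \<open>\<phi>(S) = J\<^bsub>ys\<^esub> S\<close> for every intertwiner \<open>S\<close> from an irreducible
  corepresentation to the word \<open>ys\<close>. For words of length two they are the adjoints of the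
  components of the cocycle, and in general they implement \<open>\<phi>\<close> by conjugation.\<close>

definition structure_unitary :: "'i fiber_data \<Rightarrow> 'i list \<Rightarrow> complex mat" where
  "structure_unitary \<phi> ys = (SOME M. M \<in> carrier_mat (word_dim ys) (word_dim ys) \<and>
     (\<forall>x. \<forall>S \<in> irr_mor U [x] ys. M * S = fib_map \<phi> [x] ys S))"

lemma intertwiners_separate_word:
  assumes "dim_row A = dim_row B" "dim_col A = word_dim ys" "dim_col B = word_dim ys"
    and "\<And>x S. S \<in> irr_mor U [x] ys \<Longrightarrow> A * S = B * S"
  shows "A = B"
  by (rule intertwiners_separate[of "word ys" A B 1 1])
    (use assms in \<open>simp_all add: ampliation_trivial irr_mor_singleton\<close>)

lemma structure_unitary:
  assumes \<phi>: "dimension_preserving \<phi>" and ys: "ys \<noteq> []"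
  shows "structure_unitary \<phi> ys \<in> carrier_mat (word_dim ys) (word_dim ys)"
    "S \<in> irr_mor U [x] ys \<Longrightarrow> fib_map \<phi> [x] ys S = structure_unitary \<phi> ys * S"
proof -
  have "\<exists>M \<in> carrier_mat (word_dim ys) (1 * (dim_row (word ys) * 1)).
      \<forall>x. \<forall>S \<in> Mor (U x) (word ys). M * ampliation 1 1 S = fib_map \<phi> [x] ys S"
    by (rule intertwiners_extend)
      (use functor_linear[OF \<phi> _ ys] functor_dim[OF \<phi> _ ys] in
        \<open>auto simp: irr_mor_singleton intro!: carrier_matI\<close>)
  then have "\<exists>M. M \<in> carrier_mat (word_dim ys) (word_dim ys) \<and>
      (\<forall>x. \<forall>S \<in> irr_mor U [x] ys. M * S = fib_map \<phi> [x] ys S)"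
    by (auto simp: ampliation_trivial irr_mor_singleton)
  then have *: "structure_unitary \<phi> ys \<in> carrier_mat (word_dim ys) (word_dim ys) \<and>
      (\<forall>x. \<forall>S \<in> irr_mor U [x] ys. structure_unitary \<phi> ys * S = fib_map \<phi> [x] ys S)"
    unfolding structure_unitary_def by (rule someI_ex)
  show "structure_unitary \<phi> ys \<in> carrier_mat (word_dim ys) (word_dim ys)"
    "S \<in> irr_mor U [x] ys \<Longrightarrow> fib_map \<phi> [x] ys S = structure_unitary \<phi> ys * S"
    using * by auto
qed

lemma structure_unitary_dim [simp]:
  assumes "dimension_preserving \<phi>" "ys \<noteq> []"
  shows "dim_row (structure_unitary \<phi> ys) = word_dim ys" "dim_col (structure_unitary \<phi> ys) = word_dim ys"
  using structure_unitary(1)[OF assms] by auto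

text \<open>For intertwiners \<open>S\<close> and \<open>T\<close> from irreducible corepresentations,
  \<open>S\<^sup>* J\<^sup>* J T = \<phi>(S)\<^sup>* \<phi>(T) = \<phi>(S\<^sup>* T) = S\<^sup>* T\<close>, and such intertwiners separate operators.\<close>

lemma structure_unitary_unitary:
  assumes \<phi>: "dimension_preserving \<phi>" and ys: "ys \<noteq> []"
  shows "unitary_mat (structure_unitary \<phi> ys)"
proof (rule square_isometry_unitary)
  let ?J = "structure_unitary \<phi> ys"
  note J_dim [simp] = structure_unitary_dim[OF \<phi> ys]
  have fix_adj: "mat_adjoint S * (mat_adjoint ?J * ?J) = mat_adjoint S" if S: "S \<in> irr_mor U [x] ys" for x S
  proof (rule intertwiners_separate_word[where ys = ys])
    note [simp] = irr_mor_dim[OF S]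
    fix y T assume T: "T \<in> irr_mor U [y] ys"
    note [simp] = irr_mor_dim[OF T]
    have ST: "mat_adjoint S * T \<in> irr_mor U [y] [x]"
      by (rule irr_mor_mult[OF irr_mor_adjoint[OF S] T])
    have "mat_adjoint S * (mat_adjoint ?J * ?J) * T = mat_adjoint (fib_map \<phi> [x] ys S) * fib_map \<phi> [y] ys T"
      using structure_unitary(2)[OF \<phi> ys S] structure_unitary(2)[OF \<phi> ys T] by (simp add: mult_mat_assoc)
    also have "\<dots> = fib_map \<phi> [y] [x] (mat_adjoint S * T)"
      using functor_adjoint[OF \<phi> _ ys S] functor_mult[OF \<phi> _ ys _ irr_mor_adjoint[OF S] T] by simp
    also have "\<dots> = mat_adjoint S * T" by (rule functor_irreducible[OF \<phi> ST])
    finally show "mat_adjoint S * (mat_adjoint ?J * ?J) * T = mat_adjoint S * T" .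
  qed (use irr_mor_dim[OF S] in simp_all)
  show "mat_adjoint ?J * ?J = 1\<^sub>m (dim_col ?J)"
  proof (rule intertwiners_separate_word[where ys = ys])
    fix x S assume S: "S \<in> irr_mor U [x] ys"
    note [simp] = irr_mor_dim[OF S]
    have "mat_adjoint (mat_adjoint S * (mat_adjoint ?J * ?J)) = mat_adjoint (mat_adjoint S)"
      by (simp only: fix_adj[OF S])
    then show "mat_adjoint ?J * ?J * S = 1\<^sub>m (dim_col ?J) * S" by simp
  qed simp_all
qed (use \<phi> ys in simp)

text \<open>Both sides of the first equation agree after composition with an intertwiner \<open>T\<close> from an irreducible
  corepresentation, since \<open>\<phi>(S) \<phi>(T) = \<phi>(S T)\<close>.\<close>

lemma functor_eq_structure_unitary:
  assumes \<phi>: "dimension_preserving \<phi>" and xs: "xs \<noteq> []" and ys: "ys \<noteq> []" and S: "S \<in> irr_mor U xs ys"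
  shows "fib_map \<phi> xs ys S * structure_unitary \<phi> xs = structure_unitary \<phi> ys * S"
    "fib_map \<phi> xs ys S = structure_unitary \<phi> ys * S * mat_adjoint (structure_unitary \<phi> xs)"
proof -
  note [simp] = structure_unitary_dim[OF \<phi> xs] structure_unitary_dim[OF \<phi> ys] functor_dim[OF \<phi> xs ys S]
    irr_mor_dim[OF S]
  show *: "fib_map \<phi> xs ys S * structure_unitary \<phi> xs = structure_unitary \<phi> ys * S"
  proof (rule intertwiners_separate_word[where ys = xs])
    fix x T assume T: "T \<in> irr_mor U [x] xs"
    note [simp] = irr_mor_dim[OF T]
    show "fib_map \<phi> xs ys S * structure_unitary \<phi> xs * T = structure_unitary \<phi> ys * S * T"
      using structure_unitary(2)[OF \<phi> xs T] functor_mult[OF \<phi> _ xs ys S T]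
        structure_unitary(2)[OF \<phi> ys irr_mor_mult[OF S T]]
      by (simp add: mult_mat_assoc)
  qed simp_all
  have "fib_map \<phi> xs ys S =
      fib_map \<phi> xs ys S * structure_unitary \<phi> xs * mat_adjoint (structure_unitary \<phi> xs)"
    using unitary_matD(2)[OF structure_unitary_unitary[OF \<phi> xs]] by (simp add: mult_mat_assoc)
  then show "fib_map \<phi> xs ys S = structure_unitary \<phi> ys * S * mat_adjoint (structure_unitary \<phi> xs)"
    unfolding * .
qed

lemma structure_unitary_eqI:
  assumes \<phi>: "dimension_preserving \<phi>" and ys: "ys \<noteq> []" and M: "M \<in> carrier_mat (word_dim ys) (word_dim ys)"
    and "\<And>x S. S \<in> irr_mor U [x] ys \<Longrightarrow> fib_map \<phi> [x] ys S = M * S"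
  shows "structure_unitary \<phi> ys = M"
  by (rule intertwiners_separate_word[where ys = ys])
    (use assms structure_unitary_dim[OF \<phi> ys] structure_unitary(2)[OF \<phi> ys] in auto)

text \<open>The identity is an intertwiner from \<open>x\<close> to \<open>x \<otimes> \<epsilon>\<close> and to \<open>\<epsilon> \<otimes> x\<close>.\<close>

lemma structure_unitary_unital:
  assumes \<phi>: "dimension_preserving \<phi>"
  shows "structure_unitary \<phi> [x, \<epsilon>] = 1\<^sub>m (irr_dim U x)" "structure_unitary \<phi> [\<epsilon>, x] = 1\<^sub>m (irr_dim U x)"
proof -
  have "1\<^sub>m (irr_dim U x) \<in> irr_mor U [x] [x, \<epsilon>]" "1\<^sub>m (irr_dim U x) \<in> irr_mor U [x] [\<epsilon>, x]"
    using irr_mor_one[of "[x]"] irr_mor_trivial_right[of "[x]" "[x]"] irr_mor_trivial_left[of "[x]" "[x]"] by simp_all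
  then show "structure_unitary \<phi> [x, \<epsilon>] = 1\<^sub>m (irr_dim U x)" "structure_unitary \<phi> [\<epsilon>, x] = 1\<^sub>m (irr_dim U x)"
    using structure_unitary(2)[OF \<phi>, of "[x, \<epsilon>]" _ x] structure_unitary(2)[OF \<phi>, of "[\<epsilon>, x]" _ x]
      functor_unital(2,3)[OF \<phi>, of x] structure_unitary_dim[OF \<phi>, of "[x, \<epsilon>]"] structure_unitary_dim[OF \<phi>, of "[\<epsilon>, x]"]
    by (simp_all add: irr_dim_trivial)
qed

text \<open>The operator \<open>\<phi>(T \<otimes> 1)\<close> equals \<open>\<phi>(T) \<otimes> 1\<close>, and it is also given by conjugation with structure
  unitaries; similarly for \<open>1 \<otimes> T\<close>.\<close>

lemma structure_unitary_kronecker: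
  assumes \<phi>: "dimension_preserving \<phi>" and xs: "xs \<noteq> []" and ys: "ys \<noteq> []" and T: "T \<in> irr_mor U [x] xs"
  shows "structure_unitary \<phi> (xs @ ys) * (T \<otimes>\<^sub>m 1\<^sub>m (word_dim ys)) =
      ((structure_unitary \<phi> xs * T) \<otimes>\<^sub>m 1\<^sub>m (word_dim ys)) * structure_unitary \<phi> (x # ys)"
    "structure_unitary \<phi> (ys @ xs) * (1\<^sub>m (word_dim ys) \<otimes>\<^sub>m T) =
      (1\<^sub>m (word_dim ys) \<otimes>\<^sub>m (structure_unitary \<phi> xs * T)) * structure_unitary \<phi> (ys @ [x])"
proof -
  have 1: "T \<otimes>\<^sub>m 1\<^sub>m (word_dim ys) \<in> irr_mor U ([x] @ ys) (xs @ ys)"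
    by (rule irr_mor_kronecker[OF T irr_mor_one])
  have 2: "1\<^sub>m (word_dim ys) \<otimes>\<^sub>m T \<in> irr_mor U (ys @ [x]) (ys @ xs)"
    by (rule irr_mor_kronecker[OF irr_mor_one T])
  have "fib_map \<phi> ([x] @ ys) (xs @ ys) (T \<otimes>\<^sub>m 1\<^sub>m (word_dim ys)) =
      (structure_unitary \<phi> xs * T) \<otimes>\<^sub>m 1\<^sub>m (word_dim ys)"
    using functor_kronecker[OF \<phi> _ xs T ys ys irr_mor_one]
    by (simp add: functor_one[OF \<phi> ys] structure_unitary(2)[OF \<phi> xs T])
  then show "structure_unitary \<phi> (xs @ ys) * (T \<otimes>\<^sub>m 1\<^sub>m (word_dim ys)) =
      ((structure_unitary \<phi> xs * T) \<otimes>\<^sub>m 1\<^sub>m (word_dim ys)) * structure_unitary \<phi> (x # ys)"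
    using functor_eq_structure_unitary(1)[OF \<phi> _ _ 1] xs by simp
  have "fib_map \<phi> (ys @ [x]) (ys @ xs) (1\<^sub>m (word_dim ys) \<otimes>\<^sub>m T) =
      1\<^sub>m (word_dim ys) \<otimes>\<^sub>m (structure_unitary \<phi> xs * T)"
    using functor_kronecker[OF \<phi> ys ys irr_mor_one _ xs T]
    by (simp add: functor_one[OF \<phi> ys] structure_unitary(2)[OF \<phi> xs T])
  then show "structure_unitary \<phi> (ys @ xs) * (1\<^sub>m (word_dim ys) \<otimes>\<^sub>m T) =
      (1\<^sub>m (word_dim ys) \<otimes>\<^sub>m (structure_unitary \<phi> xs * T)) * structure_unitary \<phi> (ys @ [x])"
    using functor_eq_structure_unitary(1)[OF \<phi> _ _ 2] ys by simp
qed

text \<open>The structure unitaries of length two determine all others: by the previous lemma, the one of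
  \<open>a # b # cs\<close> is known on the range of \<open>T \<otimes> 1\<close>, for \<open>T\<close> from \<open>x\<close> to \<open>a \<otimes> b\<close>, from those of \<open>[a, b]\<close> and of
  the shorter word \<open>x # cs\<close>, and these ranges span.\<close>

lemma structure_unitary_determined:
  assumes \<phi>: "dimension_preserving \<phi>" and \<psi>: "dimension_preserving \<psi>"
    and agree: "\<And>x y z S. S \<in> irr_mor U [x] [y, z] \<Longrightarrow> fib_map \<phi> [x] [y, z] S = fib_map \<psi> [x] [y, z] S"
    and "ys \<noteq> []"
  shows "structure_unitary \<phi> ys = structure_unitary \<psi> ys"
  using assms(4)
proof (induction "length ys" arbitrary: ys rule: less_induct)
  case less
  consider (one) x where "ys = [x]" | (more) a b cs where "ys = a # b # cs"
    using less.prems by (metis list.exhaust)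
  then show ?case
  proof cases
    case one
    show ?thesis
      by (rule structure_unitary_eqI[OF \<phi> less.prems structure_unitary(1)[OF \<psi> less.prems]])
        (use one structure_unitary(2)[OF \<psi> less.prems] functor_irreducible[OF \<phi>] functor_irreducible[OF \<psi>] in auto)
  next
    case more
    have two: "structure_unitary \<phi> [a, b] = structure_unitary \<psi> [a, b]"
      by (rule structure_unitary_eqI[OF \<phi> _ structure_unitary(1)[OF \<psi>]])
        (use agree structure_unitary(2)[OF \<psi>] in auto)
    show ?thesis
    proof (cases "cs = []")
      case True
      then show ?thesis using two more by simp
    next
      case False
      note [simp] = structure_unitary_dim[OF \<phi> less.prems] structure_unitary_dim[OF \<psi> less.prems]
      show ?thesis
      proof (rule intertwiners_separate[of "U a \<otimes>\<^sub>m U b" _ _ 1 "word_dim cs"])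
        show "corep (U a \<otimes>\<^sub>m U b)" by (rule corep_kronecker) simp_all
        fix x T assume "T \<in> Mor (U x) (U a \<otimes>\<^sub>m U b)"
        then have T: "T \<in> irr_mor U [x] [a, b]" by (simp add: irr_mor_singleton word_Cons)
        have IH: "structure_unitary \<phi> (x # cs) = structure_unitary \<psi> (x # cs)"
          by (rule less.hyps) (use more in auto)
        show "structure_unitary \<phi> ys * ampliation 1 (word_dim cs) T =
            structure_unitary \<psi> ys * ampliation 1 (word_dim cs) T"
          using structure_unitary_kronecker(1)[OF \<phi> _ False T] structure_unitary_kronecker(1)[OF \<psi> _ False T]
          by (simp add: more ampliation_trivial two IH)
      qed (simp_all add: more mult.assoc structure_unitary_dim[OF \<phi>] structure_unitary_dim[OF \<psi>])
    qed
  qed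
qed

lemma functor_determined:
  assumes \<phi>: "dimension_preserving \<phi>" and \<psi>: "dimension_preserving \<psi>"
    and agree: "\<And>x y z S. S \<in> irr_mor U [x] [y, z] \<Longrightarrow> fib_map \<phi> [x] [y, z] S = fib_map \<psi> [x] [y, z] S"
  shows "\<phi> = \<psi>"
proof -
  have "fib_map \<phi> xs ys S = fib_map \<psi> xs ys S" for xs ys S
  proof (cases "xs \<noteq> [] \<and> ys \<noteq> [] \<and> S \<in> irr_mor U xs ys")
    case True
    then show ?thesis
      using structure_unitary_determined[OF \<phi> \<psi> agree] functor_eq_structure_unitary(2)[OF \<phi>]
        functor_eq_structure_unitary(2)[OF \<psi>] by metis
  next
    case False
    then show ?thesis using functor_undefined[OF \<phi>] functor_undefined[OF \<psi>] by metis
  qed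
  then have "fib_map \<phi> = fib_map \<psi>" by blast
  moreover have "fib_dim \<phi> = fib_dim \<psi>" using \<phi> \<psi> by (simp add: dimension_preserving_def)
  ultimately show ?thesis by simp
qed


section \<open>The cocycle of a fiber functor\<close>

definition functor_cocycle :: "'i fiber_data \<Rightarrow> 'i \<times> 'i \<Rightarrow> complex mat" where
  "functor_cocycle \<phi> = (\<lambda>(y, z). mat_adjoint (structure_unitary \<phi> [y, z]))"

lemma functor_cocycle_family:
  assumes "dimension_preserving \<phi>"
  shows "functor_cocycle \<phi> \<in> families (irr_dim2 U)"
proof -
  have "structure_unitary \<phi> [y, z] \<in> carrier_mat (irr_dim U y * irr_dim U z) (irr_dim U y * irr_dim U z)" for y z
    using structure_unitary(1)[OF assms, of "[y, z]"] by simp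
  then show ?thesis by (auto simp: families_def functor_cocycle_def irr_dim2_def)
qed

text \<open>Both sides of the cocycle identity at \<open>(x, y, z)\<close> are the adjoint of the structure unitary of
  \<open>[x, y, z]\<close>; they correspond to reaching this word through \<open>(x \<otimes> y) \<otimes> z\<close> and through \<open>x \<otimes> (y \<otimes> z)\<close>.\<close>

lemma functor_cocycle_triple:
  assumes \<phi>: "dimension_preserving \<phi>"
  shows "Delta_hat_id U (functor_cocycle \<phi>) (x, y, z) * tensor_one U (functor_cocycle \<phi>) (x, y, z) =
      mat_adjoint (structure_unitary \<phi> [x, y, z])"
    "id_Delta_hat U (functor_cocycle \<phi>) (x, y, z) * one_tensor U (functor_cocycle \<phi>) (x, y, z) =
      mat_adjoint (structure_unitary \<phi> [x, y, z])"
proof -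
  let ?J = "structure_unitary \<phi>" and ?X = "functor_cocycle \<phi>"
  note [simp] = structure_unitary_dim[OF \<phi>]
  note eqs = Delta_hat_id_eq[OF functor_cocycle_family[OF \<phi>]] id_Delta_hat_eq[OF functor_cocycle_family[OF \<phi>]]
  have c: "corep (U a \<otimes>\<^sub>m U b)" for a b by (rule corep_kronecker) simp_all
  have fam: "ampliated_family 1 (irr_dim U z) (\<lambda>w. ?X (w, z))" "ampliated_family (irr_dim U x) 1 (\<lambda>w. ?X (x, w))"
    using functor_cocycle_family[OF \<phi>] by (auto simp: ampliated_family_def families_def irr_dim2_def)
  let ?L = "Delta_hat_id U ?X (x, y, z)" and ?R = "id_Delta_hat U ?X (x, y, z)"
  have [simp]: "dim_row ?L = irr_dim U x * irr_dim U y * irr_dim U z" "dim_col ?L = irr_dim U x * irr_dim U y * irr_dim U z"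
    "dim_row ?R = irr_dim U x * (irr_dim U y * irr_dim U z)" "dim_col ?R = irr_dim U x * (irr_dim U y * irr_dim U z)"
    using natural_extension_dim[OF c[of x y] fam(1)] natural_extension_dim[OF c[of y z] fam(2)] by (simp_all add: eqs)
  have X: "?X (a, b) = mat_adjoint (?J [a, b])" for a b by (simp add: functor_cocycle_def)
  have "mat_adjoint (?L * tensor_one U ?X (x, y, z)) = ?J [x, y, z]"
  proof (rule intertwiners_separate[OF c[of x y], where k = 1 and n = "irr_dim U z"])
    fix w T assume T: "T \<in> Mor (U w) (U x \<otimes>\<^sub>m U y)"
    then have T': "T \<in> irr_mor U [w] [x, y]" by (simp add: irr_mor_singleton word_Cons)
    note [simp] = irr_mor_dim[OF T']
    have "mat_adjoint (?L * tensor_one U ?X (x, y, z)) * ampliation 1 (irr_dim U z) T =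
        (?J [x, y] \<otimes>\<^sub>m 1\<^sub>m (irr_dim U z)) * (mat_adjoint ?L * (T \<otimes>\<^sub>m 1\<^sub>m (irr_dim U z)))"
      by (simp add: tensor_one_def X ampliation_trivial mult_mat_assoc)
    also have "\<dots> = (?J [x, y] \<otimes>\<^sub>m 1\<^sub>m (irr_dim U z)) * ((T \<otimes>\<^sub>m 1\<^sub>m (irr_dim U z)) * ?J [w, z])"
      using natural_extension_adjoint[OF c fam(1) T] by (simp add: eqs X ampliation_trivial)
    also have "\<dots> = ((?J [x, y] * T) \<otimes>\<^sub>m 1\<^sub>m (irr_dim U z)) * ?J [w, z]"
      by (simp add: kronecker_mult_complex flip: mult_mat_assoc)
    also have "\<dots> = ?J [x, y, z] * ampliation 1 (irr_dim U z) T"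
      using structure_unitary_kronecker(1)[OF \<phi> _ _ T', of "[z]"] by (simp add: ampliation_trivial)
    finally show "mat_adjoint (?L * tensor_one U ?X (x, y, z)) * ampliation 1 (irr_dim U z) T =
        ?J [x, y, z] * ampliation 1 (irr_dim U z) T" .
  qed (simp_all add: tensor_one_def X mult.assoc)
  then show "?L * tensor_one U ?X (x, y, z) = mat_adjoint (?J [x, y, z])"
    by (metis mat_adjoint_adjoint)
  have "mat_adjoint (?R * one_tensor U ?X (x, y, z)) = ?J [x, y, z]"
  proof (rule intertwiners_separate[OF c[of y z], where k = "irr_dim U x" and n = 1])
    fix w T assume T: "T \<in> Mor (U w) (U y \<otimes>\<^sub>m U z)"
    then have T': "T \<in> irr_mor U [w] [y, z]" by (simp add: irr_mor_singleton word_Cons)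
    note [simp] = irr_mor_dim[OF T']
    have "mat_adjoint (?R * one_tensor U ?X (x, y, z)) * ampliation (irr_dim U x) 1 T =
        (1\<^sub>m (irr_dim U x) \<otimes>\<^sub>m ?J [y, z]) * (mat_adjoint ?R * (1\<^sub>m (irr_dim U x) \<otimes>\<^sub>m T))"
      by (simp add: one_tensor_def X ampliation_trivial mult_mat_assoc)
    also have "\<dots> = (1\<^sub>m (irr_dim U x) \<otimes>\<^sub>m ?J [y, z]) * ((1\<^sub>m (irr_dim U x) \<otimes>\<^sub>m T) * ?J [x, w])"
      using natural_extension_adjoint[OF c fam(2) T] by (simp add: eqs X ampliation_trivial)
    also have "\<dots> = (1\<^sub>m (irr_dim U x) \<otimes>\<^sub>m (?J [y, z] * T)) * ?J [x, w]"
      by (simp add: kronecker_mult_complex flip: mult_mat_assoc)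
    also have "\<dots> = ?J [x, y, z] * ampliation (irr_dim U x) 1 T"
      using structure_unitary_kronecker(2)[OF \<phi> _ _ T', of "[x]"] by (simp add: ampliation_trivial)
    finally show "mat_adjoint (?R * one_tensor U ?X (x, y, z)) * ampliation (irr_dim U x) 1 T =
        ?J [x, y, z] * ampliation (irr_dim U x) 1 T" .
  qed (simp_all add: one_tensor_def X mult.assoc)
  then show "?R * one_tensor U ?X (x, y, z) = mat_adjoint (?J [x, y, z])"
    by (metis mat_adjoint_adjoint)
qed

lemma functor_cocycle_functor:
  assumes \<phi>: "dimension_preserving \<phi>"
  shows "cocycle_fiber_functor U \<epsilon> (functor_cocycle \<phi>) = \<phi>"
  unfolding cocycle_fiber_functor_def
proof (rule the_equality)
  show "unitary_fiber_functor U \<epsilon> \<phi> \<and> fib_dim \<phi> = irr_dim U \<and>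
    (\<forall>x y z. \<forall>S \<in> irr_mor U [x] [y, z].
        fib_map \<phi> [x] [y, z] S = mat_adjoint (functor_cocycle \<phi> (y, z)) * S) \<and>
    (\<forall>a x y z. \<forall>T \<in> irr_mor U [a] [x, y, z].
        fib_map \<phi> [a] [x, y, z] T = mat_adjoint (cocycle_2 U (functor_cocycle \<phi>) (x, y, z)) * T)"
    using \<phi> structure_unitary(2)[OF \<phi>]
    by (simp add: dimension_preserving_def functor_cocycle_triple(1)[OF \<phi>] cocycle_2_def family_mult_def)
      (simp add: functor_cocycle_def)
  fix \<psi> assume \<psi>: "unitary_fiber_functor U \<epsilon> \<psi> \<and> fib_dim \<psi> = irr_dim U \<and>
    (\<forall>x y z. \<forall>S \<in> irr_mor U [x] [y, z].
        fib_map \<psi> [x] [y, z] S = mat_adjoint (functor_cocycle \<phi> (y, z)) * S) \<and>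
    (\<forall>a x y z. \<forall>T \<in> irr_mor U [a] [x, y, z].
        fib_map \<psi> [a] [x, y, z] T = mat_adjoint (cocycle_2 U (functor_cocycle \<phi>) (x, y, z)) * T)"
  show "\<psi> = \<phi>"
    by (rule functor_determined[OF _ \<phi>])
      (use \<psi> structure_unitary(2)[OF \<phi>] in \<open>auto simp: dimension_preserving_def functor_cocycle_def\<close>)
qed

end


section \<open>The fiber functor of a cocycle\<close>

lemma unitary_multiplier_unitary:
  assumes "unitary_multiplier d m"
  shows "m \<in> families d" "unitary_mat (m j)"
proof -
  show m: "m \<in> families d" using assms by (simp add: unitary_multiplier_def multipliers_def)
  have "mat_adjoint (m j) * m j = 1\<^sub>m (d j)" "m j * mat_adjoint (m j) = 1\<^sub>m (d j)"
    using assms by (auto simp: unitary_multiplier_def family_mult_def family_adjoint_def family_one_def dest: fun_cong)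
  moreover have "m j \<in> carrier_mat (d j) (d j)" using m by (simp add: families_def)
  ultimately show "unitary_mat (m j)" by (simp add: unitary_mat_def)
qed

context compact_quantum_group_irreps
begin

context
  fixes \<Omega> :: "'i \<times> 'i \<Rightarrow> complex mat"
  assumes cocycle: "unitary_2_cocycle U \<Omega>" and normal: "normalized U \<epsilon> \<Omega>"
begin

lemma cocycle_unitary: "unitary_mat (\<Omega> (y, z))"
  using cocycle unitary_multiplier_unitary(2) by (auto simp: unitary_2_cocycle_def)

lemma cocycle_family: "\<Omega> \<in> families (irr_dim2 U)"
  using cocycle unitary_multiplier_unitary(1) by (auto simp: unitary_2_cocycle_def)

lemma cocycle_dim [simp]: "dim_row (\<Omega> (y, z)) = irr_dim U y * irr_dim U z"
  "dim_col (\<Omega> (y, z)) = irr_dim U y * irr_dim U z"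
  using cocycle_family by (auto simp: families_def irr_dim2_def)

lemma cocycle_unital: "\<Omega> (\<epsilon>, z) = 1\<^sub>m (irr_dim U z)" "\<Omega> (y, \<epsilon>) = 1\<^sub>m (irr_dim U y)"
proof -
  let ?p = "central_projection U \<epsilon>" and ?one = "family_one (irr_dim U)"
  have "(family_tensor ?p ?one \<star> \<Omega>) (\<epsilon>, z) = family_tensor ?p ?one (\<epsilon>, z)"
    "(family_tensor ?one ?p \<star> \<Omega>) (y, \<epsilon>) = family_tensor ?one ?p (y, \<epsilon>)"
    using normal by (simp_all add: normalized_def Let_def)
  then show "\<Omega> (\<epsilon>, z) = 1\<^sub>m (irr_dim U z)" "\<Omega> (y, \<epsilon>) = 1\<^sub>m (irr_dim U y)"
    by (simp_all add: family_mult_def family_tensor_def central_projection_def family_one_def irr_dim_trivial)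
qed

text \<open>The components of the cocycle with an arbitrary corepresentation \<open>v\<close> in one of the two legs.\<close>

definition cocycle_left :: "'i \<Rightarrow> 'a mat \<Rightarrow> complex mat" where
  "cocycle_left z v = natural_extension 1 (irr_dim U z) (\<lambda>w. \<Omega> (w, z)) v"

definition cocycle_right :: "'i \<Rightarrow> 'a mat \<Rightarrow> complex mat" where
  "cocycle_right x v = natural_extension (irr_dim U x) 1 (\<lambda>w. \<Omega> (x, w)) v"

lemma cocycle_families: "ampliated_family 1 (irr_dim U z) (\<lambda>w. \<Omega> (w, z))"
    "ampliated_family (irr_dim U x) 1 (\<lambda>w. \<Omega> (x, w))"
  by (auto simp: ampliated_family_def intro!: carrier_matI)

lemma cocycle_left_right_dim [simp]:
  assumes "corep v"
  shows "dim_row (cocycle_left z v) = dim_row v * irr_dim U z" "dim_col (cocycle_left z v) = dim_row v * irr_dim U z"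
    "dim_row (cocycle_right x v) = irr_dim U x * dim_row v" "dim_col (cocycle_right x v) = irr_dim U x * dim_row v"
  using natural_extension_dim[OF assms cocycle_families(1)] natural_extension_dim[OF assms cocycle_families(2)]
  by (simp_all add: cocycle_left_def cocycle_right_def)

lemma cocycle_left_right_unitary:
  assumes "corep v"
  shows "unitary_mat (cocycle_left z v)" "unitary_mat (cocycle_right x v)"
  unfolding cocycle_left_def cocycle_right_def
  by (rule natural_extension_unitary[OF assms cocycle_families(1) cocycle_unitary]
      natural_extension_unitary[OF assms cocycle_families(2) cocycle_unitary])+

lemma cocycle_left_right_irreducible:
  "cocycle_left z (U x) = \<Omega> (x, z)" "cocycle_right x (U z) = \<Omega> (x, z)"
  unfolding cocycle_left_def cocycle_right_def
  using natural_extension_irreducible[OF cocycle_families(1)] natural_extension_irreducible[OF cocycle_families(2)]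
  by simp_all

lemma cocycle_left_right_natural:
  assumes "corep v" "corep w" "S \<in> Mor v w"
  shows "cocycle_left z w * (S \<otimes>\<^sub>m 1\<^sub>m (irr_dim U z)) = (S \<otimes>\<^sub>m 1\<^sub>m (irr_dim U z)) * cocycle_left z v"
    "cocycle_right x w * (1\<^sub>m (irr_dim U x) \<otimes>\<^sub>m S) = (1\<^sub>m (irr_dim U x) \<otimes>\<^sub>m S) * cocycle_right x v"
  unfolding cocycle_left_def cocycle_right_def
  using natural_extension_natural[OF assms(1,2) cocycle_families(1) assms(3)]
    natural_extension_natural[OF assms(1,2) cocycle_families(2) assms(3)]
  by (simp_all add: ampliation_trivial)

text \<open>Both sides are natural in the middle factor \<open>v\<close>, so the identity follows from the one for an irreducible
  middle factor, which is the cocycle identity for \<open>\<Omega>\<close>.\<close>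

lemma cocycle_identity:
  assumes v: "corep v"
  shows "cocycle_left z (U x \<otimes>\<^sub>m v) * (cocycle_right x v \<otimes>\<^sub>m 1\<^sub>m (irr_dim U z)) =
    cocycle_right x (v \<otimes>\<^sub>m U z) * (1\<^sub>m (irr_dim U x) \<otimes>\<^sub>m cocycle_left z v)"
proof (rule intertwiners_separate[OF v, where k = "irr_dim U x" and n = "irr_dim U z"])
  have c1: "corep (U x \<otimes>\<^sub>m w)" and c2: "corep (w \<otimes>\<^sub>m U z)" if "corep w" for w
    using that by (simp_all add: corep_kronecker)
  note [simp] = c1[OF v] c2[OF v] c1[OF corep_irreducible] c2[OF corep_irreducible] v
  let ?x = "irr_dim U x" and ?z = "irr_dim U z"
  fix y T assume T: "T \<in> Mor (U y) v"
  note [simp] = Mor_irreducible_dim[OF T]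
  have sq: "square_mat v" using corepD(1)[OF v] .
  have xT: "1\<^sub>m ?x \<otimes>\<^sub>m T \<in> Mor (U x \<otimes>\<^sub>m U y) (U x \<otimes>\<^sub>m v)"
    by (rule Mor_kronecker) (use T sq Mor_one[of "U x"] in simp_all)
  have Tz: "T \<otimes>\<^sub>m 1\<^sub>m ?z \<in> Mor (U y \<otimes>\<^sub>m U z) (v \<otimes>\<^sub>m U z)"
    by (rule Mor_kronecker) (use T sq Mor_one[of "U z"] in simp_all)
  have identity: "cocycle_left z (U x \<otimes>\<^sub>m U y) * (\<Omega> (x, y) \<otimes>\<^sub>m 1\<^sub>m ?z) =
      cocycle_right x (U y \<otimes>\<^sub>m U z) * (1\<^sub>m ?x \<otimes>\<^sub>m \<Omega> (y, z))"
  proof -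
    have "(Delta_hat_id U \<Omega> \<star> tensor_one U \<Omega>) (x, y, z) = (id_Delta_hat U \<Omega> \<star> one_tensor U \<Omega>) (x, y, z)"
      using cocycle by (simp add: unitary_2_cocycle_def)
    then show ?thesis
      by (simp add: family_mult_def tensor_one_def one_tensor_def Delta_hat_id_eq[OF cocycle_family]
          id_Delta_hat_eq[OF cocycle_family] cocycle_left_def cocycle_right_def)
  qed
  have "cocycle_left z (U x \<otimes>\<^sub>m v) * (cocycle_right x v \<otimes>\<^sub>m 1\<^sub>m ?z) * ampliation ?x ?z T =
      cocycle_left z (U x \<otimes>\<^sub>m v) * ((cocycle_right x v * (1\<^sub>m ?x \<otimes>\<^sub>m T)) \<otimes>\<^sub>m 1\<^sub>m ?z)"
    by (simp add: ampliation_def mult_mat_assoc kronecker_mult_complex mult.assoc flip: kronecker_assoc)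
  also have "\<dots> = cocycle_left z (U x \<otimes>\<^sub>m v) * (((1\<^sub>m ?x \<otimes>\<^sub>m T) * \<Omega> (x, y)) \<otimes>\<^sub>m 1\<^sub>m ?z)"
    using cocycle_left_right_natural(2)[OF _ v T, of x] by (simp add: cocycle_left_right_irreducible)
  also have "\<dots> = cocycle_left z (U x \<otimes>\<^sub>m v) * ((1\<^sub>m ?x \<otimes>\<^sub>m T) \<otimes>\<^sub>m 1\<^sub>m ?z) * (\<Omega> (x, y) \<otimes>\<^sub>m 1\<^sub>m ?z)"
    by (simp add: mult_mat_assoc kronecker_mult_complex mult.assoc)
  also have "\<dots> = ((1\<^sub>m ?x \<otimes>\<^sub>m T) \<otimes>\<^sub>m 1\<^sub>m ?z) * (cocycle_left z (U x \<otimes>\<^sub>m U y) * (\<Omega> (x, y) \<otimes>\<^sub>m 1\<^sub>m ?z))"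
    using cocycle_left_right_natural(1)[OF _ _ xT, of z] by (simp add: mult_mat_assoc)
  also have "\<dots> = (1\<^sub>m ?x \<otimes>\<^sub>m (T \<otimes>\<^sub>m 1\<^sub>m ?z)) * (cocycle_right x (U y \<otimes>\<^sub>m U z) * (1\<^sub>m ?x \<otimes>\<^sub>m \<Omega> (y, z)))"
    by (simp add: identity kronecker_assoc)
  also have "\<dots> = cocycle_right x (v \<otimes>\<^sub>m U z) * (1\<^sub>m ?x \<otimes>\<^sub>m (T \<otimes>\<^sub>m 1\<^sub>m ?z)) * (1\<^sub>m ?x \<otimes>\<^sub>m \<Omega> (y, z))"
    using cocycle_left_right_natural(2)[OF _ _ Tz, of x] by (simp add: mult_mat_assoc)
  also have "\<dots> = cocycle_right x (v \<otimes>\<^sub>m U z) * (1\<^sub>m ?x \<otimes>\<^sub>m ((T \<otimes>\<^sub>m 1\<^sub>m ?z) * \<Omega> (y, z)))"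
    by (simp add: mult_mat_assoc kronecker_mult_complex)
  also have "\<dots> = cocycle_right x (v \<otimes>\<^sub>m U z) * (1\<^sub>m ?x \<otimes>\<^sub>m (cocycle_left z v * (T \<otimes>\<^sub>m 1\<^sub>m ?z)))"
    using cocycle_left_right_natural(1)[OF _ v T, of z] by (simp add: cocycle_left_right_irreducible)
  also have "\<dots> = cocycle_right x (v \<otimes>\<^sub>m U z) * (1\<^sub>m ?x \<otimes>\<^sub>m cocycle_left z v) * ampliation ?x ?z T"
    by (simp add: ampliation_def mult_mat_assoc kronecker_mult_complex)
  finally show "cocycle_left z (U x \<otimes>\<^sub>m v) * (cocycle_right x v \<otimes>\<^sub>m 1\<^sub>m ?z) * ampliation ?x ?z T =
      cocycle_right x (v \<otimes>\<^sub>m U z) * (1\<^sub>m ?x \<otimes>\<^sub>m cocycle_left z v) * ampliation ?x ?z T" .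
qed (use v in \<open>simp_all add: corep_kronecker\<close>)

text \<open>For two and three letters these operators are the components of \<open>\<Omega>\<close> and of
  \<open>(\<iota> \<otimes> Delta_hat)(\<Omega>) (1 \<otimes> \<Omega>)\<close>.\<close>

primrec iterated_cocycle :: "'i list \<Rightarrow> complex mat" where
  "iterated_cocycle [] = 1\<^sub>m 1"
| "iterated_cocycle (x # xs) = cocycle_right x (word xs) * (1\<^sub>m (irr_dim U x) \<otimes>\<^sub>m iterated_cocycle xs)"

lemma iterated_cocycle_dim [simp]:
  "dim_row (iterated_cocycle xs) = word_dim xs" "dim_col (iterated_cocycle xs) = word_dim xs"
  by (induction xs) auto

lemma iterated_cocycle_unitary: "unitary_mat (iterated_cocycle xs)"
  by (induction xs)
    (auto intro!: unitary_mat_mult unitary_mat_kronecker cocycle_left_right_unitary simp: unitary_mat_one)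

lemma cocycle_trivial_word:
  "cocycle_left z (word []) = 1\<^sub>m (irr_dim U z)" "cocycle_right x (word []) = 1\<^sub>m (irr_dim U x)"
  using cocycle_left_right_irreducible[of z \<epsilon>] cocycle_left_right_irreducible[of \<epsilon> x]
  using cocycle_left_right_irreducible(2)[of x \<epsilon>] by (simp_all add: trivial cocycle_unital)

lemma iterated_cocycle_small:
  "iterated_cocycle [x] = 1\<^sub>m (irr_dim U x)" "iterated_cocycle [y, z] = \<Omega> (y, z)"
  by (simp_all add: cocycle_trivial_word[simplified] word_singleton cocycle_left_right_irreducible)

text \<open>By the cocycle identity the iterated cocycle can also be built up from the last letter. This is what
  makes the functor below compatible with tensoring by identities from the right.\<close>

lemma iterated_cocycle_snoc:
  "iterated_cocycle (xs @ [z]) = cocycle_left z (word xs) * (iterated_cocycle xs \<otimes>\<^sub>m 1\<^sub>m (irr_dim U z))"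
proof (induction xs)
  case Nil
  then show ?case using iterated_cocycle_small(1)[of z] cocycle_trivial_word(1)[of z] by simp
next
  case (Cons x xs)
  let ?x = "irr_dim U x" and ?z = "irr_dim U z"
  have c: "corep (word xs \<otimes>\<^sub>m U z)" "corep (U x \<otimes>\<^sub>m word xs)" by (simp_all add: corep_kronecker)
  have "iterated_cocycle ((x # xs) @ [z]) = cocycle_right x (word xs \<otimes>\<^sub>m U z) *
      (1\<^sub>m ?x \<otimes>\<^sub>m (cocycle_left z (word xs) * (iterated_cocycle xs \<otimes>\<^sub>m 1\<^sub>m ?z)))"
    by (simp add: Cons.IH word_append word_singleton)
  also have "\<dots> = cocycle_right x (word xs \<otimes>\<^sub>m U z) * (1\<^sub>m ?x \<otimes>\<^sub>m cocycle_left z (word xs)) *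
      (1\<^sub>m ?x \<otimes>\<^sub>m (iterated_cocycle xs \<otimes>\<^sub>m 1\<^sub>m ?z))"
    using c by (simp add: mult_mat_assoc kronecker_mult_complex)
  also have "\<dots> = cocycle_left z (U x \<otimes>\<^sub>m word xs) * (cocycle_right x (word xs) \<otimes>\<^sub>m 1\<^sub>m ?z) *
      ((1\<^sub>m ?x \<otimes>\<^sub>m iterated_cocycle xs) \<otimes>\<^sub>m 1\<^sub>m ?z)"
    by (simp add: cocycle_identity kronecker_assoc)
  also have "\<dots> = cocycle_left z (word (x # xs)) * (iterated_cocycle (x # xs) \<otimes>\<^sub>m 1\<^sub>m ?z)"
    using c by (simp add: mult_mat_assoc kronecker_mult_complex word_Cons mult.assoc)
  finally show ?case .
qed

text \<open>Conjugation by the iterated cocycles. As the iterated cocycle of a single letter is \<open>1\<close>, this extends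
  the formula \<open>\<Omega>\<^sup>* S\<close> for intertwiners \<open>S\<close> from \<open>x\<close> to \<open>y \<otimes> z\<close>.\<close>

definition twisted :: "'i list \<Rightarrow> 'i list \<Rightarrow> complex mat \<Rightarrow> complex mat" where
  "twisted xs ys S = mat_adjoint (iterated_cocycle ys) * S * iterated_cocycle xs"

lemma twisted_dim [simp]:
  "dim_row (twisted xs ys S) = word_dim ys" "dim_col (twisted xs ys S) = word_dim xs"
  by (simp_all add: twisted_def)

lemma twisted_mult:
  assumes "S \<in> irr_mor U ys zs" "T \<in> irr_mor U xs ys"
  shows "twisted xs zs (S * T) = twisted ys zs S * twisted xs ys T"
proof -
  note [simp] = irr_mor_dim[OF assms(1)] irr_mor_dim[OF assms(2)]
  show ?thesis
    by (simp add: twisted_def mult_mat_assoc unitary_cancel_left'[OF iterated_cocycle_unitary])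
qed

text \<open>The outermost factor of the iterated cocycle is natural, so it passes through \<open>1 \<otimes> S\<close> or \<open>S \<otimes> 1\<close> and cancels
  with its adjoint.\<close>

lemma twisted_whisker_irreducible:
  assumes S: "S \<in> irr_mor U xs ys"
  shows "twisted (x # xs) (x # ys) (1\<^sub>m (irr_dim U x) \<otimes>\<^sub>m S) = 1\<^sub>m (irr_dim U x) \<otimes>\<^sub>m twisted xs ys S"
    "twisted (xs @ [z]) (ys @ [z]) (S \<otimes>\<^sub>m 1\<^sub>m (irr_dim U z)) = twisted xs ys S \<otimes>\<^sub>m 1\<^sub>m (irr_dim U z)"
proof -
  note [simp] = irr_mor_dim[OF S]
  let ?R = "cocycle_right x" and ?L = "cocycle_left z"
  let ?xS = "1\<^sub>m (irr_dim U x) \<otimes>\<^sub>m S" and ?Sz = "S \<otimes>\<^sub>m 1\<^sub>m (irr_dim U z)"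
  have S': "S \<in> Mor (word xs) (word ys)" using S by (simp add: irr_mor_word)
  have 1: "mat_adjoint (?R (word ys)) * (?xS * ?R (word xs)) = ?xS"
    unfolding cocycle_left_right_natural(2)[OF corep_word corep_word S', symmetric]
    by (rule unitary_cancel_left[OF cocycle_left_right_unitary(2)]) simp_all
  have 2: "mat_adjoint (?L (word ys)) * (?Sz * ?L (word xs)) = ?Sz"
    unfolding cocycle_left_right_natural(1)[OF corep_word corep_word S', symmetric]
    by (rule unitary_cancel_left[OF cocycle_left_right_unitary(1)]) simp_all
  have "twisted (x # xs) (x # ys) ?xS = (1\<^sub>m (irr_dim U x) \<otimes>\<^sub>m mat_adjoint (iterated_cocycle ys)) *
      (mat_adjoint (?R (word ys)) * (?xS * ?R (word xs))) * (1\<^sub>m (irr_dim U x) \<otimes>\<^sub>m iterated_cocycle xs)"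
    by (simp add: twisted_def mult_mat_assoc)
  also have "\<dots> = 1\<^sub>m (irr_dim U x) \<otimes>\<^sub>m twisted xs ys S"
    unfolding 1 by (simp add: kronecker_mult_complex twisted_def)
  finally show "twisted (x # xs) (x # ys) ?xS = 1\<^sub>m (irr_dim U x) \<otimes>\<^sub>m twisted xs ys S" .
  have "twisted (xs @ [z]) (ys @ [z]) ?Sz = (mat_adjoint (iterated_cocycle ys) \<otimes>\<^sub>m 1\<^sub>m (irr_dim U z)) *
      (mat_adjoint (?L (word ys)) * (?Sz * ?L (word xs))) * (iterated_cocycle xs \<otimes>\<^sub>m 1\<^sub>m (irr_dim U z))"
    by (simp add: twisted_def mult_mat_assoc iterated_cocycle_snoc del: iterated_cocycle.simps)
  also have "\<dots> = twisted xs ys S \<otimes>\<^sub>m 1\<^sub>m (irr_dim U z)"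
    unfolding 2 by (simp add: kronecker_mult_complex twisted_def)
  finally show "twisted (xs @ [z]) (ys @ [z]) ?Sz = twisted xs ys S \<otimes>\<^sub>m 1\<^sub>m (irr_dim U z)" .
qed

lemma twisted_whisker_left:
  assumes S: "S \<in> irr_mor U xs ys"
  shows "twisted (zs @ xs) (zs @ ys) (1\<^sub>m (word_dim zs) \<otimes>\<^sub>m S) = 1\<^sub>m (word_dim zs) \<otimes>\<^sub>m twisted xs ys S"
proof (induction zs)
  case (Cons z zs)
  have "1\<^sub>m (word_dim zs) \<otimes>\<^sub>m S \<in> irr_mor U (zs @ xs) (zs @ ys)"
    by (rule irr_mor_kronecker[OF irr_mor_one S])
  from twisted_whisker_irreducible(1)[OF this, of z] show ?case
    by (simp add: Cons.IH flip: kronecker_assoc)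
qed simp

lemma twisted_whisker_right:
  assumes "S \<in> irr_mor U xs ys"
  shows "twisted (xs @ zs) (ys @ zs) (S \<otimes>\<^sub>m 1\<^sub>m (word_dim zs)) = twisted xs ys S \<otimes>\<^sub>m 1\<^sub>m (word_dim zs)"
  using assms
proof (induction zs arbitrary: xs ys S)
  case (Cons z zs)
  have "S \<otimes>\<^sub>m 1\<^sub>m (irr_dim U z) \<in> irr_mor U (xs @ [z]) (ys @ [z])"
    by (rule irr_mor_kronecker[OF Cons.prems]) (use irr_mor_one[of "[z]"] in simp)
  from Cons.IH[OF this] show ?case
    by (simp add: twisted_whisker_irreducible(2)[OF Cons.prems] kronecker_assoc)
qed simp

text \<open>\<open>S \<otimes> T\<close> is the product of \<open>S \<otimes> 1\<close> and \<open>1 \<otimes> T\<close>.\<close>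

lemma twisted_kronecker:
  assumes S: "S \<in> irr_mor U xs ys" and T: "T \<in> irr_mor U xs' ys'"
  shows "twisted (xs @ xs') (ys @ ys') (S \<otimes>\<^sub>m T) = twisted xs ys S \<otimes>\<^sub>m twisted xs' ys' T"
proof -
  note [simp] = irr_mor_dim[OF S] irr_mor_dim[OF T]
  have 1: "1\<^sub>m (word_dim xs) \<otimes>\<^sub>m T \<in> irr_mor U (xs @ xs') (xs @ ys')"
    by (rule irr_mor_kronecker[OF irr_mor_one T])
  have 2: "S \<otimes>\<^sub>m 1\<^sub>m (word_dim ys') \<in> irr_mor U (xs @ ys') (ys @ ys')"
    by (rule irr_mor_kronecker[OF S irr_mor_one])
  have "S \<otimes>\<^sub>m T = (S \<otimes>\<^sub>m 1\<^sub>m (word_dim ys')) * (1\<^sub>m (word_dim xs) \<otimes>\<^sub>m T)"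
    by (simp add: kronecker_mult_complex)
  then have "twisted (xs @ xs') (ys @ ys') (S \<otimes>\<^sub>m T) =
      (twisted xs ys S \<otimes>\<^sub>m 1\<^sub>m (word_dim ys')) * (1\<^sub>m (word_dim xs) \<otimes>\<^sub>m twisted xs' ys' T)"
    using twisted_mult[OF 2 1] twisted_whisker_left[OF T] twisted_whisker_right[OF S] by simp
  then show ?thesis by (simp add: kronecker_mult_complex)
qed

definition twisted_functor :: "'i fiber_data" where
  "twisted_functor = \<lparr>fib_dim = irr_dim U, fib_map = (\<lambda>xs ys S.
     if xs \<noteq> [] \<and> ys \<noteq> [] \<and> S \<in> irr_mor U xs ys then twisted xs ys S else undefined)\<rparr>"

lemma twisted_functor_map:
  "xs \<noteq> [] \<Longrightarrow> ys \<noteq> [] \<Longrightarrow> S \<in> irr_mor U xs ys \<Longrightarrow> fib_map twisted_functor xs ys S = twisted xs ys S"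
  "\<not> (xs \<noteq> [] \<and> ys \<noteq> [] \<and> S \<in> irr_mor U xs ys) \<Longrightarrow> fib_map twisted_functor xs ys S = undefined"
  by (auto simp: twisted_functor_def)

lemma twisted_functor_dimension_preserving: "dimension_preserving twisted_functor"
proof -
  have d: "fib_dim twisted_functor = irr_dim U" by (simp add: twisted_functor_def)
  have linear: "twisted xs ys (S + T) = twisted xs ys S + twisted xs ys T"
    "twisted xs ys (c \<cdot>\<^sub>m S) = c \<cdot>\<^sub>m twisted xs ys S"
    if "S \<in> irr_mor U xs ys" "T \<in> irr_mor U xs ys" for xs ys S T c
    using irr_mor_dim[OF that(1)] irr_mor_dim[OF that(2)]
    by (simp_all add: twisted_def mat_mult_add_left mat_mult_add_right mat_mult_smult_left mat_mult_smult_right)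
  have adjoint: "twisted ys xs (mat_adjoint S) = mat_adjoint (twisted xs ys S)" if "S \<in> irr_mor U xs ys" for xs ys S
    using irr_mor_dim[OF that] by (simp add: twisted_def mult_mat_assoc)
  have one: "1\<^sub>m (irr_dim U x) \<in> irr_mor U [x] [x]" "1\<^sub>m (irr_dim U x) \<in> irr_mor U [x] [x, \<epsilon>]"
    "1\<^sub>m (irr_dim U x) \<in> irr_mor U [x] [\<epsilon>, x]" for x
    using irr_mor_one[of "[x]"] irr_mor_trivial_right[of "[x]" "[x]"] irr_mor_trivial_left[of "[x]" "[x]"] by simp_all
  have unital: "twisted [x] [x] (1\<^sub>m (irr_dim U x)) = 1\<^sub>m (irr_dim U x)"
    "twisted [x] [x, \<epsilon>] (1\<^sub>m (irr_dim U x)) = 1\<^sub>m (irr_dim U x)"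
    "twisted [x] [\<epsilon>, x] (1\<^sub>m (irr_dim U x)) = 1\<^sub>m (irr_dim U x)" for x
    by (simp_all only: twisted_def iterated_cocycle_small cocycle_unital)
      simp_all
  have "unitary_fiber_functor U \<epsilon> twisted_functor"
    unfolding unitary_fiber_functor_def Let_def d
  proof (intro conjI allI impI)
    show "irr_dim U \<epsilon> = 1" by (rule irr_dim_trivial)
    fix xs ys :: "'i list" and S T :: "complex mat" and x :: 'i
    show "fib_map twisted_functor [x] [x] (1\<^sub>m (irr_dim U x)) = 1\<^sub>m (irr_dim U x)"
      "fib_map twisted_functor [x] [x, \<epsilon>] (1\<^sub>m (irr_dim U x)) = 1\<^sub>m (irr_dim U x)"
      "fib_map twisted_functor [x] [\<epsilon>, x] (1\<^sub>m (irr_dim U x)) = 1\<^sub>m (irr_dim U x)"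
      by (simp_all add: twisted_functor_map one unital)
    show "fib_map twisted_functor xs ys S = undefined"
      if "\<not> (xs \<noteq> [] \<and> ys \<noteq> [] \<and> S \<in> irr_mor U xs ys)"
      by (rule twisted_functor_map(2)[OF that])
    assume "xs \<noteq> [] \<and> ys \<noteq> [] \<and> S \<in> irr_mor U xs ys"
    then have xs: "xs \<noteq> []" and ys: "ys \<noteq> []" and S: "S \<in> irr_mor U xs ys" by auto
    show "fib_map twisted_functor xs ys S \<in> carrier_mat (word_dim ys) (word_dim xs)"
      by (rule carrier_matI; simp add: twisted_functor_map xs ys S)
    show "fib_map twisted_functor xs ys (c \<cdot>\<^sub>m S) = c \<cdot>\<^sub>m fib_map twisted_functor xs ys S" for c
      using Mor_smult[of "word xs" "word ys" S c] S
      by (simp add: twisted_functor_map xs ys linear(2)[OF S S] irr_mor_word)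
    show "fib_map twisted_functor ys xs (mat_adjoint S) = mat_adjoint (fib_map twisted_functor xs ys S)"
      by (simp add: twisted_functor_map xs ys S irr_mor_adjoint adjoint)
    show "fib_map twisted_functor xs ys (S + T) = fib_map twisted_functor xs ys S + fib_map twisted_functor xs ys T"
      if "xs \<noteq> [] \<and> ys \<noteq> [] \<and> T \<in> irr_mor U xs ys"
      using Mor_add[of "word xs" "word ys" S T] S that
      by (simp add: twisted_functor_map xs ys linear(1)[OF S] irr_mor_word)
    show "fib_map twisted_functor (xs @ xs') (ys @ ys') (S \<otimes>\<^sub>m T) =
        fib_map twisted_functor xs ys S \<otimes>\<^sub>m fib_map twisted_functor xs' ys' T"
      if "xs' \<noteq> [] \<and> ys' \<noteq> [] \<and> T \<in> irr_mor U xs' ys'" for xs' ys'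
      using that by (simp add: twisted_functor_map xs ys S irr_mor_kronecker twisted_kronecker)
    show "fib_map twisted_functor ws ys (S * T) =
        fib_map twisted_functor xs ys S * fib_map twisted_functor ws xs T"
      if "ws \<noteq> [] \<and> xs \<noteq> [] \<and> T \<in> irr_mor U ws xs" for ws
      using that irr_mor_mult[OF S] twisted_mult[OF S] by (simp add: twisted_functor_map xs ys S)
  qed
  then show ?thesis using d by (simp add: dimension_preserving_def)
qed

lemma twisted_functor_binary:
  assumes "S \<in> irr_mor U [x] [y, z]"
  shows "fib_map twisted_functor [x] [y, z] S = mat_adjoint (\<Omega> (y, z)) * S"
  using irr_mor_dim[OF assms]
  by (simp add: twisted_functor_map assms twisted_def iterated_cocycle_small del: iterated_cocycle.simps)

lemma twisted_functor_ternary: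
  assumes "T \<in> irr_mor U [a] [x, y, z]"
  shows "fib_map twisted_functor [a] [x, y, z] T = mat_adjoint (cocycle_2 U \<Omega> (x, y, z)) * T"
proof -
  have "cocycle_2 U \<Omega> (x, y, z) = (id_Delta_hat U \<Omega> \<star> one_tensor U \<Omega>) (x, y, z)"
    using cocycle by (simp add: cocycle_2_def unitary_2_cocycle_def)
  also have "\<dots> = iterated_cocycle (x # [y, z])"
    unfolding iterated_cocycle.simps(2)[of x "[y, z]"] iterated_cocycle_small
    by (simp add: family_mult_def one_tensor_def id_Delta_hat_eq[OF cocycle_family] cocycle_right_def word_Cons
        del: iterated_cocycle.simps)
  finally show ?thesis
    using irr_mor_dim[OF assms]
    by (simp add: twisted_functor_map assms twisted_def iterated_cocycle_small del: iterated_cocycle.simps)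
qed

text \<open>The definite description denotes: the functor just constructed has the required values, and a
  functor is determined by its values on the intertwiners from \<open>x\<close> to \<open>y \<otimes> z\<close>.\<close>

lemma cocycle_fiber_functor_eq: "cocycle_fiber_functor U \<epsilon> \<Omega> = twisted_functor"
  unfolding cocycle_fiber_functor_def
proof (rule the_equality)
  show "unitary_fiber_functor U \<epsilon> twisted_functor \<and> fib_dim twisted_functor = irr_dim U \<and>
    (\<forall>x y z. \<forall>S \<in> irr_mor U [x] [y, z]. fib_map twisted_functor [x] [y, z] S = mat_adjoint (\<Omega> (y, z)) * S) \<and>
    (\<forall>a x y z. \<forall>T \<in> irr_mor U [a] [x, y, z].
        fib_map twisted_functor [a] [x, y, z] T = mat_adjoint (cocycle_2 U \<Omega> (x, y, z)) * T)"
    using twisted_functor_dimension_preserving twisted_functor_binary twisted_functor_ternary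
    by (auto simp: dimension_preserving_def)
  fix \<psi> assume "unitary_fiber_functor U \<epsilon> \<psi> \<and> fib_dim \<psi> = irr_dim U \<and>
    (\<forall>x y z. \<forall>S \<in> irr_mor U [x] [y, z]. fib_map \<psi> [x] [y, z] S = mat_adjoint (\<Omega> (y, z)) * S) \<and>
    (\<forall>a x y z. \<forall>T \<in> irr_mor U [a] [x, y, z].
        fib_map \<psi> [a] [x, y, z] T = mat_adjoint (cocycle_2 U \<Omega> (x, y, z)) * T)"
  then show "\<psi> = twisted_functor"
    by (intro functor_determined[OF _ twisted_functor_dimension_preserving])
      (auto simp: dimension_preserving_def twisted_functor_binary)
qed

lemma cocycle_fiber_functor:
  "dimension_preserving (cocycle_fiber_functor U \<epsilon> \<Omega>)"
  "S \<in> irr_mor U [x] [y, z] \<Longrightarrow>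
    fib_map (cocycle_fiber_functor U \<epsilon> \<Omega>) [x] [y, z] S = mat_adjoint (\<Omega> (y, z)) * S"
  by (simp_all add: cocycle_fiber_functor_eq twisted_functor_dimension_preserving twisted_functor_binary)

end

end


section \<open>Unitary families are multipliers\<close>

lemma hilbert_norm_unitary:
  assumes M: "M \<in> carrier_mat n n" "unitary_mat M" and v: "v \<in> carrier_vec n"
  shows "hilbert_norm (M *\<^sub>v v) = hilbert_norm v"
proof -
  have adj: "(M *\<^sub>v v) \<bullet>c w = v \<bullet>c (mat_adjoint M *\<^sub>v w)" if w: "w \<in> carrier_vec n" for w
  proof -
    have "(M *\<^sub>v v) \<bullet>c w = (\<Sum>i<n. \<Sum>j<n. M $$ (i, j) * v $ j * cnj (w $ i))"
      using M v w by (simp add: scalar_prod_def lessThan_atLeast0 sum_distrib_right)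
    also have "\<dots> = (\<Sum>j<n. \<Sum>i<n. M $$ (i, j) * v $ j * cnj (w $ i))" by (rule sum.swap)
    also have "\<dots> = v \<bullet>c (mat_adjoint M *\<^sub>v w)"
      using M v w by (simp add: scalar_prod_def lessThan_atLeast0 sum_distrib_left mult_ac)
    finally show ?thesis .
  qed
  have cancel: "mat_adjoint M *\<^sub>v (M *\<^sub>v v) = v"
    using M v by (simp add: unitary_mat_def flip: assoc_mult_mat_vec[of _ n n])
  have "M *\<^sub>v v \<in> carrier_vec n" using M(1) v by simp
  from adj[OF this] have "(M *\<^sub>v v) \<bullet>c (M *\<^sub>v v) = v \<bullet>c v" unfolding cancel .
  then show ?thesis by (simp only: hilbert_norm_def)
qed

lemma operator_norm_unitary:
  assumes M: "M \<in> carrier_mat n n" "unitary_mat M" and S: "S \<in> carrier_mat n n"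
  shows "operator_norm (M * S) = operator_norm S" "operator_norm (S * M) = operator_norm S"
proof -
  have 0: "hilbert_norm (M * S *\<^sub>v v) = hilbert_norm (S *\<^sub>v v)" if "v \<in> carrier_vec n" for v
    using hilbert_norm_unitary[OF M, of "S *\<^sub>v v"] M S that by (simp add: assoc_mult_mat_vec[of _ n n])
  have "{hilbert_norm (M * S *\<^sub>v v) |v. v \<in> carrier_vec (dim_col (M * S)) \<and> hilbert_norm v \<le> 1} =
      {hilbert_norm (S *\<^sub>v v) |v. v \<in> carrier_vec (dim_col S) \<and> hilbert_norm v \<le> 1}"
  proof (intro Collect_cong ex_cong1)
    show "r = hilbert_norm (M * S *\<^sub>v v) \<and> v \<in> carrier_vec (dim_col (M * S)) \<and> hilbert_norm v \<le> 1 \<longleftrightarrow>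
        r = hilbert_norm (S *\<^sub>v v) \<and> v \<in> carrier_vec (dim_col S) \<and> hilbert_norm v \<le> 1" for r v
      using 0[of v] S by (metis carrier_matD(2) index_mult_mat(3))
  qed
  then show "operator_norm (M * S) = operator_norm S" by (simp only: operator_norm_def)
  have M': "mat_adjoint M \<in> carrier_mat n n" "unitary_mat (mat_adjoint M)"
    using M unitary_mat_adjoint by auto
  have 1: "\<exists>w. w \<in> carrier_vec n \<and> hilbert_norm w \<le> 1 \<and> S * M *\<^sub>v v = S *\<^sub>v w"
    if "v \<in> carrier_vec n" "hilbert_norm v \<le> 1" for v
    using hilbert_norm_unitary[OF M that(1)] M S that
    by (intro exI[of _ "M *\<^sub>v v"]) (simp add: assoc_mult_mat_vec[of _ n n])
  have 2: "\<exists>v. v \<in> carrier_vec n \<and> hilbert_norm v \<le> 1 \<and> S *\<^sub>v w = S * M *\<^sub>v v"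
    if "w \<in> carrier_vec n" "hilbert_norm w \<le> 1" for w
  proof -
    have "M *\<^sub>v (mat_adjoint M *\<^sub>v w) = w"
      using M that by (simp add: unitary_mat_def flip: assoc_mult_mat_vec[of _ n n])
    then have "S * M *\<^sub>v (mat_adjoint M *\<^sub>v w) = S *\<^sub>v w"
      using M that S by (simp add: assoc_mult_mat_vec[of _ n n])
    then show ?thesis
      using hilbert_norm_unitary[OF M' that(1)] M' that by (intro exI[of _ "mat_adjoint M *\<^sub>v w"]) auto
  qed
  have "{hilbert_norm (S * M *\<^sub>v v) |v. v \<in> carrier_vec (dim_col (S * M)) \<and> hilbert_norm v \<le> 1} =
      {hilbert_norm (S *\<^sub>v v) |v. v \<in> carrier_vec (dim_col S) \<and> hilbert_norm v \<le> 1}"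
  proof (intro subset_antisym subsetI)
    fix r assume "r \<in> {hilbert_norm (S * M *\<^sub>v v) |v. v \<in> carrier_vec (dim_col (S * M)) \<and> hilbert_norm v \<le> 1}"
    then obtain v where v: "v \<in> carrier_vec n" "hilbert_norm v \<le> 1" "r = hilbert_norm (S * M *\<^sub>v v)"
      using M S by auto
    show "r \<in> {hilbert_norm (S *\<^sub>v v) |v. v \<in> carrier_vec (dim_col S) \<and> hilbert_norm v \<le> 1}"
      using 1[OF v(1,2)] v(3) S by auto
  next
    fix r assume "r \<in> {hilbert_norm (S *\<^sub>v v) |v. v \<in> carrier_vec (dim_col S) \<and> hilbert_norm v \<le> 1}"
    then obtain w where w: "w \<in> carrier_vec n" "hilbert_norm w \<le> 1" "r = hilbert_norm (S *\<^sub>v w)"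
      using S by auto
    show "r \<in> {hilbert_norm (S * M *\<^sub>v v) |v. v \<in> carrier_vec (dim_col (S * M)) \<and> hilbert_norm v \<le> 1}"
    proof -
      obtain v where "v \<in> carrier_vec n" "hilbert_norm v \<le> 1" "S *\<^sub>v w = S * M *\<^sub>v v"
        using 2[OF w(1,2)] by blast
      then show ?thesis using w(3) M(1) by (intro CollectI exI[of _ v]) auto
    qed
  qed
  then show "operator_norm (S * M) = operator_norm S" by (simp only: operator_norm_def)
qed

text \<open>Multiplication by unitaries preserves operator norms, hence the \<open>c\<^sub>0\<close> condition.\<close>

lemma unitary_multiplierI:
  assumes m: "m \<in> families d" and unitary: "\<And>j. unitary_mat (m j)"
  shows "unitary_multiplier d m"
proof -
  have mj: "m j \<in> carrier_mat (d j) (d j)" for j using m by (simp add: families_def)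
  have "m \<star> a \<in> c0_sum d" "a \<star> m \<in> c0_sum d" if a: "a \<in> c0_sum d" for a
  proof -
    have aj: "a j \<in> carrier_mat (d j) (d j)" for j using a by (simp add: c0_sum_def families_def)
    have "operator_norm (m j * a j) = operator_norm (a j)" "operator_norm (a j * m j) = operator_norm (a j)" for j
      by (rule operator_norm_unitary[OF mj unitary aj])+
    then show "m \<star> a \<in> c0_sum d" "a \<star> m \<in> c0_sum d"
      using a mult_carrier_mat[OF mj aj] mult_carrier_mat[OF aj mj]
      by (simp_all add: c0_sum_def families_def family_mult_def)
  qed
  then have "m \<in> multipliers d" using m by (simp add: multipliers_def)
  moreover have "dim_row (m j) = d j" "dim_col (m j) = d j" for j using mj[of j] by auto
  ultimately show ?thesis
    using unitary by (simp add: unitary_multiplier_def family_mult_def family_adjoint_def family_one_def unitary_mat_def)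
qed


section \<open>Existence and uniqueness\<close>

lemma kronecker_list_simps: "kronecker_list [] = 1\<^sub>m 1" "kronecker_list (A # As) = A \<otimes>\<^sub>m kronecker_list As"
  by (simp_all add: kronecker_list_def)

lemma kronecker_list_one: "kronecker_list (map (\<lambda>x. 1\<^sub>m (d x)) xs) = 1\<^sub>m (prod_list (map d xs))"
  by (induction xs) (simp_all add: kronecker_list_simps)

context compact_quantum_group_irreps
begin

lemma functor_cocycle_cocycle:
  assumes \<phi>: "dimension_preserving \<phi>"
  shows "unitary_2_cocycle U (functor_cocycle \<phi>)" "normalized U \<epsilon> (functor_cocycle \<phi>)"
proof -
  have "unitary_mat (functor_cocycle \<phi> yz)" for yz
    using structure_unitary_unitary[OF \<phi>] by (cases yz) (simp add: functor_cocycle_def unitary_mat_adjoint)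
  then have "unitary_multiplier (irr_dim2 U) (functor_cocycle \<phi>)"
    by (rule unitary_multiplierI[OF functor_cocycle_family[OF \<phi>]])
  moreover have "Delta_hat_id U (functor_cocycle \<phi>) \<star> tensor_one U (functor_cocycle \<phi>) =
      id_Delta_hat U (functor_cocycle \<phi>) \<star> one_tensor U (functor_cocycle \<phi>)"
    by (rule ext) (auto simp: family_mult_def functor_cocycle_triple[OF \<phi>])
  ultimately show "unitary_2_cocycle U (functor_cocycle \<phi>)" by (simp add: unitary_2_cocycle_def)
  have zero: "(0\<^sub>m a b \<otimes>\<^sub>m A) = 0\<^sub>m (a * dim_row A) (b * dim_col A)"
    "(A \<otimes>\<^sub>m 0\<^sub>m a b) = 0\<^sub>m (dim_row A * a) (dim_col A * b)" for a b and A :: "complex mat"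
    by (rule eq_matI; simp add: div_mod_bounds)+
  have "dim_row (functor_cocycle \<phi> (y, z)) = irr_dim U y * irr_dim U z" for y z
    using functor_cocycle_family[OF \<phi>] by (auto simp: families_def irr_dim2_def)
  moreover have "functor_cocycle \<phi> (\<epsilon>, z) = 1\<^sub>m (irr_dim U z)" "functor_cocycle \<phi> (z, \<epsilon>) = 1\<^sub>m (irr_dim U z)" for z
    by (simp_all add: functor_cocycle_def structure_unitary_unital[OF \<phi>])
  moreover have "dim_col (functor_cocycle \<phi> (y, z)) = irr_dim U y * irr_dim U z" for y z
    using functor_cocycle_family[OF \<phi>] by (auto simp: families_def irr_dim2_def)
  ultimately show "normalized U \<epsilon> (functor_cocycle \<phi>)"
    by (auto simp: normalized_def Let_def family_mult_def family_tensor_def central_projection_def family_one_def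
        irr_dim_trivial zero fun_eq_iff)
qed

lemma isomorphic_refl:
  assumes \<phi>: "dimension_preserving \<phi>"
  shows "isomorphic_fiber_functors U \<phi> \<phi>"
  unfolding isomorphic_fiber_functors_def
proof (intro exI[of _ "\<lambda>x. 1\<^sub>m (irr_dim U x)"] conjI allI impI ballI)
  show "1\<^sub>m (irr_dim U x) \<in> carrier_mat (fib_dim \<phi> x) (fib_dim \<phi> x)" "unitary_mat (1\<^sub>m (irr_dim U x))" for x
    using \<phi> by (auto simp: dimension_preserving_def unitary_mat_one)
  show "fib_map \<phi> xs ys S = kronecker_list (map (\<lambda>x. 1\<^sub>m (irr_dim U x)) ys) * fib_map \<phi> xs ys S *
      kronecker_list (map (\<lambda>x. mat_adjoint (1\<^sub>m (irr_dim U x))) xs)"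
    if "xs \<noteq> []" "ys \<noteq> []" "S \<in> irr_mor U xs ys" for xs ys S
    using functor_dim[OF \<phi> that] by (simp add: kronecker_list_one)
qed

lemma isomorphic_binary:
  assumes \<phi>: "dimension_preserving \<phi>" and \<psi>: "dimension_preserving \<psi>"
    and iso: "isomorphic_fiber_functors U \<phi> \<psi>"
  obtains u where "\<And>x. u x \<in> carrier_mat (irr_dim U x) (irr_dim U x)" "\<And>x. unitary_mat (u x)"
    "\<And>x y z S. S \<in> irr_mor U [x] [y, z] \<Longrightarrow>
      fib_map \<psi> [x] [y, z] S = (u y \<otimes>\<^sub>m u z) * fib_map \<phi> [x] [y, z] S * mat_adjoint (u x)"
proof -
  obtain u where u: "(\<forall>x. u x \<in> carrier_mat (fib_dim \<psi> x) (fib_dim \<phi> x) \<and> unitary_mat (u x)) \<and>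
      (\<forall>xs ys. xs \<noteq> [] \<longrightarrow> ys \<noteq> [] \<longrightarrow> (\<forall>S \<in> irr_mor U xs ys.
      fib_map \<psi> xs ys S = kronecker_list (map u ys) * fib_map \<phi> xs ys S *
        kronecker_list (map (\<lambda>x. mat_adjoint (u x)) xs)))"
    using iso unfolding isomorphic_fiber_functors_def by (rule exE)
  note carrier = conjunct1[OF u] and conjugate = conjunct2[OF u]
  show ?thesis
  proof (rule that)
    show "u x \<in> carrier_mat (irr_dim U x) (irr_dim U x)" for x
      using carrier \<phi> \<psi> by (simp add: dimension_preserving_def)
    show "unitary_mat (u x)" for x using carrier by simp
    show "fib_map \<psi> [x] [y, z] S = (u y \<otimes>\<^sub>m u z) * fib_map \<phi> [x] [y, z] S * mat_adjoint (u x)"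
      if "S \<in> irr_mor U [x] [y, z]" for x y z S
      using conjugate[rule_format, of "[x]" "[y, z]" S] that by (simp add: kronecker_list_simps)
  qed
qed

text \<open>Both functors are obtained from \<open>\<phi>\<close> by conjugation with unitaries \<open>u\<^sub>1\<close> and \<open>u\<^sub>2\<close>. For
  \<open>w = u\<^sub>2 u\<^sub>1\<^sup>*\<close> this gives \<open>\<Omega>\<^sub>2\<^sup>* S = (w \<otimes> w) \<Omega>\<^sub>1\<^sup>* S w\<^sup>* = (w \<otimes> w) \<Omega>\<^sub>1\<^sup>* Delta_hat(w)\<^sup>* S\<close> for all intertwiners
  \<open>S\<close> from \<open>x\<close> to \<open>y \<otimes> z\<close>.\<close>

lemma isomorphic_cocycles_differ_by_coboundary:
  assumes \<phi>: "dimension_preserving \<phi>"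
    and 1: "unitary_2_cocycle U \<Omega>\<^sub>1" "normalized U \<epsilon> \<Omega>\<^sub>1"
      "isomorphic_fiber_functors U \<phi> (cocycle_fiber_functor U \<epsilon> \<Omega>\<^sub>1)"
    and 2: "unitary_2_cocycle U \<Omega>\<^sub>2" "normalized U \<epsilon> \<Omega>\<^sub>2"
      "isomorphic_fiber_functors U \<phi> (cocycle_fiber_functor U \<epsilon> \<Omega>\<^sub>2)"
  shows "differ_by_coboundary U \<Omega>\<^sub>1 \<Omega>\<^sub>2"
proof -
  obtain u\<^sub>1 where u1: "\<And>x. u\<^sub>1 x \<in> carrier_mat (irr_dim U x) (irr_dim U x)" "\<And>x. unitary_mat (u\<^sub>1 x)"
    "\<And>x y z S. S \<in> irr_mor U [x] [y, z] \<Longrightarrow>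
      mat_adjoint (\<Omega>\<^sub>1 (y, z)) * S = (u\<^sub>1 y \<otimes>\<^sub>m u\<^sub>1 z) * fib_map \<phi> [x] [y, z] S * mat_adjoint (u\<^sub>1 x)"
    using isomorphic_binary[OF \<phi> cocycle_fiber_functor(1)[OF 1(1,2)] 1(3)] cocycle_fiber_functor(2)[OF 1(1,2)]
    by metis
  obtain u\<^sub>2 where u2: "\<And>x. u\<^sub>2 x \<in> carrier_mat (irr_dim U x) (irr_dim U x)" "\<And>x. unitary_mat (u\<^sub>2 x)"
    "\<And>x y z S. S \<in> irr_mor U [x] [y, z] \<Longrightarrow>
      mat_adjoint (\<Omega>\<^sub>2 (y, z)) * S = (u\<^sub>2 y \<otimes>\<^sub>m u\<^sub>2 z) * fib_map \<phi> [x] [y, z] S * mat_adjoint (u\<^sub>2 x)"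
    using isomorphic_binary[OF \<phi> cocycle_fiber_functor(1)[OF 2(1,2)] 2(3)] cocycle_fiber_functor(2)[OF 2(1,2)]
    by metis
  note [simp] = carrier_matD[OF u1(1)] carrier_matD[OF u2(1)] cocycle_dim[OF 1(1,2)] cocycle_dim[OF 2(1,2)]
  define w where "w = (\<lambda>x. u\<^sub>2 x * mat_adjoint (u\<^sub>1 x))"
  have w_dim [simp]: "dim_row (w x) = irr_dim U x" "dim_col (w x) = irr_dim U x" for x by (simp_all add: w_def)
  have w: "w \<in> families (irr_dim U)" by (auto simp: families_def intro!: carrier_matI)
  have w_multiplier: "unitary_multiplier (irr_dim U) w"
    by (rule unitary_multiplierI[OF w])
      (simp add: w_def unitary_mat_mult unitary_mat_adjoint u1(2) u2(2))
  have "\<Omega>\<^sub>2 (y, z) = Delta_hat U w (y, z) * \<Omega>\<^sub>1 (y, z) * (mat_adjoint (w y) \<otimes>\<^sub>m mat_adjoint (w z))" for y z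
  proof -
    let ?D = "Delta_hat U w (y, z)"
    have c: "corep (U y \<otimes>\<^sub>m U z)" by (rule corep_kronecker) simp_all
    have fam: "ampliated_family 1 1 w" by (auto simp: ampliated_family_def intro!: carrier_matI)
    have [simp]: "dim_row ?D = irr_dim U y * irr_dim U z" "dim_col ?D = irr_dim U y * irr_dim U z"
      using Delta_hat(1)[OF w, of y z] by (auto simp: irr_dim2_def)
    have "mat_adjoint (\<Omega>\<^sub>2 (y, z)) = (w y \<otimes>\<^sub>m w z) * mat_adjoint (\<Omega>\<^sub>1 (y, z)) * mat_adjoint ?D"
    proof (rule intertwiners_separate_word[where ys = "[y, z]"])
      fix x S assume S: "S \<in> irr_mor U [x] [y, z]"
      note [simp] = irr_mor_dim[OF S] functor_dim[OF \<phi> _ _ S]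
      let ?F = "fib_map \<phi> [x] [y, z] S"
      have uu: "unitary_mat (u\<^sub>1 y \<otimes>\<^sub>m u\<^sub>1 z)" by (rule unitary_mat_kronecker[OF u1(2) u1(2)])
      have DS: "mat_adjoint ?D * S = S * mat_adjoint (w x)"
        using natural_extension_adjoint[OF c fam, of S x] S
        by (simp add: Delta_hat_eq[OF w] irr_mor_singleton word_Cons ampliation_trivial)
      have "(w y \<otimes>\<^sub>m w z) * mat_adjoint (\<Omega>\<^sub>1 (y, z)) * mat_adjoint ?D * S =
          (w y \<otimes>\<^sub>m w z) * ((mat_adjoint (\<Omega>\<^sub>1 (y, z)) * S) * mat_adjoint (w x))"
        by (simp add: mult_mat_assoc DS)
      also have "\<dots> = (u\<^sub>2 y \<otimes>\<^sub>m u\<^sub>2 z) * (mat_adjoint (u\<^sub>1 y \<otimes>\<^sub>m u\<^sub>1 z) * ((u\<^sub>1 y \<otimes>\<^sub>m u\<^sub>1 z) *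
          (?F * ((mat_adjoint (u\<^sub>1 x) * u\<^sub>1 x) * mat_adjoint (u\<^sub>2 x)))))"
        unfolding u1(3)[OF S] by (simp add: w_def mult_mat_assoc flip: kronecker_mult_complex)
      also have "\<dots> = mat_adjoint (\<Omega>\<^sub>2 (y, z)) * S"
        unfolding u2(3)[OF S] using unitary_matD(1)[OF u1(2)[of x]]
        by (subst unitary_cancel_left[OF uu]) (simp_all add: mult_mat_assoc)
      finally show "mat_adjoint (\<Omega>\<^sub>2 (y, z)) * S =
          (w y \<otimes>\<^sub>m w z) * mat_adjoint (\<Omega>\<^sub>1 (y, z)) * mat_adjoint ?D * S" by simp
    qed simp_all
    then have "mat_adjoint (mat_adjoint (\<Omega>\<^sub>2 (y, z))) =
        mat_adjoint ((w y \<otimes>\<^sub>m w z) * mat_adjoint (\<Omega>\<^sub>1 (y, z)) * mat_adjoint ?D)" by simp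
    then show ?thesis by (simp add: mult_mat_assoc)
  qed
  then have "\<Omega>\<^sub>2 = Delta_hat U w \<star> \<Omega>\<^sub>1 \<star> family_tensor (family_adjoint w) (family_adjoint w)"
    by (auto simp: fun_eq_iff family_mult_def family_tensor_def family_adjoint_def)
  then show ?thesis using w_multiplier by (auto simp: differ_by_coboundary_def)
qed

end

theorem proposition4p5:
  fixes tens :: "'a::cstar_algebra \<Rightarrow> 'a \<Rightarrow> 'b::cstar_algebra"
    and tensL :: "'b \<Rightarrow> 'a \<Rightarrow> 'c::cstar_algebra"
    and tensR :: "'a \<Rightarrow> 'b \<Rightarrow> 'c"
    and Delta :: "'a \<Rightarrow> 'b"
    and U :: "'i \<Rightarrow> 'a mat"
    and \<epsilon> :: 'i
    and \<phi> :: "'i fiber_data"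
  assumes "compact_quantum_group_irreps tens tensL tensR Delta U \<epsilon>"
    and "unitary_fiber_functor U \<epsilon> \<phi>"
    and "\<And>x. fib_dim \<phi> x = irr_dim U x"
  shows "(\<exists>\<Omega>. unitary_2_cocycle U \<Omega> \<and> normalized U \<epsilon> \<Omega> \<and>
            isomorphic_fiber_functors U \<phi> (cocycle_fiber_functor U \<epsilon> \<Omega>)) \<and>
         (\<forall>\<Omega>\<^sub>1 \<Omega>\<^sub>2.
            unitary_2_cocycle U \<Omega>\<^sub>1 \<and> normalized U \<epsilon> \<Omega>\<^sub>1 \<and>
            isomorphic_fiber_functors U \<phi> (cocycle_fiber_functor U \<epsilon> \<Omega>\<^sub>1) \<and>
            unitary_2_cocycle U \<Omega>\<^sub>2 \<and> normalized U \<epsilon> \<Omega>\<^sub>2 \<and>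
            isomorphic_fiber_functors U \<phi> (cocycle_fiber_functor U \<epsilon> \<Omega>\<^sub>2) \<longrightarrow>
            differ_by_coboundary U \<Omega>\<^sub>1 \<Omega>\<^sub>2)"
proof -
  interpret compact_quantum_group_irreps tens tensL tensR Delta U \<epsilon> by fact
  have \<phi>: "dimension_preserving \<phi>"
    using assms(2,3) by (auto simp: dimension_preserving_def)
  have "unitary_2_cocycle U (functor_cocycle \<phi>) \<and> normalized U \<epsilon> (functor_cocycle \<phi>) \<and>
      isomorphic_fiber_functors U \<phi> (cocycle_fiber_functor U \<epsilon> (functor_cocycle \<phi>))"
    using functor_cocycle_cocycle[OF \<phi>] isomorphic_refl[OF \<phi>] by (simp add: functor_cocycle_functor[OF \<phi>])
  then show ?thesis
    using isomorphic_cocycles_differ_by_coboundary[OF \<phi>] by blast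
qed

end
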